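(* Let $G$ be a connected semi-balanced plane directed graph with the ribbon structure given by the positive orientation of the plane, and fix any basis. Then the simplices $\mathcal{Q}_T$ of the Jaeger trees $T$ of $G$ form a triangulation of the root polytope $\mathcal{Q}_G$.
   Context: A directed graph is an orientation of a finite graph without loops and multiple edges; $\overrightarrow{th}$ denotes an edge with tail $t$ and head $h$, and $xy$ an edge whose orientation is not specified. Connectedness, cycles and spanning trees are meant in the underlying undirected graph. A cycle is semi-balanced if it has the same number of edges going in the two directions around the cycle; a directed graph is semi-balanced if all of its cycles are semi-balanced. A plane graph is a graph embedded in the plane without edge crossings. For a directed graph $G=(V,E)$ let $\mathbf{v}\in\mathbf{R}^V$ be the standard basis vector of $v\in V$. The root polytope is $\mathcal{Q}_G=\mathrm{Conv}\{\mathbf{h}-\mathbf{t}\mid \overrightarrow{th}\in E\}\subset\mathbf{R}^V$; for a spanning tree $T$, $\mathcal{Q}_T=\mathrm{Conv}\{\mathbf{h}-\mathbf{t}\mid \overrightarrow{th}\in T\}$ (a simplex). A ribbon structure on $G$ is a choice, for each vertex $x$, of a cyclic permutation of the edges incident to $x$ (here: the counterclockwise cyclic order around $x$ in the plane); $xy^+$ denotes the edge following $xy$ at $x$, and $yx^+$ the edge following $yx$ at $y$. A basis is a pair $(b_0,b_0b_1)$ where $b_0$ is a vertex and $b_0b_1$ is an edge incident to $b_0$. The tour of a spanning tree $T$ is the sequence of node-edge pairs starting with $(b_0,b_0b_1)$ such that if the current pair is $(x,xy)$ and $xy\notin T$ then the next pair is $(x,xy^+)$, while if $xy\in T$ then the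 next pair is $(y,yx^+)$; it stops right before $(b_0,b_0b_1)$ would become current again. A spanning tree $T$ is a Jaeger tree if for each edge $\overrightarrow{th}\notin T$ the pair $(t,th)$ precedes $(h,th)$ in the tour of $T$. A dissection of a polytope is a set of mutually interior-disjoint maximal dimensional simplices whose union is the polytope; a triangulation is a dissection in which any two simplices intersect in a (possibly empty) common face. *)

theory Defs
  imports "HOL-Analysis.Analysis" "HOL-Combinatorics.Orbits" "Graph_Theory.Graph_Theory"
begin

section \<open>Directed graphs, cycles and spanning trees\<close>

text \<open>A directed graph is an orientation of a finite simple graph; the arc \<^term>\<open>(t, h)\<close>
  has tail \<^term>\<open>t\<close> and head \<^term>\<open>h\<close>. Since at most one of \<^term>\<open>(t, h)\<close> and \<^term>\<open>(h, t)\<close> is an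
  arc, an arc also serves as the name of the underlying undirected edge.\<close>

definition oriented_simple_graph :: "'v pair_pre_digraph \<Rightarrow> bool" where
  "oriented_simple_graph G \<longleftrightarrow> pair_digraph G \<and> asym (parcs G)"

text \<open>Cycles of the underlying undirected graph, traversed in one of their two directions. In the
  symmetric closure every edge gives rise to a closed walk of length 2 that uses the edge back and
  forth; the length condition excludes these.\<close>

definition undirected_cycle :: "'v pair_pre_digraph \<Rightarrow> ('v \<times> 'v) list \<Rightarrow> bool" where
  "undirected_cycle G p \<longleftrightarrow>
     pre_digraph.cycle (with_proj (mk_symmetric (with_proj G))) p \<and> 3 \<le> length p"

definition semi_balanced_cycle :: "'v pair_pre_digraph \<Rightarrow> ('v \<times> 'v) list \<Rightarrow> bool" where
  "semi_balanced_cycle G p \<longleftrightarrow>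
     length (filter (\<lambda>(u, v). (u, v) \<in> parcs G) p) = length (filter (\<lambda>(u, v). (v, u) \<in> parcs G) p)"

definition semi_balanced :: "'v pair_pre_digraph \<Rightarrow> bool" where
  "semi_balanced G \<longleftrightarrow> (\<forall>p. undirected_cycle G p \<longrightarrow> semi_balanced_cycle G p)"

text \<open>\<^const>\<open>Digraph_Component.connected\<close> refers to the underlying undirected graph, but
  \<^const>\<open>forest\<close> and hence \<^const>\<open>spanning_tree\<close> of the library only exclude directed cycles, so
  they cannot be used here. A spanning tree is represented by its set of arcs.\<close>

definition undirected_spanning_tree :: "'v pair_pre_digraph \<Rightarrow> ('v \<times> 'v) set \<Rightarrow> bool" where
  "undirected_spanning_tree G T \<longleftrightarrow>
     T \<subseteq> parcs G \<and>
     Digraph_Component.connected (with_proj \<lparr>pverts = pverts G, parcs = T\<rparr>) \<and>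
     (\<nexists>p. undirected_cycle \<lparr>pverts = pverts G, parcs = T\<rparr> p)"


section \<open>Ribbon structures, tours and Jaeger trees\<close>

definition incident :: "'v pair_pre_digraph \<Rightarrow> 'v \<Rightarrow> ('v \<times> 'v) set" where
  "incident G x = {a \<in> parcs G. x = fst a \<or> x = snd a}"

definition opposite_end :: "'v \<times> 'v \<Rightarrow> 'v \<Rightarrow> 'v" where
  "opposite_end a x = (if x = fst a then snd a else fst a)"

text \<open>\<open>\<rho> x a\<close> is the edge following \<open>a\<close> at the vertex \<open>x\<close>. Only the values for \<open>a\<close> incident
  to \<open>x\<close> matter.\<close>

type_synonym 'v ribbon = "'v \<Rightarrow> 'v \<times> 'v \<Rightarrow> 'v \<times> 'v"

definition ribbon_structure :: "'v pair_pre_digraph \<Rightarrow> 'v ribbon \<Rightarrow> bool" where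
  "ribbon_structure G \<rho> \<longleftrightarrow>
     (\<forall>x\<in>pverts G. incident G x \<noteq> {} \<longrightarrow> cyclic_on (\<rho> x) (incident G x))"

definition basis_pair :: "'v pair_pre_digraph \<Rightarrow> 'v \<times> ('v \<times> 'v) \<Rightarrow> bool" where
  "basis_pair G = (\<lambda>(b\<^sub>0, a). b\<^sub>0 \<in> pverts G \<and> a \<in> incident G b\<^sub>0)"

definition tour_step :: "'v ribbon \<Rightarrow> ('v \<times> 'v) set \<Rightarrow> 'v \<times> ('v \<times> 'v) \<Rightarrow> 'v \<times> ('v \<times> 'v)" where
  "tour_step \<rho> T = (\<lambda>(x, a).
     if a \<in> T then let y = opposite_end a x in (y, \<rho> y a) else (x, \<rho> x a))"

definition tour_length :: "'v ribbon \<Rightarrow> 'v \<times> ('v \<times> 'v) \<Rightarrow> ('v \<times> 'v) set \<Rightarrow> nat" where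
  "tour_length \<rho> b T = (LEAST n. 0 < n \<and> (tour_step \<rho> T ^^ n) b = b)"

definition tour :: "'v ribbon \<Rightarrow> 'v \<times> ('v \<times> 'v) \<Rightarrow> ('v \<times> 'v) set \<Rightarrow> ('v \<times> ('v \<times> 'v)) list" where
  "tour \<rho> b T = map (\<lambda>i. (tour_step \<rho> T ^^ i) b) [0..<tour_length \<rho> b T]"

definition precedes_in :: "'b list \<Rightarrow> 'b \<Rightarrow> 'b \<Rightarrow> bool" where
  "precedes_in xs u v \<longleftrightarrow> (\<exists>i j. i < j \<and> j < length xs \<and> xs ! i = u \<and> xs ! j = v)"

definition jaeger_tree ::
  "'v pair_pre_digraph \<Rightarrow> 'v ribbon \<Rightarrow> 'v \<times> ('v \<times> 'v) \<Rightarrow> ('v \<times> 'v) set \<Rightarrow> bool" where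
  "jaeger_tree G \<rho> b T \<longleftrightarrow>
     undirected_spanning_tree G T \<and>
     (\<forall>(t, h) \<in> parcs G - T. precedes_in (tour \<rho> b T) (t, (t, h)) (h, (t, h)))"


section \<open>Plane graphs and their counterclockwise ribbon structure\<close>

text \<open>The plane is \<^typ>\<open>complex\<close>. Vertices are points, and edges are arbitrary topological arcs,
  parametrised from tail to head, that meet the vertices and each other only in end vertices.\<close>

definition plane_embedding ::
  "'v pair_pre_digraph \<Rightarrow> ('v \<Rightarrow> complex) \<Rightarrow> ('v \<times> 'v \<Rightarrow> real \<Rightarrow> complex) \<Rightarrow> bool" where
  "plane_embedding G pos \<gamma> \<longleftrightarrow>
     inj_on pos (pverts G) \<and>
     (\<forall>a\<in>parcs G. arc (\<gamma> a) \<and> pathstart (\<gamma> a) = pos (fst a) \<and> pathfinish (\<gamma> a) = pos (snd a)) \<and>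
     (\<forall>a\<in>parcs G. path_image (\<gamma> a) \<inter> pos ` pverts G \<subseteq> {pos (fst a), pos (snd a)}) \<and>
     (\<forall>a\<in>parcs G. \<forall>a'\<in>parcs G. a \<noteq> a' \<longrightarrow>
        path_image (\<gamma> a) \<inter> path_image (\<gamma> a') \<subseteq> pos ` pverts G)"

definition arc_from ::
  "('v \<times> 'v \<Rightarrow> real \<Rightarrow> complex) \<Rightarrow> 'v \<Rightarrow> 'v \<times> 'v \<Rightarrow> real \<Rightarrow> complex" where
  "arc_from \<gamma> x a = (if x = fst a then \<gamma> a else reversepath (\<gamma> a))"

text \<open>The displacement, from the starting point of a path, of the first point of the path on the
  circle of radius \<open>r\<close> around that starting point.\<close>

definition exit_vector :: "(real \<Rightarrow> complex) \<Rightarrow> real \<Rightarrow> complex" where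
  "exit_vector g r = g (Inf {s \<in> {0..1}. dist (g 0) (g s) = r}) - g 0"

text \<open>\<^term>\<open>Arg2pi (w' / w)\<close>, with values in \<open>[0, 2\<pi>)\<close>, is the counterclockwise angle from
  \<open>w\<close> to \<open>w'\<close>. A sole edge at a vertex is its own successor.\<close>

definition ccw_successor ::
  "'e set \<Rightarrow> ('e \<Rightarrow> complex) \<Rightarrow> 'e \<Rightarrow> 'e \<Rightarrow> bool" where
  "ccw_successor I w a a' \<longleftrightarrow>
     a' \<in> I \<and> (\<forall>c \<in> I - {a}. a' \<noteq> a \<and> Arg2pi (w a' / w a) \<le> Arg2pi (w c / w a))"

text \<open>The counterclockwise order of edges at a vertex \<open>x\<close>. Topological arcs need not have
  tangent directions at \<open>x\<close> and may spiral around it, so the order is that of the points where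
  the arcs first reach a small circle around \<open>x\<close>; this cyclic order does not depend on the
  circle once all arcs at \<open>x\<close> reach it.\<close>

definition positive_ribbon_structure ::
  "'v pair_pre_digraph \<Rightarrow> ('v \<Rightarrow> complex) \<Rightarrow> ('v \<times> 'v \<Rightarrow> real \<Rightarrow> complex) \<Rightarrow> 'v ribbon \<Rightarrow> bool" where
  "positive_ribbon_structure G pos \<gamma> \<rho> \<longleftrightarrow>
     ribbon_structure G \<rho> \<and>
     (\<forall>x\<in>pverts G. \<forall>\<^sub>F r in at_right 0. \<forall>a\<in>incident G x.
        ccw_successor (incident G x) (\<lambda>c. exit_vector (arc_from \<gamma> x c) r) a (\<rho> x a))"


section \<open>Root polytopes, dissections and triangulations\<close>

definition root_polytope :: "('v::finite \<times> 'v) set \<Rightarrow> (real ^ 'v) set" where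
  "root_polytope A = convex hull ((\<lambda>(t, h). axis h 1 - axis t 1) ` A)"

text \<open>Interiors of simplices are relative interiors, as the polytope need not be full-dimensional
  in the ambient space.\<close>

definition dissection :: "'a::euclidean_space set \<Rightarrow> 'a set set \<Rightarrow> bool" where
  "dissection P \<S> \<longleftrightarrow>
     finite \<S> \<and>
     (\<forall>S\<in>\<S>. aff_dim P simplex S) \<and>
     (\<forall>S\<in>\<S>. \<forall>S'\<in>\<S>. S \<noteq> S' \<longrightarrow> rel_interior S \<inter> rel_interior S' = {}) \<and>
     \<Union>\<S> = P"

definition triangulation_of :: "'a::euclidean_space set \<Rightarrow> 'a set set \<Rightarrow> bool" where
  "triangulation_of P \<S> \<longleftrightarrow> dissection P \<S> \<and> triangulation \<S>"

end

theory Submission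
  imports Defs "HOL-Complex_Analysis.Winding_Numbers"
begin

text \<open>A point of the root polytope is the divergence of a nonnegative flow on the arcs, and it lies in
  the simplex of a spanning tree \<open>T\<close> iff the flow on \<open>T\<close> with this divergence is nonnegative. The
  coefficient of an arc \<open>a\<close> of \<open>T\<close> is the mass of the point on the head side of the fundamental cut
  of \<open>a\<close>, so statements about the simplices become statements about cuts. Semi-balancedness
  provides a potential that grows by 1 along every arc (\<open>ex_potential\<close>). Hence all generators lie in
  a hyperplane that misses the origin, coefficients add up to 1 in every representation of a point,
  and the simplices of spanning trees have full dimension.

  \<^bold>\<open>Interiors are disjoint.\<close> Run the tours of two Jaeger trees in parallel until they disagree about
  an arc \<open>e\<close>, say \<open>e \<in> T - T'\<close>. The Jaeger property of \<open>T'\<close> says that this happens at the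
  tail of \<open>e\<close>. The tour of \<open>T\<close> visits the head side of the fundamental cut of \<open>e\<close> in one
  block, so an arc outside \<open>T\<close> that enters the head side has been met before \<open>e\<close>, and is then
  outside \<open>T'\<close> as well. Therefore no arc of \<open>T'\<close> enters the head side, and the mass of the head
  side separates the two simplices (\<open>separating_cut\<close>).

  \<^bold>\<open>The simplices cover.\<close> Among the spanning trees whose simplex contains a given point, take one
  whose tour is lexicographically best, where the good decision is to omit an arc that is met at
  its tail and to keep an arc that is met at its head. If some arc \<open>e\<close> outside this tree were met
  at its head first, then pivoting \<open>e\<close> into the tree would keep the point and would improve the
  tour: the arc that leaves the tree is parallel to \<open>e\<close> across its own cut, and by the block
  structure of the tour it is met at its tail unless \<open>e\<close> is met before it (\<open>jaeger_cover\<close>).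

  \<^bold>\<open>The simplices meet in faces.\<close> If a point had different coefficients in two Jaeger trees \<open>T\<close>
  and \<open>T'\<close>, the difference would be a circulation, and it would contain a cycle whose forward arcs
  lie in \<open>T\<close> and whose backward arcs lie in \<open>T'\<close> (\<open>circulation_cycle\<close>). In the plane, a cycle has
  a right and a left side, and every corner between consecutive edges at a vertex lies on one
  of them. A tour changes sides exactly when it passes an edge of the cycle outside the tree. Its
  first change of side happens at the tail of such an edge by the Jaeger property, so whether this
  edge is a forward or a backward one depends only on the side on which the basis lies. Thus
  either every Jaeger tree misses a forward arc of the cycle, or every Jaeger tree misses a backward
  one (\<open>jaeger_tree_misses_edge\<close>), which rules out such a pair \<open>T\<close>, \<open>T'\<close>.

  That corners can be assigned consistently to the two sides is where the embedding enters. For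
  arbitrary topological arcs, the order in which the edges leave a small circle around a vertex of
  the cycle determines the winding number of the cycle along each other edge at this vertex
  (\<open>winding_number_beside_closed_curve\<close>).\<close>

section \<open>Spanning trees and their fundamental cuts\<close>

definition crosses :: "'v \<times> 'v \<Rightarrow> 'v set \<Rightarrow> bool" where
  "crosses a X \<longleftrightarrow> (fst a \<in> X) \<noteq> (snd a \<in> X)"

text \<open>Spanning trees in terms of cuts: the graph is connected iff every nonempty proper
  vertex set is crossed, and it has no cycle iff each arc is the only one across some vertex set. In this
  form both properties survive exchanges of arcs by taking symmetric differences of vertex
  sets, and the cuts give the linear functionals that are dual to the arcs of a tree.\<close>

definition cut_tree :: "('v \<times> 'v) set \<Rightarrow> ('v \<times> 'v) set \<Rightarrow> bool" where
  "cut_tree E T \<longleftrightarrow> T \<subseteq> E \<and> (\<forall>X. X \<noteq> {} \<and> X \<noteq> UNIV \<longrightarrow> (\<exists>a\<in>T. crosses a X)) \<and>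
     (\<forall>a\<in>T. \<exists>X. crosses a X \<and> (\<forall>b\<in>T. crosses b X \<longrightarrow> b = a))"

text \<open>The fundamental cut of an arc, represented by the side that contains the head.\<close>

definition tree_cut :: "('v \<times> 'v) set \<Rightarrow> 'v \<times> 'v \<Rightarrow> 'v set" where
  "tree_cut T a = (SOME X. snd a \<in> X \<and> fst a \<notin> X \<and> (\<forall>b\<in>T. crosses b X \<longrightarrow> b = a))"

lemma crosses_Compl [simp]: "crosses a (- X) = crosses a X"
  by (auto simp: crosses_def)

lemma tree_cut:
  assumes "cut_tree E T" "a \<in> T"
  shows "snd a \<in> tree_cut T a" "fst a \<notin> tree_cut T a" "\<And>b. b \<in> T \<Longrightarrow> crosses b (tree_cut T a) \<Longrightarrow> b = a"
proof -
  obtain X where X: "crosses a X" "\<forall>b\<in>T. crosses b X \<longrightarrow> b = a"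
  proof -
    have "\<forall>a\<in>T. \<exists>X. crosses a X \<and> (\<forall>b\<in>T. crosses b X \<longrightarrow> b = a)"
      using assms(1) by (simp add: cut_tree_def)
    then show ?thesis using that assms(2) by meson
  qed
  have "\<exists>X. snd a \<in> X \<and> fst a \<notin> X \<and> (\<forall>b\<in>T. crosses b X \<longrightarrow> b = a)"
  proof (cases "snd a \<in> X")
    case True
    then show ?thesis using X by (intro exI[of _ X]) (auto simp: crosses_def)
  next
    case False
    then show ?thesis using X by (intro exI[of _ "- X"]) (auto simp: crosses_def)
  qed
  from someI_ex[OF this] show "snd a \<in> tree_cut T a" "fst a \<notin> tree_cut T a" "\<And>b. b \<in> T \<Longrightarrow> crosses b (tree_cut T a) \<Longrightarrow> b = a"
    unfolding tree_cut_def by simp_all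
qed

lemma tree_cut_crosses: "cut_tree E T \<Longrightarrow> a \<in> T \<Longrightarrow> b \<in> T \<Longrightarrow> crosses b (tree_cut T a) \<longleftrightarrow> b = a"
  using tree_cut[of E T a] by (metis crosses_def)

lemma cut_tree_connected:
  assumes "cut_tree E T" "X \<noteq> {}" "X \<noteq> UNIV" shows "\<exists>a\<in>T. crosses a X"
  using assms by (simp add: cut_tree_def)

lemma crosses_sym_diff: "crosses a ((X - Y) \<union> (Y - X)) \<longleftrightarrow> crosses a X \<noteq> crosses a Y"
  by (auto simp: crosses_def)

text \<open>The cut of \<open>g\<close> becomes the cut of \<open>e\<close> in the new tree. The cut of another arc has to change only if
  \<open>e\<close> crosses it, and then its symmetric difference with the cut of \<open>g\<close> is a replacement.\<close>

lemma cut_tree_exchange: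
  assumes T: "cut_tree E T" and g: "g \<in> T" and e: "e \<in> E" "e \<notin> T" "crosses e (tree_cut T g)"
  shows "cut_tree E (insert e (T - {g}))"
  unfolding cut_tree_def
proof (intro conjI allI impI ballI)
  let ?T = "insert e (T - {g})" and ?Y = "tree_cut T g"
  show "?T \<subseteq> E" using T e by (auto simp: cut_tree_def)
  fix X :: "'a set" assume X: "X \<noteq> {} \<and> X \<noteq> UNIV"
  show "\<exists>a\<in>?T. crosses a X"
  proof (rule ccontr)
    assume no: "\<not> (\<exists>a\<in>?T. crosses a X)"
    (* Among the arcs of T only g crosses X, so none crosses the symmetric difference with the cut of g. *)
    let ?Z = "(X - ?Y) \<union> (?Y - X)"
    obtain a where a: "a \<in> T" "crosses a X" using cut_tree_connected[OF T] X by blast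
    then have gX: "crosses g X" using no by (cases "a = g") auto
    have "\<not> crosses a ?Z" if "a \<in> T" for a
      unfolding crosses_sym_diff using tree_cut_crosses[OF T g that] gX no that by (cases "a = g") auto
    then have "?Z = {} \<or> ?Z = UNIV" using cut_tree_connected[OF T, of ?Z] by blast
    then have "X = ?Y \<or> X = - ?Y" by blast
    then show False using no e(3) by auto
  qed
next
  let ?T = "insert e (T - {g})" and ?Y = "tree_cut T g"
  fix a assume a: "a \<in> ?T"
  show "\<exists>X. crosses a X \<and> (\<forall>b\<in>?T. crosses b X \<longrightarrow> b = a)"
  proof (cases "a = e")
    case True
    then show ?thesis using e(3) tree_cut_crosses[OF T g] by (intro exI[of _ ?Y]) auto
  next
    case False
    then have aT: "a \<in> T" "a \<noteq> g" using a by auto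
    show ?thesis
    proof (cases "crosses e (tree_cut T a)")
      case True
      then show ?thesis
        using aT e(3) tree_cut_crosses[OF T g] tree_cut_crosses[OF T aT(1)]
        by (intro exI[of _ "(tree_cut T a - ?Y) \<union> (?Y - tree_cut T a)"]) (auto simp: crosses_sym_diff)
    next
      case False
      then show ?thesis
        using aT tree_cut_crosses[OF T aT(1)] by (intro exI[of _ "tree_cut T a"]) auto
    qed
  qed
qed

definition sym_closure :: "('v \<times> 'v) set \<Rightarrow> ('v \<times> 'v) set" where "sym_closure R = R \<union> R\<inverse>"

lemma reachable_UNIV:
  "u \<rightarrow>\<^sup>*\<^bsub>with_proj \<lparr>pverts = UNIV, parcs = R\<rparr>\<^esub> v \<longleftrightarrow> (u, v) \<in> R\<^sup>*"
proof -
  have "(u, v) \<in> rtrancl_on UNIV R \<longleftrightarrow> (u, v) \<in> R\<^sup>*"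
  proof
    show "(u, v) \<in> rtrancl_on UNIV R \<Longrightarrow> (u, v) \<in> R\<^sup>*"
      by (rule rtrancl_on_rtranclI)
    show "(u, v) \<in> R\<^sup>* \<Longrightarrow> (u, v) \<in> rtrancl_on UNIV R"
      by (induction rule: rtrancl_induct) (auto intro: rtrancl_on_into_rtrancl_on)
  qed
  then show ?thesis by (simp add: reachable_def)
qed

lemma mk_symmetric_eq: "mk_symmetric (with_proj \<lparr>pverts = U, parcs = R\<rparr>) = \<lparr>pverts = U, parcs = sym_closure R\<rparr>"
  by (auto simp: mk_symmetric_def sym_closure_def)

lemma connected_iff:
  "Digraph_Component.connected (with_proj \<lparr>pverts = UNIV, parcs = R\<rparr>) \<longleftrightarrow> (\<forall>u v. (u, v) \<in> (sym_closure R)\<^sup>*)"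
  unfolding Digraph_Component.connected_def strongly_connected_def mk_symmetric_eq reachable_UNIV by simp

lemma path_exists:
  assumes "(u, v) \<in> (sym_closure R)\<^sup>*"
  obtains p where "pcas u p v" "set p \<subseteq> sym_closure R" "distinct (pawalk_verts u p)"
proof -
  let ?H = "\<lparr>pverts = UNIV, parcs = sym_closure R\<rparr> :: 'a pair_pre_digraph"
  interpret pair_wf_digraph ?H by unfold_locales auto
  have "u \<rightarrow>\<^sup>*\<^bsub>with_proj ?H\<^esub> v" using assms unfolding reachable_UNIV .
  then obtain p where "apath u p v" using reachable_apath by blast
  then show thesis using that by (auto simp: apath_def awalk_def)
qed

lemma pcas_append: "pcas u (p @ q) w \<longleftrightarrow> (\<exists>v. pcas u p v \<and> pcas v q w)"
  by (induction p arbitrary: u) auto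

lemma pawalk_verts_append1: "pcas u p v \<Longrightarrow> pawalk_verts u (p @ [(v, w)]) = pawalk_verts u p @ [w]"
  by (induction p arbitrary: u) auto

lemma hd_pawalk_verts: "pcas u p v \<Longrightarrow> hd (pawalk_verts u p) = u"
  by (cases p) auto

lemma pawalk_verts_ne: "pawalk_verts u p \<noteq> []" by (cases p) auto

text \<open>Unfolds the library notions of walk and cycle for graphs on a whole type.\<close>

lemma undirected_cycle_iff:
  "undirected_cycle \<lparr>pverts = UNIV, parcs = E\<rparr> p \<longleftrightarrow>
    (\<exists>u. set p \<subseteq> sym_closure E \<and> pcas u p u \<and> distinct (tl (pawalk_verts u p)) \<and> 3 \<le> length p)"
proof -
  let ?H = "\<lparr>pverts = UNIV, parcs = sym_closure E\<rparr> :: 'a pair_pre_digraph"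
  interpret pair_wf_digraph ?H by unfold_locales auto
  show ?thesis unfolding undirected_cycle_def mk_symmetric_eq
    by (auto simp: cycle_def awalk_def)
qed

text \<open>The path is not the closing arc itself, which makes the cycle have length at least 3.\<close>

lemma cycle_from_path:
  assumes "(u, v) \<in> (sym_closure R)\<^sup>*" "R \<subseteq> E" "(v, u) \<in> sym_closure E" "(u, v) \<notin> sym_closure R" "u \<noteq> v"
  obtains p where "undirected_cycle \<lparr>pverts = UNIV, parcs = E\<rparr> (p @ [(v, u)])" "pcas u p v" "set p \<subseteq> sym_closure R"
proof -
  obtain p where p: "pcas u p v" "set p \<subseteq> sym_closure R" "distinct (pawalk_verts u p)" using path_exists[OF assms(1)] .
  have "length p \<ge> 2"
  proof (rule ccontr)
    assume "\<not> length p \<ge> 2"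
    then have "length p = 0 \<or> length p = 1" by linarith
    then show False
    proof
      assume "length p = 0" then show False using p assms(5) by auto
    next
      assume "length p = 1"
      then obtain e where "p = [e]" by (auto simp: length_Suc_conv)
      then have "(u, v) \<in> sym_closure R" using p by (cases e) auto
      then show False using assms(4) by simp
    qed
  qed
  moreover have "sym_closure R \<subseteq> sym_closure E" using assms(2) by (auto simp: sym_closure_def)
  moreover have "distinct (tl (pawalk_verts u (p @ [(v, u)])))"
  proof -
    have "pawalk_verts u p = u # tl (pawalk_verts u p)"
      using hd_pawalk_verts[OF p(1)] pawalk_verts_ne[of u p] by (metis list.collapse)
    then have "distinct (tl (pawalk_verts u p) @ [u])" using p(3)
      by (metis distinct.simps(2) distinct_append distinct_singleton disjoint_insert(2) inf_bot_right list.set(1) list.set(2))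
    then show ?thesis using pawalk_verts_append1[OF p(1), of u] pawalk_verts_ne[of u p] by (simp add: tl_append2)
  qed
  ultimately have "undirected_cycle \<lparr>pverts = UNIV, parcs = E\<rparr> (p @ [(v, u)])"
    unfolding undirected_cycle_iff using p assms(3) by (intro exI[of _ u]) (auto simp: pcas_append)
  then show thesis using that p by blast
qed

lemma path_crosses:
  assumes "pcas u p v" "(u \<in> X) \<noteq> (v \<in> X)"
  obtains e where "e \<in> set p" "crosses e X"
proof -
  have "\<exists>e\<in>set p. crosses e X"
    using assms
  proof (induction p arbitrary: u)
    case (Cons e p)
    then show ?case by (cases "crosses e X") (auto simp: crosses_def)
  qed auto
  then show thesis using that by blast
qed

lemma rtrancl_crosses:
  assumes "(u, v) \<in> (sym_closure R)\<^sup>*" "(u \<in> X) \<noteq> (v \<in> X)"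
  obtains a where "a \<in> R" "crosses a X"
proof -
  have "\<exists>a\<in>R. crosses a X"
    using assms
  proof (induction rule: rtrancl_induct)
    case (step y z)
    show ?case
    proof (cases "(y \<in> X) = (z \<in> X)")
      case False
      then show ?thesis using step(2) unfolding sym_closure_def by (force simp: crosses_def)
    qed (use step in auto)
  qed auto
  then show thesis using that by blast
qed

text \<open>An arc of a tree gives the cut that consists of everything reachable from its head without the
  arc. Conversely, a cycle would have to cross the cut of any of its arcs a second time.\<close>

lemma spanning_tree_iff_cut_tree:
  fixes G :: "'v pair_pre_digraph"
  assumes "oriented_simple_graph G" "pverts G = UNIV"
  shows "undirected_spanning_tree G T \<longleftrightarrow> cut_tree (parcs G) T"
proof
  have asymG: "\<And>x y. (x, y) \<in> parcs G \<Longrightarrow> (y, x) \<notin> parcs G"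
    using assms by (auto simp: oriented_simple_graph_def asym_on_def)
  assume "undirected_spanning_tree G T"
  then have T: "T \<subseteq> parcs G" "\<And>u v. (u, v) \<in> (sym_closure T)\<^sup>*"
    "\<And>p. \<not> undirected_cycle \<lparr>pverts = UNIV, parcs = T\<rparr> p"
    unfolding undirected_spanning_tree_def assms(2) connected_iff by auto
  show "cut_tree (parcs G) T"
    unfolding cut_tree_def
  proof (intro conjI allI impI ballI)
    fix X :: "'v set" assume "X \<noteq> {} \<and> X \<noteq> UNIV"
    then obtain u v where "u \<in> X" "v \<notin> X" by blast
    then show "\<exists>a\<in>T. crosses a X" using rtrancl_crosses[OF T(2)[of u v], of X] by blast
  next
    fix a assume a: "a \<in> T"
    obtain s t where st: "a = (s, t)" by (cases a)
    define X where "X = {w. (t, w) \<in> (sym_closure (T - {a}))\<^sup>*}"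
    have "s \<notin> X"
    proof
      assume "s \<in> X"
      then have "(t, s) \<in> (sym_closure (T - {a}))\<^sup>*" by (simp add: X_def)
      moreover have "(t, s) \<notin> sym_closure (T - {a})" using a st T(1) asymG by (auto simp: sym_closure_def)
      moreover have "s \<noteq> t" using a st T(1) asymG by auto
      moreover have "(s, t) \<in> sym_closure T" using a st by (auto simp: sym_closure_def)
      ultimately show False using cycle_from_path[of t s "T - {a}" T] T(3) by blast
    qed
    moreover have "t \<in> X" by (simp add: X_def)
    moreover have "\<not> crosses b X" if b: "b \<in> T" "b \<noteq> a" for b
    proof -
      have "b \<in> sym_closure (T - {a})" "(snd b, fst b) \<in> sym_closure (T - {a})" using b by (auto simp: sym_closure_def)
      then have "fst b \<in> X \<longleftrightarrow> snd b \<in> X"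
        unfolding X_def by (metis mem_Collect_eq prod.collapse rtrancl.rtrancl_into_rtrancl)
      then show ?thesis by (simp add: crosses_def)
    qed
    ultimately show "\<exists>X. crosses a X \<and> (\<forall>b\<in>T. crosses b X \<longrightarrow> b = a)"
      using st by (intro exI[of _ X]) (auto simp: crosses_def)
  qed fact
next
  assume T: "cut_tree (parcs G) T"
  show "undirected_spanning_tree G T"
    unfolding undirected_spanning_tree_def assms(2) connected_iff
  proof (intro conjI allI)
    show "T \<subseteq> parcs G" using T by (simp add: cut_tree_def)
    fix u v
    let ?X = "{w. (u, w) \<in> (sym_closure T)\<^sup>*}"
    have "\<not> crosses a ?X" if "a \<in> T" for a
    proof -
      have "a \<in> sym_closure T" "(snd a, fst a) \<in> sym_closure T" using that by (auto simp: sym_closure_def)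
      then have "fst a \<in> ?X \<longleftrightarrow> snd a \<in> ?X"
        by (metis mem_Collect_eq prod.collapse rtrancl.rtrancl_into_rtrancl)
      then show ?thesis by (simp add: crosses_def)
    qed
    then have "?X = UNIV" using cut_tree_connected[OF T, of ?X] by blast
    then show "(u, v) \<in> (sym_closure T)\<^sup>*" by blast
  next
    show "\<nexists>p. undirected_cycle \<lparr>pverts = UNIV, parcs = T\<rparr> p"
    proof
      assume "\<exists>p. undirected_cycle \<lparr>pverts = UNIV, parcs = T\<rparr> p"
      then obtain p u where p: "set p \<subseteq> sym_closure T" "pcas u p u" "distinct (tl (pawalk_verts u p))" "3 \<le> length p"
        unfolding undirected_cycle_iff by blast
      then obtain y q where pq: "p = (u, y) # q" by (cases p) auto
      have q: "pcas y q u" "distinct (pawalk_verts y q)" "set q \<subseteq> sym_closure T" "2 \<le> length q" "(u, y) \<in> sym_closure T"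
        using p pq by auto
      define a where "a = (if (u, y) \<in> T then (u, y) else (y, u))"
      have a: "a \<in> T" "a = (u, y) \<or> a = (y, u)" using q(5) by (auto simp: a_def sym_closure_def)
      have "(y \<in> tree_cut T a) \<noteq> (u \<in> tree_cut T a)" using tree_cut(1,2)[OF T a(1)] a(2) by auto
      then obtain e where e: "e \<in> set q" "crosses e (tree_cut T a)" using path_crosses[OF q(1)] by blast
      have "e = a \<or> (snd e, fst e) = a"
      proof -
        have "e \<in> T \<or> (snd e, fst e) \<in> T" using e(1) q(3) by (cases e) (auto simp: sym_closure_def)
        moreover have "crosses (snd e, fst e) (tree_cut T a)" using e(2) by (auto simp: crosses_def)
        ultimately show ?thesis using e(2) tree_cut(3)[OF T a(1)] by blast
      qed
      then have e_cases: "e = (u, y) \<or> e = (y, u)" using a(2) by (cases e) auto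
      obtain q1 q2 where q12: "q = q1 @ e # q2" using e(1) by (meson split_list)
      obtain w where w: "pcas y q1 w" "fst e = w" "pcas (snd e) q2 u" using q(1) q12 by (auto simp: pcas_append)
      have V: "pawalk_verts y q = pawalk_verts y q1 @ pawalk_verts (snd e) q2"
      proof -
        have "pcas y q1 w \<Longrightarrow> pawalk_verts y (q1 @ e # q2) = pawalk_verts y q1 @ pawalk_verts (snd e) q2" for y
          using w(2) by (induction q1 arbitrary: y) auto
        then show ?thesis using w q12 by simp
      qed
      have mem: "x \<in> set (pawalk_verts x r)" "z \<in> set (pawalk_verts x r)" if "pcas x r z" for x r z
        using that by (induction r arbitrary: x) auto
      show False
        using e_cases
      proof
        assume "e = (u, y)"
        then have "y \<in> set (pawalk_verts y q1)" "y \<in> set (pawalk_verts (snd e) q2)" using mem w by auto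
        then show False using V q(2) by auto
      next
        assume *: "e = (y, u)"
        have "q1 = []"
        proof (rule ccontr)
          assume "q1 \<noteq> []"
          then obtain b r where br: "q1 = b # r" by (cases q1) auto
          then have "distinct (y # pawalk_verts (snd b) r)" "pcas (snd b) r y" using V q(2) w * by auto
          then show False by (metis distinct.simps(2) mem(2))
        qed
        moreover have "q2 = []"
        proof (rule ccontr)
          assume "q2 \<noteq> []"
          then obtain b r where br: "q2 = b # r" by (cases q2) auto
          then have "distinct (u # pawalk_verts (snd b) r)" "pcas (snd b) r u" using V q(2) w * by auto
          then show False by (metis distinct.simps(2) mem(2))
        qed
        ultimately show False using q12 q(4) by simp
      qed
    qed
  qed
qed

section \<open>Edge vectors and potentials\<close>

definition edge_vec :: "'v::finite \<times> 'v \<Rightarrow> real ^ 'v" where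
  "edge_vec = (\<lambda>(t, h). axis h 1 - axis t 1)"

text \<open>If \<open>w\<close> is the divergence of a flow, then this is the net flow into \<open>X\<close>.\<close>

definition mass :: "'v::finite set \<Rightarrow> real ^ 'v \<Rightarrow> real" where
  "mass X w = (\<Sum>v\<in>X. w $ v)"

lemma linear_mass: "linear (mass X)"
  unfolding mass_def by (intro linearI) (auto simp: sum.distrib sum_distrib_left)

lemma mass_edge_vec: "mass X (edge_vec a) = (if snd a \<in> X then 1 else 0) - (if fst a \<in> X then 1 else 0)"
  by (cases a) (simp add: mass_def edge_vec_def axis_def sum_subtractf)

lemma mass_sum: "mass X (\<Sum>a\<in>A. c a *\<^sub>R w a) = (\<Sum>a\<in>A. c a * mass X (w a))"
  using linear_mass[of X] by (simp add: linear_sum linear_cmul)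

lemma mass_edge_vec_uncrossed: "\<not> crosses a X \<Longrightarrow> mass X (edge_vec a) = 0"
  by (auto simp: mass_edge_vec crosses_def)

lemma mass_tree_cut:
  assumes "cut_tree E T" "a \<in> T" "b \<in> T"
  shows "mass (tree_cut T a) (edge_vec b) = (if b = a then 1 else 0)"
proof (cases "b = a")
  case True
  then show ?thesis using tree_cut(1,2)[OF assms(1,2)] by (simp add: mass_edge_vec)
next
  case False
  then have "\<not> crosses b (tree_cut T a)" using tree_cut(3)[OF assms] by blast
  then show ?thesis using False by (simp add: mass_edge_vec_uncrossed)
qed

text \<open>The fundamental cuts are dual to the arcs of the tree: they read off the coefficients.\<close>

lemma mass_tree_combination:
  fixes T :: "('v::finite \<times> 'v) set"
  assumes "cut_tree E T" "a \<in> T"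
  shows "mass (tree_cut T a) (\<Sum>b\<in>T. c b *\<^sub>R edge_vec b) = c a"
proof -
  have "mass (tree_cut T a) (\<Sum>b\<in>T. c b *\<^sub>R edge_vec b) = (\<Sum>b\<in>T. if b = a then c b else 0)"
    unfolding mass_sum by (intro sum.cong) (auto simp: mass_tree_cut[OF assms])
  then show ?thesis using assms(2) by (simp add: sum.delta)
qed

text \<open>The vertices \<open>w\<close> for which the difference of basis vectors from the tail of \<open>a\<close> to \<open>w\<close> is in the
  span form a set that no arc of the tree crosses, so these are all vertices.\<close>

lemma edge_vec_in_span_tree:
  fixes T :: "('v::finite \<times> 'v) set"
  assumes T: "cut_tree E T"
  shows "edge_vec a \<in> span (edge_vec ` T)"
proof -
  let ?X = "{w. axis w 1 - axis (fst a) 1 \<in> span (edge_vec ` T)}"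
  have "\<not> crosses b ?X" if "b \<in> T" for b
  proof -
    have b: "edge_vec b \<in> span (edge_vec ` T)" using that by (intro span_base) auto
    have eq: "axis (snd b) 1 - axis (fst a) 1 = (axis (fst b) 1 - axis (fst a) 1) + edge_vec b"
      by (cases b) (simp add: edge_vec_def)
    have "snd b \<in> ?X \<longleftrightarrow> fst b \<in> ?X"
      using span_add_eq2[OF b] unfolding mem_Collect_eq eq by blast
    then show ?thesis by (simp add: crosses_def)
  qed
  moreover have "fst a \<in> ?X" by (simp add: span_zero)
  ultimately have "?X = UNIV" using cut_tree_connected[OF T, of ?X] by blast
  then have "snd a \<in> ?X" by blast
  then show ?thesis by (cases a) (simp add: edge_vec_def)
qed

lemma edge_vec_inj:
  assumes "\<And>x. (x, x) \<notin> E" shows "inj_on edge_vec E"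
proof (rule inj_onI)
  fix a b assume a: "a \<in> E" and b: "b \<in> E" and eq: "edge_vec a = edge_vec b"
  obtain t h t' h' where [simp]: "a = (t, h)" "b = (t', h')" by (metis prod.exhaust)
  have ne: "t \<noteq> h" "t' \<noteq> h'" using a b assms by auto
  have c: "edge_vec a $ v = edge_vec b $ v" for v using eq by simp
  have "h = h'" using c[of h] ne by (auto simp: edge_vec_def axis_def split: if_splits)
  moreover have "t = t'" using c[of t] ne by (auto simp: edge_vec_def axis_def split: if_splits)
  ultimately show "a = b" by simp
qed

lemma edge_vec_tree_expansion:
  fixes T :: "('v::finite \<times> 'v) set"
  assumes T: "cut_tree E T" and nl: "\<And>x. (x, x) \<notin> E"
  shows "edge_vec e = (\<Sum>a\<in>T. mass (tree_cut T a) (edge_vec e) *\<^sub>R edge_vec a)"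
proof -
  have inj: "inj_on edge_vec T"
    using edge_vec_inj[OF nl] T by (auto simp: cut_tree_def intro: inj_on_subset)
  obtain u where "edge_vec e = (\<Sum>v\<in>edge_vec ` T. u v *\<^sub>R v)"
    using edge_vec_in_span_tree[OF T, of e] by (auto simp: span_finite)
  then have e: "edge_vec e = (\<Sum>a\<in>T. u (edge_vec a) *\<^sub>R edge_vec a)"
    by (simp add: sum.reindex[OF inj])
  have "mass (tree_cut T a) (edge_vec e) = u (edge_vec a)" if "a \<in> T" for a
    unfolding e using mass_tree_combination[OF T that, of "\<lambda>a. u (edge_vec a)"] .
  then show ?thesis using e by simp
qed

lemma root_polytope_iff:
  assumes "inj_on edge_vec T"
  shows "p \<in> root_polytope T \<longleftrightarrow>
    (\<exists>f. (\<forall>a\<in>T. 0 \<le> f a) \<and> sum f T = 1 \<and> p = (\<Sum>a\<in>T. f a *\<^sub>R edge_vec a))"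
proof -
  have *: "root_polytope T = convex hull (edge_vec ` T)" by (simp add: root_polytope_def edge_vec_def)
  show ?thesis
  proof
    assume "p \<in> root_polytope T"
    then obtain u where "\<forall>x\<in>edge_vec ` T. 0 \<le> u x" "sum u (edge_vec ` T) = 1" "p = (\<Sum>x\<in>edge_vec ` T. u x *\<^sub>R x)"
      unfolding * convex_hull_finite[OF finite_imageI[OF finite]] by blast
    then show "\<exists>f. (\<forall>a\<in>T. 0 \<le> f a) \<and> sum f T = 1 \<and> p = (\<Sum>a\<in>T. f a *\<^sub>R edge_vec a)"
      by (intro exI[of _ "u \<circ> edge_vec"]) (auto simp: sum.reindex[OF assms])
  next
    assume "\<exists>f. (\<forall>a\<in>T. 0 \<le> f a) \<and> sum f T = 1 \<and> p = (\<Sum>a\<in>T. f a *\<^sub>R edge_vec a)"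
    then obtain f where f: "\<forall>a\<in>T. 0 \<le> f a" "sum f T = 1" "p = (\<Sum>a\<in>T. f a *\<^sub>R edge_vec a)" by blast
    show "p \<in> root_polytope T"
      unfolding * f(3) using f(1,2) by (intro convex_sum) (auto intro: hull_inc)
  qed
qed

text \<open>The increments of a potential telescope along a walk to the number of forward steps minus the
  number of backward steps.\<close>

lemma pcas_potential:
  fixes l :: "'v \<Rightarrow> real"
  assumes "pcas u p v" "set p \<subseteq> sym_closure T" "\<And>x y. (x, y) \<in> T \<Longrightarrow> l y = l x + 1" "T \<subseteq> E"
    "\<And>x y. (x, y) \<in> E \<Longrightarrow> (y, x) \<notin> E"
    and PQ: "\<And>x y. P (x, y) \<longleftrightarrow> (x, y) \<in> E" "\<And>x y. Q (x, y) \<longleftrightarrow> (y, x) \<in> E"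
  shows "l v - l u = real (length (filter P p)) - real (length (filter Q p))"
  using assms(1,2)
proof (induction p arbitrary: u)
  case (Cons e p)
  obtain y where e: "e = (u, y)" "pcas y p v" using Cons.prems(1) by (cases e) auto
  have IH: "l v - l y = real (length (filter P p)) - real (length (filter Q p))"
    using Cons.IH[OF e(2)] Cons.prems(2) by simp
  have "(u, y) \<in> T \<or> (y, u) \<in> T" using Cons.prems(2) e by (auto simp: sym_closure_def)
  then show ?case
  proof
    assume "(u, y) \<in> T"
    then have "(u, y) \<in> E" "(y, u) \<notin> E" "l y = l u + 1" using assms(3-5) by auto
    then show ?thesis using IH e(1) PQ by simp
  next
    assume "(y, u) \<in> T"
    then have "(y, u) \<in> E" "(u, y) \<notin> E" "l u = l y + 1" using assms(3-5) by auto
    then show ?thesis using IH e(1) PQ by simp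
  qed
qed simp

text \<open>Spanning trees are the bases of the graphic matroid: an independent set of edge vectors extends
  to a basis of their span. A vertex set that the basis does not cross has mass 0 on the whole span,
  which contradicts connectedness. An arc of the basis is cut off by the set of vertices that can be
  reached from its head within the span of the other arcs.\<close>

lemma ex_cut_tree:
  fixes E :: "('v::finite \<times> 'v) set"
  assumes nl: "\<And>x. (x, x) \<notin> E" and conn: "\<And>u v. (u, v) \<in> (sym_closure E)\<^sup>*"
    and S: "S \<subseteq> edge_vec ` E" "independent S"
  obtains T where "cut_tree E T" "S \<subseteq> edge_vec ` T"
proof -
  obtain B where B: "S \<subseteq> B" "B \<subseteq> edge_vec ` E" "independent B" "edge_vec ` E \<subseteq> span B"
    using maximal_independent_subset_extend[OF S] by metis
  define T where "T = {a \<in> E. edge_vec a \<in> B}"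
  have im: "edge_vec ` T = B" using B(2) by (auto simp: T_def)
  have inj: "inj_on edge_vec E" using edge_vec_inj[OF nl] .
  have "cut_tree E T"
    unfolding cut_tree_def
  proof (intro conjI allI impI ballI)
    show "T \<subseteq> E" by (auto simp: T_def)
    fix X :: "'v set" assume "X \<noteq> {} \<and> X \<noteq> UNIV"
    then obtain u v where "u \<in> X" "v \<notin> X" by blast
    then obtain a where a: "a \<in> E" "crosses a X" using rtrancl_crosses[OF conn[of u v], of X] by blast
    show "\<exists>a\<in>T. crosses a X"
    proof (rule ccontr)
      assume "\<not> (\<exists>a\<in>T. crosses a X)"
      then have "\<And>w. w \<in> B \<Longrightarrow> mass X w = 0" using mass_edge_vec_uncrossed im by blast
      moreover have "edge_vec a \<in> span B" using a B(4) by auto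
      ultimately have "mass X (edge_vec a) = 0"
        using linear_eq_0_on_span[OF linear_mass] by blast
      then show False using a(2) by (auto simp: mass_edge_vec crosses_def split: if_splits)
    qed
  next
    fix a assume a: "a \<in> T"
    let ?X = "{w. axis w 1 - axis (snd a) 1 \<in> span (B - {edge_vec a})}"
    have "fst a \<notin> ?X"
    proof
      assume "fst a \<in> ?X"
      then have "- (axis (fst a) 1 - axis (snd a) 1 :: real ^ 'v) \<in> span (B - {edge_vec a})"
        by (intro span_neg) auto
      then have "edge_vec a \<in> span (B - {edge_vec a})" by (cases a) (simp add: edge_vec_def)
      then show False using B(3) a im by (auto simp: dependent_def)
    qed
    moreover have "snd a \<in> ?X" by (simp add: span_zero)
    moreover have "\<not> crosses b ?X" if b: "b \<in> T" "b \<noteq> a" for b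
    proof -
      have "edge_vec b \<noteq> edge_vec a" using b a inj by (auto simp: T_def inj_on_def)
      then have bs: "edge_vec b \<in> span (B - {edge_vec a})" using b im by (intro span_base) auto
      have eq: "axis (snd b) 1 - axis (snd a) 1 = (axis (fst b) 1 - axis (snd a) 1) + edge_vec b"
        by (cases b) (simp add: edge_vec_def)
      have "snd b \<in> ?X \<longleftrightarrow> fst b \<in> ?X"
        using span_add_eq2[OF bs] unfolding mem_Collect_eq eq by blast
      then show ?thesis by (simp add: crosses_def)
    qed
    ultimately show "\<exists>X. crosses a X \<and> (\<forall>b\<in>T. crosses b X \<longrightarrow> b = a)"
      by (intro exI[of _ ?X]) (auto simp: crosses_def)
  qed
  then show thesis using that B(1) im by blast
qed

locale oriented_graph =
  fixes G :: "'v::finite pair_pre_digraph"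
  assumes simple: "oriented_simple_graph G"
    and verts: "pverts G = UNIV"
begin

abbreviation "E \<equiv> parcs G"

lemma no_loop: "(x, x) \<notin> E"
  using simple by (auto simp: oriented_simple_graph_def asym_on_def)

lemma no_2cycle: "(x, y) \<in> E \<Longrightarrow> (y, x) \<notin> E"
  using simple by (auto simp: oriented_simple_graph_def asym_on_def)

end

locale semi_balanced_graph = oriented_graph G for G :: "'v::finite pair_pre_digraph" +
  assumes conn: "Digraph_Component.connected (with_proj G)"
    and balanced: "semi_balanced G"
begin

lemma record_eq: "\<lparr>pverts = UNIV, parcs = E\<rparr> = G" using verts by (cases G) simp

lemma connected_rtrancl: "(u, v) \<in> (sym_closure E)\<^sup>*"
  using conn record_eq connected_iff[of E] by simp

lemma edge_vec_inj_E: "T \<subseteq> E \<Longrightarrow> inj_on edge_vec T"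
  using edge_vec_inj[of E] no_loop by (blast intro: inj_on_subset)

text \<open>On a spanning tree, the number of fundamental cuts that contain a vertex is such a potential.
  For an arc outside the tree, the balance of its fundamental cycle says that the potential also
  grows by 1 along this arc.\<close>

lemma ex_potential: "\<exists>l :: 'v \<Rightarrow> real. \<forall>x y. (x, y) \<in> E \<longrightarrow> l y = l x + 1"
proof -
  obtain T where T: "cut_tree E T"
    using ex_cut_tree[of E "{}"] no_loop connected_rtrancl by (metis empty_subsetI independent_empty)
  have TE: "T \<subseteq> E" using T by (simp add: cut_tree_def)
  define l where "l v = (\<Sum>a\<in>T. if v \<in> tree_cut T a then 1 else (0::real))" for v
  have lT: "l y = l x + 1" if xy: "(x, y) \<in> T" for x y
  proof -
    have "l y - l x = (\<Sum>a\<in>T. mass (tree_cut T a) (edge_vec (x, y)))"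
      unfolding l_def by (simp add: mass_edge_vec sum_subtractf)
    also have "\<dots> = (\<Sum>a\<in>T. if a = (x, y) then 1 else 0)"
      using mass_tree_cut[OF T _ xy] by (intro sum.cong) auto
    also have "\<dots> = 1" using xy by (simp add: sum.delta)
    finally show ?thesis by simp
  qed
  have "l h = l t + 1" if e: "(t, h) \<in> E" for t h
  proof (cases "(t, h) \<in> T")
    case False
    have "(h, t) \<in> (sym_closure T)\<^sup>*"
      using T simple verts spanning_tree_iff_cut_tree[of G T] unfolding undirected_spanning_tree_def verts connected_iff by blast
    moreover have "(h, t) \<notin> sym_closure T" "h \<noteq> t" using False e TE no_2cycle no_loop by (auto simp: sym_closure_def)
    moreover have "(t, h) \<in> sym_closure E" using e by (auto simp: sym_closure_def)
    ultimately obtain p where p: "undirected_cycle \<lparr>pverts = UNIV, parcs = E\<rparr> (p @ [(t, h)])" "pcas h p t" "set p \<subseteq> sym_closure T"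
      using cycle_from_path[OF _ TE] by metis
    then have "semi_balanced_cycle G (p @ [(t, h)])" using balanced record_eq by (auto simp: semi_balanced_def)
    then have "length (filter (\<lambda>(u, v). (u, v) \<in> E) p) + 1 = length (filter (\<lambda>(u, v). (v, u) \<in> E) p)"
      using e no_2cycle[OF e] by (simp add: semi_balanced_cycle_def)
    moreover have "l t - l h = real (length (filter (\<lambda>(u, v). (u, v) \<in> E) p)) - real (length (filter (\<lambda>(u, v). (v, u) \<in> E) p))"
      by (rule pcas_potential[OF p(2,3) lT TE]) (auto dest: no_2cycle)
    ultimately show ?thesis by linarith
  qed (use lT in blast)
  then show ?thesis by blast
qed

definition pot :: "'v \<Rightarrow> real" where "pot = (SOME l. \<forall>x y. (x, y) \<in> E \<longrightarrow> l y = l x + 1)"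

lemma pot: "(x, y) \<in> E \<Longrightarrow> pot y = pot x + 1"
  using someI_ex[OF ex_potential] unfolding pot_def[symmetric] by blast

text \<open>The linear functional that is 1 on every edge vector.\<close>

definition height :: "real ^ 'v \<Rightarrow> real" where "height w = (\<Sum>v\<in>UNIV. pot v * w $ v)"

lemma linear_height: "linear height"
  unfolding height_def by (intro linearI) (auto simp: sum.distrib sum_distrib_left algebra_simps)

lemma height_edge_vec: "a \<in> E \<Longrightarrow> height (edge_vec a) = 1"
proof -
  assume a: "a \<in> E"
  obtain x y where xy: "a = (x, y)" by (cases a)
  have "height (axis v 1) = pot v" for v
  proof -
    have "height (axis v 1) = (\<Sum>u\<in>UNIV. if u = v then pot u else 0)"
      unfolding height_def by (intro sum.cong) (auto simp: axis_def)
    then show ?thesis by simp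
  qed
  then have "height (edge_vec a) = pot y - pot x"
    unfolding xy edge_vec_def using linear_height by (simp add: linear_diff)
  then show ?thesis using pot a xy by auto
qed

lemma height_sum:
  assumes "T \<subseteq> E" shows "height (\<Sum>a\<in>T. f a *\<^sub>R edge_vec a) = sum f T"
proof -
  have "height (\<Sum>a\<in>T. f a *\<^sub>R edge_vec a) = (\<Sum>a\<in>T. f a * height (edge_vec a))"
    using linear_height by (simp add: linear_sum linear_cmul)
  also have "\<dots> = sum f T" using assms height_edge_vec by (intro sum.cong) auto
  finally show ?thesis .
qed

text \<open>In the covering argument this guarantees a positive coefficient, and hence that a pivot exists.\<close>

lemma tree_coefficients_sum:
  assumes T: "cut_tree E T" and e: "e \<in> E"
  shows "(\<Sum>a\<in>T. mass (tree_cut T a) (edge_vec e)) = 1"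
  using height_sum[of T "\<lambda>a. mass (tree_cut T a) (edge_vec e)"] edge_vec_tree_expansion[OF T no_loop, of e] T height_edge_vec[OF e]
  by (simp add: cut_tree_def)

end

section \<open>Cyclic permutations\<close>

lemma cyclic_on_enumerate:
  assumes "cyclic_on f S" "x \<in> S"
  shows "bij_betw (\<lambda>i. (f ^^ i) x) {0..<card S} S" and "(f ^^ card S) x = x"
proof -
  have S: "S = orbit f x" using assms by (simp add: cyclic_on_alldef)
  then have x: "x \<in> orbit f x" using assms by simp
  let ?n = "funpow_dist1 f x x"
  have im: "S = (\<lambda>i. (f ^^ i) x) ` {0..<?n}"
    using orbit_conv_funpow_dist1[OF x] S by simp
  have inj: "inj_on (\<lambda>i. (f ^^ i) x) {0..<?n}"
    using inj_on_funpow_dist1[OF x] by simp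
  have card: "card S = ?n" using im card_image[OF inj] by simp
  show "bij_betw (\<lambda>i. (f ^^ i) x) {0..<card S} S"
    unfolding card using im inj by (simp add: bij_betw_def)
  show "(f ^^ card S) x = x" unfolding card using funpow_dist1_prop[OF x] .
qed

lemma cyclic_on_inj_on:
  assumes "cyclic_on f S" shows "inj_on f S"
proof (rule finite_surj_inj)
  show "finite S" using finite_cyclic_on[OF assms] .
  show "S \<subseteq> f ` S"
  proof
    fix x assume x: "x \<in> S"
    then have "x \<in> orbit f x" using assms by (simp add: cyclic_on_alldef)
    then show "x \<in> f ` S" using x assms by (metis cyclic_on_alldef image_eqI orbit.cases)
  qed
qed

section \<open>Tours\<close>

text \<open>A discrete intermediate value theorem.\<close>

lemma discrete_change:
  fixes s :: "nat \<Rightarrow> bool"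
  assumes "i \<le> j" "s i \<noteq> s j"
  obtains m where "i \<le> m" "m < j" "s m = s i" "s (Suc m) \<noteq> s i"
proof -
  have "\<exists>m. i \<le> m \<and> m < j \<and> s m = s i \<and> s (Suc m) \<noteq> s i"
    using assms
  proof (induction j rule: dec_induct)
    case (step n)
    then show ?case by (cases "s n = s i") (auto intro: less_SucI)
  qed simp
  then show thesis using that by blast
qed

locale toured_graph = semi_balanced_graph G for G :: "'v::finite pair_pre_digraph" +
  fixes \<rho> :: "'v ribbon" and b :: "'v \<times> ('v \<times> 'v)"
  assumes ribbon: "ribbon_structure G \<rho>"
    and basis: "basis_pair G b"
begin

text \<open>The node-edge pairs on which tours live. A tour is an orbit of a permutation of this set.\<close>

definition flags :: "('v \<times> ('v \<times> 'v)) set" where "flags = {(x, a). a \<in> incident G x}"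

abbreviation flag :: "('v \<times> 'v) set \<Rightarrow> nat \<Rightarrow> 'v \<times> ('v \<times> 'v)" where
  "flag T i \<equiv> (tour_step \<rho> T ^^ i) b"

abbreviation len :: "('v \<times> 'v) set \<Rightarrow> nat" where "len T \<equiv> tour_length \<rho> b T"

lemma cyclic: "incident G x \<noteq> {} \<Longrightarrow> cyclic_on (\<rho> x) (incident G x)"
  using ribbon verts by (simp add: ribbon_structure_def)

lemma rotate_incident: "a \<in> incident G x \<Longrightarrow> \<rho> x a \<in> incident G x"
  using cyclic[of x] by (blast intro: cyclic_on_inI)

lemma rotate_inj: "inj_on (\<rho> x) (incident G x)"
  using cyclic[of x] by (cases "incident G x = {}") (auto intro: cyclic_on_inj_on)

lemma opposite_incident: "a \<in> incident G x \<Longrightarrow> a \<in> incident G (opposite_end a x)"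
  by (auto simp: incident_def opposite_end_def)

lemma opposite_opposite: "a \<in> incident G x \<Longrightarrow> opposite_end a (opposite_end a x) = x"
  using no_loop[of x] by (cases a) (auto simp: incident_def opposite_end_def)

lemma opposite_cases: "a \<in> incident G x \<Longrightarrow> a \<in> incident G y \<Longrightarrow> y = x \<or> y = opposite_end a x"
  by (auto simp: incident_def opposite_end_def)

lemma tour_step_in_flags: "u \<in> flags \<Longrightarrow> tour_step \<rho> T u \<in> flags"
  by (cases u) (auto simp: flags_def tour_step_def Let_def intro: rotate_incident opposite_incident)

text \<open>Both kinds of steps end with a rotation at the new vertex. Undoing it reveals the edge, and the
  edge tells whether the vertex has changed.\<close>

lemma tour_step_inj: "inj_on (tour_step \<rho> T) flags"
proof (rule inj_onI, clarify)
  fix x a y c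
  assume u: "(x, a) \<in> flags" and v: "(y, c) \<in> flags" and eq: "tour_step \<rho> T (x, a) = tour_step \<rho> T (y, c)"
  define x' where "x' = (if a \<in> T then opposite_end a x else x)"
  define y' where "y' = (if c \<in> T then opposite_end c y else y)"
  have s: "tour_step \<rho> T (x, a) = (x', \<rho> x' a)" "tour_step \<rho> T (y, c) = (y', \<rho> y' c)"
    by (auto simp: tour_step_def x'_def y'_def Let_def)
  have inc: "a \<in> incident G x'" "c \<in> incident G y'"
    using u v opposite_incident by (auto simp: flags_def x'_def y'_def)
  have xy: "x' = y'" "\<rho> x' a = \<rho> x' c" using eq s by auto
  then have "a = c" using inc inj_onD[OF rotate_inj] by metis
  moreover have "x = y"
    using xy(1) u v \<open>a = c\<close> opposite_opposite by (auto simp: x'_def y'_def flags_def split: if_splits) (metis opposite_opposite)+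
  ultimately show "x = y \<and> a = c" by simp
qed

lemma basis_in_flags: "b \<in> flags"
  using basis by (cases b) (auto simp: basis_pair_def flags_def)

lemma flag_in_flags: "flag T i \<in> flags"
  by (induction i) (auto intro: tour_step_in_flags basis_in_flags)

lemma flag_cancel: "flag T (i + k) = flag T (j + k) \<Longrightarrow> flag T i = flag T j"
proof (induction k)
  case (Suc k)
  then have "tour_step \<rho> T (flag T (i + k)) = tour_step \<rho> T (flag T (j + k))" by simp
  then have "flag T (i + k) = flag T (j + k)" using tour_step_inj flag_in_flags by (metis inj_onD)
  then show ?case by (rule Suc.IH)
qed simp

lemma tour_returns: "0 < len T" "flag T (len T) = b"
proof -
  have "\<not> inj (flag T)"
    using flag_in_flags finite_imageD[of "flag T" UNIV] finite_subset[of "range (flag T)" flags] by (metis finite infinite_UNIV_nat)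
  then obtain i j where ij: "i \<noteq> j" "flag T i = flag T j" by (auto simp: inj_def)
  have "\<exists>n. 0 < n \<and> flag T n = b"
  proof -
    have "\<exists>n. 0 < n \<and> flag T n = b" if "i < j" "flag T i = flag T j" for i j
      using flag_cancel[of 0 i T "j - i"] that by (intro exI[of _ "j - i"]) auto
    then show ?thesis using ij by (metis linorder_neqE_nat)
  qed
  then have "0 < len T \<and> flag T (len T) = b" unfolding tour_length_def by (rule LeastI_ex)
  then show "0 < len T" "flag T (len T) = b" by auto
qed

lemma flag_inj:
  assumes "i < len T" "j < len T" "flag T i = flag T j" shows "i = j"
proof -
  have "\<not> (i < j)" if "j < len T" "flag T i = flag T j" for i j
  proof
    assume "i < j"
    then have "flag T (j - i) = b" using flag_cancel[of 0 i T "j - i"] that by simp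
    moreover have "0 < j - i" "j - i < len T" using \<open>i < j\<close> that by auto
    ultimately show False using not_less_Least[of "j - i" "\<lambda>n. 0 < n \<and> flag T n = b"] by (auto simp: tour_length_def)
  qed
  then show ?thesis using assms by (metis linorder_neqE_nat)
qed

lemma flag_periodic: "flag T (i + len T) = flag T i"
  using tour_returns(2)[of T] by (simp add: funpow_add)

lemma flag_mod: "flag T (i mod len T) = flag T i"
proof -
  have "flag T (j + k * len T) = flag T j" for j k
    by (induction k) (auto simp: flag_periodic add.assoc[symmetric] add.commute[of "len T"])
  then show ?thesis by (metis mod_mult_div_eq add.commute mult.commute)
qed

lemma precedes_iff: "precedes_in (tour \<rho> b T) u v \<longleftrightarrow> (\<exists>i j. i < j \<and> j < len T \<and> flag T i = u \<and> flag T j = v)"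
proof -
  have nth: "length (tour \<rho> b T) = len T" "\<And>i. i < len T \<Longrightarrow> tour \<rho> b T ! i = flag T i"
    by (simp_all add: tour_def)
  show ?thesis unfolding precedes_in_def by (intro iff_exI) (auto simp: nth)
qed

lemma flag_Suc:
  "flag T (Suc i) = (let (x, a) = flag T i; y = (if a \<in> T then opposite_end a x else x) in (y, \<rho> y a))"
  by (simp add: tour_step_def Let_def split: prod.splits)

text \<open>A tour moves only along arcs of the tree, and only one of them crosses the fundamental cut.\<close>

lemma tour_side_change:
  assumes "cut_tree (parcs G) T" "g \<in> T"
    "(fst (flag T i) \<in> tree_cut T g) \<noteq> (fst (flag T (Suc i)) \<in> tree_cut T g)"
  shows "snd (flag T i) = g"
proof -
  obtain x a where xa: "flag T i = (x, a)" by (cases "flag T i")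
  have inc: "a \<in> incident G x" using flag_in_flags[of i T] xa by (simp add: flags_def)
  have "a \<in> T" using assms(3) xa by (auto simp: flag_Suc Let_def simp del: funpow.simps split: if_splits)
  moreover have "fst (flag T (Suc i)) = opposite_end a x" using xa \<open>a \<in> T\<close> by (simp add: flag_Suc Let_def del: funpow.simps)
  then have "crosses a (tree_cut T g)"
    using assms(3) xa inc by (auto simp: crosses_def incident_def opposite_end_def split: if_splits)
  ultimately show ?thesis using tree_cut(3)[OF assms(1,2)] xa by auto
qed

lemma endpoint_determined_by_side:
  assumes "cut_tree (parcs G) T" "g \<in> T" "(x, g) \<in> flags" "(y, g) \<in> flags"
    "(x \<in> tree_cut T g) = (y \<in> tree_cut T g)"
  shows "x = y"
  using tree_cut(1,2)[OF assms(1,2)] assms(3-5) by (auto simp: flags_def incident_def)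

text \<open>The tour visits the far side of a fundamental cut in one block: after it has crossed to the far
  side and has come back, it would have to cross at the same flag \<open>(x, g)\<close> again, but the flags
  of a tour are distinct.\<close>

lemma tour_no_return:
  assumes T: "cut_tree (parcs G) T" "g \<in> T"
    and i: "flag T i = (x, g)" "i < k" "k < j" "j < len T"
    and k: "(fst (flag T k) \<in> tree_cut T g) = (x \<in> tree_cut T g)"
    and j: "(fst (flag T j) \<in> tree_cut T g) \<noteq> (x \<in> tree_cut T g)"
  shows False
proof -
  obtain m where m: "k \<le> m" "m < j"
    "(fst (flag T m) \<in> tree_cut T g) = (fst (flag T k) \<in> tree_cut T g)"
    "(fst (flag T (Suc m)) \<in> tree_cut T g) \<noteq> (fst (flag T k) \<in> tree_cut T g)"
    using discrete_change[of k j "\<lambda>i. fst (flag T i) \<in> tree_cut T g"] i j k by (metis less_imp_le)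
  have "snd (flag T m) = g" using tour_side_change[OF T, of m] m by blast
  then obtain y where y: "flag T m = (y, g)" by (cases "flag T m") auto
  have "y = x" using endpoint_determined_by_side[OF T, of y x] flag_in_flags[of m T] flag_in_flags[of i T] i y m(3) k by simp
  then have "m = i" using flag_inj[of m T i] i y m by auto
  then show False using i m by simp
qed

text \<open>A tour is periodic, so after it has crossed a fundamental cut it has to cross back, which is
  possible only along the same arc from its other end.\<close>

lemma visits_other_end:
  assumes T: "cut_tree (parcs G) T" "g \<in> T" and i: "flag T i = (x, g)"
  shows "\<exists>m. flag T m = (opposite_end g x, g)"
proof -
  let ?s = "\<lambda>i. fst (flag T i) \<in> tree_cut T g"
  have inc: "g \<in> incident G x" using flag_in_flags[of i T] i by (simp add: flags_def)
  have "fst (flag T (Suc i)) = opposite_end g x" using i T(2) by (simp add: flag_Suc Let_def del: funpow.simps)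
  then have 1: "?s (Suc i) \<noteq> ?s i" using i inc tree_cut(1,2)[OF T]
    by (auto simp: incident_def opposite_end_def simp del: funpow.simps)
  have 2: "?s (i + len T) = ?s i" by (simp only: flag_periodic)
  obtain m where m: "?s m = ?s (Suc i)" "?s (Suc m) \<noteq> ?s (Suc i)"
    using discrete_change[of "Suc i" "i + len T" ?s] 1 2 tour_returns(1)[of T] by (metis Suc_leI less_add_same_cancel1)
  have "snd (flag T m) = g" using tour_side_change[OF T, of m] m by blast
  then obtain y where y: "flag T m = (y, g)" by (cases "flag T m") auto
  have "y \<noteq> x" using m(1) 1 y i by auto
  moreover have "g \<in> incident G y" using flag_in_flags[of m T] y by (simp add: flags_def)
  ultimately have "y = opposite_end g x" using opposite_cases[OF inc] by blast
  then show ?thesis using y by blast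
qed

text \<open>The visited flags are closed under rotation at a vertex: for an edge of the tree, rotate when the
  tour comes back from the other end. Hence a visited vertex is visited with all its edges, and no
  arc of the tree leads from visited to unvisited vertices.\<close>

lemma tour_visits_all:
  assumes T: "cut_tree (parcs G) T" and u: "u \<in> flags"
  obtains i where "i < len T" "flag T i = u"
proof -
  let ?O = "range (flag T)"
  have rot: "(x, \<rho> x a) \<in> ?O" if xa: "(x, a) \<in> ?O" for x a
  proof -
    obtain i where i: "flag T i = (x, a)" using xa by (elim rangeE) simp
    show ?thesis
    proof (cases "a \<in> T")
      case True
      then obtain m where m: "flag T m = (opposite_end a x, a)" using visits_other_end[OF T True i] by blast
      have "a \<in> incident G x" using flag_in_flags[of i T] i by (simp add: flags_def)
      then have "flag T (Suc m) = (x, \<rho> x a)" using m True opposite_opposite by (simp add: flag_Suc Let_def del: funpow.simps)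
      then show ?thesis by (metis rangeI)
    next
      case False
      then have "flag T (Suc i) = (x, \<rho> x a)" using i by (simp add: flag_Suc Let_def del: funpow.simps)
      then show ?thesis by (metis rangeI)
    qed
  qed
  have all_at: "(x, c) \<in> ?O" if xa: "(x, a) \<in> ?O" and c: "c \<in> incident G x" for x a c
  proof -
    obtain i where i: "flag T i = (x, a)" using xa by (elim rangeE) simp
    have a: "a \<in> incident G x" using flag_in_flags[of i T] i by (simp add: flags_def)
    then have "c \<in> orbit (\<rho> x) a" using cyclic[of x] c by (auto simp: cyclic_on_alldef)
    then show ?thesis by (induction rule: orbit.induct) (use xa rot in auto)
  qed
  define V where "V = {x. \<exists>a. (x, a) \<in> ?O}"
  have "\<not> crosses a V" if a: "a \<in> T" for a
  proof
    assume cr: "crosses a V"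
    have aG: "a \<in> parcs G" using T a by (auto simp: cut_tree_def)
    have "\<exists>x. x \<in> V \<and> opposite_end a x \<notin> V \<and> a \<in> incident G x"
    proof (cases "fst a \<in> V")
      case True
      then show ?thesis using cr aG by (intro exI[of _ "fst a"]) (simp add: crosses_def incident_def opposite_end_def)
    next
      case False
      then have "snd a \<in> V" "snd a \<noteq> fst a" using cr by (auto simp: crosses_def)
      then show ?thesis using False aG by (intro exI[of _ "snd a"]) (simp add: incident_def opposite_end_def)
    qed
    then obtain x where xy: "x \<in> V" "opposite_end a x \<notin> V" "a \<in> incident G x" by blast
    obtain c where "(x, c) \<in> ?O" using xy(1) unfolding V_def by blast
    from all_at[OF this xy(3)] obtain i where "flag T i = (x, a)" by (elim rangeE) simp
    then have "(opposite_end a x, a) \<in> ?O" using visits_other_end[OF T a] by (metis rangeI)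
    then show False using xy(2) unfolding V_def by blast
  qed
  moreover have "fst b \<in> V"
    unfolding V_def using rangeI[of "flag T" 0] by (intro CollectI exI[of _ "snd b"]) simp
  ultimately have "V = UNIV" using cut_tree_connected[OF T, of V] by blast
  moreover obtain x c where xc: "u = (x, c)" "c \<in> incident G x" using u by (auto simp: flags_def)
  ultimately have "x \<in> V" by blast
  then obtain a where "(x, a) \<in> ?O" unfolding V_def by blast
  then have "u \<in> ?O" using all_at xc by blast
  then obtain i where "flag T i = u" by (elim rangeE) simp
  then show thesis using that[of "i mod len T"] flag_mod[of i T] tour_returns(1)[of T] by simp
qed

lemma jaeger_tree_iff:
  "jaeger_tree G \<rho> b T \<longleftrightarrow> cut_tree E T \<and>
    (\<forall>a\<in>E - T. \<exists>i j. i < j \<and> j < len T \<and> flag T i = (fst a, a) \<and> flag T j = (snd a, a))"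
  unfolding jaeger_tree_def precedes_iff spanning_tree_iff_cut_tree[OF simple verts] by (simp add: split_beta)

lemma tours_agree:
  assumes "\<And>j. j < i \<Longrightarrow> snd (flag T j) \<in> T \<longleftrightarrow> snd (flag T j) \<in> T'"
  shows "flag T' i = flag T i"
  using assms
proof (induction i)
  case (Suc i)
  then have "flag T' i = flag T i" by simp
  then show ?case using Suc.prems[of i] by (cases "flag T i") (simp add: flag_Suc Let_def del: funpow.simps)
qed simp

lemma agreeing_prefix_in_tour:
  assumes agree: "\<And>j. j < i \<Longrightarrow> snd (flag T j) \<in> T \<longleftrightarrow> snd (flag T j) \<in> T'" and i: "i < len T"
  shows "i < len T'"
proof (rule ccontr)
  assume n: "\<not> i < len T'"
  have "flag T' (len T') = flag T (len T')"
    using agree n by (intro tours_agree) auto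
  then have "flag T (len T') = flag T 0" using tour_returns(2)[of T'] by simp
  then show False using flag_inj[of "len T'" T 0] tour_returns(1)[of T'] n i by simp
qed

end

section \<open>The dissection by Jaeger trees\<close>

context toured_graph begin

lemma tree_subset: "cut_tree E T \<Longrightarrow> T \<subseteq> E" by (simp add: cut_tree_def)

lemma tail_flag: "a \<in> E \<Longrightarrow> (fst a, a) \<in> flags" and head_flag: "a \<in> E \<Longrightarrow> (snd a, a) \<in> flags"
  by (auto simp: flags_def incident_def)

text \<open>Here \<open>e\<close> is the first arc about which the tours disagree. It is met at its tail, as \<open>T'\<close> is a
  Jaeger tree that omits \<open>e\<close>. An arc of \<open>T'\<close> that enters the head side of the cut of \<open>e\<close> would be
  met by the tour of \<open>T\<close> at its tail before \<open>e\<close>, where both trees agree, but it is not in \<open>T\<close>.\<close>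

lemma separating_cut_directed:
  assumes T: "jaeger_tree G \<rho> b T" and T': "jaeger_tree G \<rho> b T'"
    and agree: "\<And>j. j < i \<Longrightarrow> snd (flag T j) \<in> T \<longleftrightarrow> snd (flag T j) \<in> T'"
    and i: "i < len T" "snd (flag T i) = e" "e \<in> T" "e \<notin> T'"
  shows "\<forall>a\<in>T'. mass (tree_cut T e) (edge_vec a) \<le> 0"
proof (rule ballI, rule ccontr)
  fix a assume a: "a \<in> T'" "\<not> mass (tree_cut T e) (edge_vec a) \<le> 0"
  let ?X = "tree_cut T e"
  have tree: "cut_tree E T" "cut_tree E T'" using T T' by (auto simp: jaeger_tree_iff)
  have J: "\<exists>i j. i < j \<and> j < len T \<and> flag T i = (fst a, a) \<and> flag T j = (snd a, a)" if "a \<in> E" "a \<notin> T" for a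
    using T that unfolding jaeger_tree_iff by simp
  have J': "\<exists>i j. i < j \<and> j < len T' \<and> flag T' i = (fst a, a) \<and> flag T' j = (snd a, a)" if "a \<in> E" "a \<notin> T'" for a
    using T' that unfolding jaeger_tree_iff by simp
  have same: "flag T' j = flag T j" if "j \<le> i" for j
    using agree that by (intro tours_agree) auto
  have i': "i < len T'" using agree i(1) by (rule agreeing_prefix_in_tour)
  have eE: "e \<in> E" using tree_subset[OF tree(1)] i(3) by blast
  obtain x where x: "flag T i = (x, e)" using i(2) by (cases "flag T i") auto
  have "x = fst e"
  proof (rule ccontr)
    assume "x \<noteq> fst e"
    moreover have "e \<in> incident G x" using flag_in_flags[of i T] x by (simp add: flags_def)
    ultimately have xh: "x = snd e" by (auto simp: incident_def)
    obtain k j where kj: "k < j" "j < len T'" "flag T' k = (fst e, e)" "flag T' j = (snd e, e)"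
      using J'[OF eE i(4)] by blast
    have "flag T' i = (snd e, e)" using same[of i] x xh by simp
    then have "j = i" using flag_inj[of j T' i] kj i' by simp
    then have "flag T k = (fst e, e)" using same[of k] kj by simp
    then show False using agree[of k] kj \<open>j = i\<close> i by simp
  qed
  then have xX: "x \<notin> ?X" using tree_cut(2)[OF tree(1) i(3)] by simp
  have aX: "fst a \<notin> ?X" "snd a \<in> ?X" using a(2) by (auto simp: mass_edge_vec split: if_splits)
  then have cr: "crosses a ?X" by (simp add: crosses_def)
  have ae: "a \<noteq> e" using a(1) i(4) by auto
  then have aT: "a \<notin> T" using tree_cut(3)[OF tree(1) i(3) _ cr] by blast
  have aE: "a \<in> E" using tree_subset[OF tree(2)] a(1) by blast
  obtain k j where kj: "k < j" "j < len T" "flag T k = (fst a, a)" "flag T j = (snd a, a)"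
    using J[OF aE aT] by blast
  have "\<not> i < k"
    using tour_no_return[OF tree(1) i(3) x _ kj(1,2)] kj(3,4) aX xX by auto
  moreover have "k \<noteq> i" using kj(3) x ae by auto
  ultimately have "k < i" by simp
  then show False using agree[of k] kj(3) aT a(1) by simp
qed

lemma separating_cut:
  assumes T: "jaeger_tree G \<rho> b T" and T': "jaeger_tree G \<rho> b T'" and ne: "T \<noteq> T'"
  obtains e where "e \<in> T" "\<forall>a\<in>T'. mass (tree_cut T e) (edge_vec a) \<le> 0"
    | e where "e \<in> T'" "\<forall>a\<in>T. mass (tree_cut T' e) (edge_vec a) \<le> 0"
proof -
  have tree: "cut_tree E T" "cut_tree E T'" using T T' by (auto simp: jaeger_tree_iff)
  have "\<exists>i. i < len T \<and> (snd (flag T i) \<in> T \<longleftrightarrow> snd (flag T i) \<notin> T')"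
  proof -
    obtain a where a: "a \<in> T \<longleftrightarrow> a \<notin> T'" using ne by blast
    then have "a \<in> E" using tree_subset[OF tree(1)] tree_subset[OF tree(2)] by blast
    then obtain i where "i < len T" "flag T i = (fst a, a)" using tour_visits_all[OF tree(1) tail_flag] by blast
    then show ?thesis using a by (intro exI[of _ i]) auto
  qed
  then obtain i where i: "i < len T" "snd (flag T i) \<in> T \<longleftrightarrow> snd (flag T i) \<notin> T'"
    and min: "\<And>j. j < i \<Longrightarrow> \<not> (j < len T \<and> (snd (flag T j) \<in> T \<longleftrightarrow> snd (flag T j) \<notin> T'))"
    using exists_least_iff[of "\<lambda>i. i < len T \<and> (snd (flag T i) \<in> T \<longleftrightarrow> snd (flag T i) \<notin> T')"] by blast
  have agree: "snd (flag T j) \<in> T \<longleftrightarrow> snd (flag T j) \<in> T'" if "j < i" for j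
    using min[OF that] that i(1) by auto
  show thesis
  proof (cases "snd (flag T i) \<in> T")
    case True
    then show thesis using separating_cut_directed[OF T T' agree i(1) refl] i that(1) by blast
  next
    case False
    have same: "flag T' j = flag T j" if "j \<le> i" for j
      using agree that by (intro tours_agree) auto
    have i': "i < len T'" using agree i(1) by (rule agreeing_prefix_in_tour)
    have "snd (flag T' j) \<in> T' \<longleftrightarrow> snd (flag T' j) \<in> T" if "j < i" for j
      using agree[OF that] same[of j] that by auto
    moreover have "snd (flag T' i) \<in> T'" "snd (flag T' i) \<notin> T" using False i(2) same[of i] by auto
    ultimately show thesis using separating_cut_directed[OF T' T _ i' refl] that(2) by blast
  qed
qed

text \<open>By Caratheodory, a smallest set of edge vectors whose hull contains \<open>p\<close> is affinely independent.
  As all edge vectors have height 1, it is linearly independent and extends to a spanning tree.\<close>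

lemma ex_tree_polytope:
  assumes "p \<in> root_polytope E"
  shows "\<exists>T. cut_tree E T \<and> p \<in> root_polytope T"
proof -
  let ?P = "\<lambda>S. S \<subseteq> edge_vec ` E \<and> p \<in> convex hull S"
  have hull: "root_polytope A = convex hull (edge_vec ` A)" for A :: "('v \<times> 'v) set"
    by (simp add: root_polytope_def edge_vec_def)
  have "?P (edge_vec ` E)" using assms by (simp add: hull)
  then obtain S where S: "?P S" and min: "\<And>S'. ?P S' \<Longrightarrow> card S \<le> card S'"
    using exists_least_iff[of "\<lambda>n. \<exists>S. ?P S \<and> card S = n"] by (metis not_le)
  have SE: "S \<subseteq> edge_vec ` E" and pS: "p \<in> convex hull S" using S by simp_all
  have fin: "finite S" using finite_subset[OF SE] by simp
  obtain S' where S': "finite S'" "S' \<subseteq> S" "int (card S') \<le> aff_dim S + 1" "p \<in> convex hull S'"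
    using pS unfolding caratheodory_aff_dim[of S] mem_Collect_eq by metis
  have "card S \<le> card S'" using min[of S'] SE S'(2,4) by (meson subset_trans)
  then have "aff_dim S = int (card S) - 1" using S'(3) aff_dim_le_card[OF fin] by linarith
  then have naff: "\<not> affine_dependent S" using fin affine_independent_iff_card by blast
  have ind: "independent S"
  proof
    assume "dependent S"
    then obtain u where u: "\<exists>v\<in>S. u v \<noteq> 0" "(\<Sum>v\<in>S. u v *\<^sub>R v) = 0" using dependent_finite[OF fin] by blast
    have "height (\<Sum>v\<in>S. u v *\<^sub>R v) = (\<Sum>v\<in>S. u v * height v)"
      using linear_height by (simp add: linear_sum linear_cmul)
    also have "\<dots> = sum u S" using SE height_edge_vec by (intro sum.cong) auto
    finally have "sum u S = 0" using u(2) linear_height by (simp add: linear_0)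
    then show False using naff u affine_dependent_explicit_finite[OF fin] by blast
  qed
  then obtain T where T: "cut_tree E T" "S \<subseteq> edge_vec ` T"
    using ex_cut_tree[OF no_loop connected_rtrancl SE ind] by metis
  have "p \<in> root_polytope T" unfolding hull using pS hull_mono[OF T(2)] by (rule subsetD[rotated])
  then show ?thesis using T by blast
qed

text \<open>The ratio test of the simplex algorithm. The coefficients of \<open>edge_vec e\<close> in the tree are -1,
  0 or 1, and the coefficient of \<open>g\<close> is 1 iff \<open>e\<close> crosses the fundamental cut of \<open>g\<close> in
  the same direction as \<open>g\<close>.\<close>

lemma pivot_keeps_point:
  assumes T: "cut_tree E T" and p: "p \<in> root_polytope T" and e: "e \<in> E" "e \<notin> T"
  obtains g where "g \<in> T" "mass (tree_cut T g) (edge_vec e) = 1" "p \<in> root_polytope (insert e (T - {g}))"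
proof -
  let ?c = "\<lambda>a. mass (tree_cut T a) (edge_vec e)"
  have inj: "inj_on edge_vec T" using edge_vec_inj_E tree_subset[OF T] by blast
  obtain f where f: "\<forall>a\<in>T. 0 \<le> f a" "sum f T = 1" "p = (\<Sum>a\<in>T. f a *\<^sub>R edge_vec a)"
    using p root_polytope_iff[OF inj] by blast
  define A where "A = {a \<in> T. ?c a = 1}"
  have c01: "?c a = 1 \<or> ?c a \<le> 0" for a by (auto simp: mass_edge_vec)
  have "A \<noteq> {}"
  proof
    assume "A = {}"
    then have "sum ?c T \<le> 0" using c01 by (intro sum_nonpos) (auto simp: A_def)
    then show False using tree_coefficients_sum[OF T e(1)] by simp
  qed
  define g where "g = arg_min_on f A"
  have g: "g \<in> A" "\<And>a. a \<in> A \<Longrightarrow> f g \<le> f a"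
    using arg_min_if_finite[of A f] \<open>A \<noteq> {}\<close> unfolding g_def by (auto simp: not_less)
  have gT: "g \<in> T" "?c g = 1" using g(1) by (auto simp: A_def)
  (* Increase the coefficient of e until the coefficient of g is the first one in the tree to drop to 0. *)
  define f' where "f' a = (if a = e then f g else f a - f g * ?c a)" for a
  let ?T = "insert e (T - {g})"
  have T'E: "?T \<subseteq> E" using tree_subset[OF T] e by auto
  have "f' a \<ge> 0" if "a \<in> ?T" for a
  proof (cases "a = e")
    case False
    then have aT: "a \<in> T" using that by auto
    show ?thesis
    proof (cases "?c a = 1")
      case True
      then show ?thesis using g(2)[of a] aT False by (simp add: f'_def A_def)
    next
      case n: False
      then have "f g * ?c a \<le> 0" using c01[of a] f(1) gT by (auto intro: mult_nonneg_nonpos)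
      moreover have "f' a = f a - f g * ?c a" "0 \<le> f a" using f(1) aT False by (simp_all add: f'_def)
      ultimately show ?thesis by linarith
    qed
  qed (use f(1) gT in \<open>simp add: f'_def\<close>)
  moreover have p_eq: "p = (\<Sum>a\<in>?T. f' a *\<^sub>R edge_vec a)"
  proof -
    have "p = (\<Sum>a\<in>T. (f a - f g * ?c a) *\<^sub>R edge_vec a) + f g *\<^sub>R (\<Sum>a\<in>T. ?c a *\<^sub>R edge_vec a)"
      unfolding f(3) by (simp add: scaleR_left_diff_distrib sum_subtractf scaleR_sum_right)
    also have "(\<Sum>a\<in>T. ?c a *\<^sub>R edge_vec a) = edge_vec e"
      using edge_vec_tree_expansion[OF T no_loop, of e] by simp
    also have "(\<Sum>a\<in>T. (f a - f g * ?c a) *\<^sub>R edge_vec a) = (\<Sum>a\<in>T - {g}. (f a - f g * ?c a) *\<^sub>R edge_vec a)"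
      using gT by (simp add: sum.remove)
    also have "\<dots> = (\<Sum>a\<in>T - {g}. f' a *\<^sub>R edge_vec a)"
      using e(2) by (intro sum.cong) (auto simp: f'_def)
    finally show ?thesis using e(2) by (simp add: f'_def)
  qed
  moreover have "sum f' ?T = 1"
    using height_sum[OF T'E, of f'] height_sum[OF tree_subset[OF T], of f] p_eq f by simp
  ultimately have "p \<in> root_polytope ?T"
    using root_polytope_iff[OF edge_vec_inj_E[OF T'E]] by blast
  then show thesis using that gT by blast
qed

definition good :: "('v \<times> 'v) set \<Rightarrow> 'v \<times> ('v \<times> 'v) \<Rightarrow> bool" where
  "good T = (\<lambda>(x, a). (x = fst a) = (a \<notin> T))"

text \<open>The decisions of a tour, for lexicographic comparison: 0 for a good one, which omits an arc met at
  its tail or keeps an arc met at its head, and 1 for a bad one. All tours have the length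
  \<open>card flags\<close>.\<close>

definition badness :: "('v \<times> 'v) set \<Rightarrow> nat list" where
  "badness T = map (\<lambda>i. if good T (flag T i) then 0 else 1) [0..<card flags]"

lemma badness_less:
  assumes i: "i < card flags" "\<And>j. j < i \<Longrightarrow> snd (flag T j) \<in> T \<longleftrightarrow> snd (flag T j) \<in> T'"
    and g: "\<not> good T (flag T i)" "good T' (flag T i)"
  shows "(badness T', badness T) \<in> lex less_than"
proof -
  have same: "flag T' j = flag T j" if "j \<le> i" for j
    using i(2) that by (intro tours_agree) auto
  have "good T' (flag T' j) = good T (flag T j)" if "j < i" for j
    using same[of j] i(2)[OF that] that by (cases "flag T j") (auto simp: good_def)
  then have "take i (badness T') = take i (badness T)"
    using i(1) by (auto simp: badness_def take_map)
  moreover have "badness T' ! i = 0" "badness T ! i = 1" "length (badness T') = card flags" "length (badness T) = card flags"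
    using same[of i] i(1) g by (auto simp: badness_def)
  ultimately have "badness T' = take i (badness T) @ 0 # drop (Suc i) (badness T')"
      "badness T = take i (badness T) @ 1 # drop (Suc i) (badness T)" "length (badness T') = length (badness T)"
    using i(1) id_take_nth_drop[of i "badness T"] id_take_nth_drop[of i "badness T'"] by simp_all
  moreover have "(0::nat, 1) \<in> less_than" by simp
  ultimately show ?thesis unfolding lex_conv by blast
qed

lemma tour_length_eq_card:
  assumes "cut_tree E T" shows "len T = card flags"
proof -
  have "flag T ` {..<len T} = flags"
  proof
    show "flags \<subseteq> flag T ` {..<len T}"
    proof
      fix u assume "u \<in> flags"
      then obtain i where "i < len T" "flag T i = u" using tour_visits_all[OF assms] by blast
      then show "u \<in> flag T ` {..<len T}" by blast
    qed
  qed (use flag_in_flags in blast)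
  moreover have "inj_on (flag T) {..<len T}" using flag_inj by (auto intro: inj_onI)
  ultimately show ?thesis by (metis card_image card_lessThan)
qed

text \<open>A tree that is not a Jaeger tree omits an arc that is met at its head first, and pivoting this arc
  into the tree improves the tour.\<close>

lemma jaeger_cover:
  assumes "p \<in> root_polytope E"
  shows "\<exists>T. jaeger_tree G \<rho> b T \<and> p \<in> root_polytope T"
proof -
  define C where "C = {T. cut_tree E T \<and> p \<in> root_polytope T}"
  obtain T0 where T0: "T0 \<in> C" using ex_tree_polytope[OF assms] unfolding C_def by blast
  have "wf (inv_image (lex less_than) badness)" by (intro wf_inv_image wf_lex wf_less_than)
  from wfE_min[OF this T0] obtain T where TC: "T \<in> C"
    and min: "\<And>T'. (T', T) \<in> inv_image (lex less_than) badness \<Longrightarrow> T' \<notin> C" by blast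
  have T: "cut_tree E T" and p: "p \<in> root_polytope T" using TC by (auto simp: C_def)
  have "jaeger_tree G \<rho> b T"
  proof (rule ccontr)
    assume "\<not> jaeger_tree G \<rho> b T"
    then obtain e where e: "e \<in> E" "e \<notin> T"
      and not: "\<not> (\<exists>i j. i < j \<and> j < len T \<and> flag T i = (fst e, e) \<and> flag T j = (snd e, e))"
      using T unfolding jaeger_tree_iff by auto
    obtain j where j: "j < len T" "flag T j = (fst e, e)" using tour_visits_all[OF T tail_flag[OF e(1)]] .
    obtain k where k: "k < len T" "flag T k = (snd e, e)" using tour_visits_all[OF T head_flag[OF e(1)]] .
    have ne: "fst e \<noteq> snd e" using e(1) no_loop by (cases e) auto
    have kj: "k < j" using not j k ne by (metis linorder_neqE_nat prod.inject)
    obtain g where g: "g \<in> T" "mass (tree_cut T g) (edge_vec e) = 1" "p \<in> root_polytope (insert e (T - {g}))"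
      using pivot_keeps_point[OF T p e] .
    let ?X = "tree_cut T g" and ?T = "insert e (T - {g})"
    have eX: "fst e \<notin> ?X" "snd e \<in> ?X" using g(2) by (auto simp: mass_edge_vec split: if_splits)
    have T': "cut_tree E ?T" using eX by (intro cut_tree_exchange[OF T g(1) e]) (auto simp: crosses_def)
    (* The tours of the two trees agree until one of the exchanged arcs is met. *)
    let ?P = "\<lambda>i. i < len T \<and> snd (flag T i) \<in> {e, g}"
    have "?P k" using k by simp
    then obtain i where i: "?P i" and imin: "\<And>j. j < i \<Longrightarrow> \<not> ?P j" using exists_least_iff[of ?P] by blast
    have agree: "snd (flag T j) \<in> T \<longleftrightarrow> snd (flag T j) \<in> ?T" if "j < i" for j
      using imin[OF that] i that by auto
    obtain x a where xa: "flag T i = (x, a)" by (cases "flag T i")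
    have ik: "i \<le> k" using imin[of k] \<open>?P k\<close> by (meson not_le)
    have "\<not> good T (flag T i) \<and> good ?T (flag T i)"
    proof (cases "a = e")
      case True
      then have "x = fst e \<or> x = snd e" using flag_in_flags[of i T] xa by (auto simp: flags_def incident_def)
      moreover have "x \<noteq> fst e"
      proof
        assume "x = fst e"
        then have "i = j" using flag_inj[of i T j] i j xa True by simp
        then show False using ik kj by simp
      qed
      ultimately show ?thesis using True xa ne e by (auto simp: good_def)
    next
      case False
      then have ag: "a = g" using i xa by auto
      have ge: "g \<noteq> e" using g(1) e(2) by auto
      have "x = fst g"
      proof (rule ccontr)
        assume "x \<noteq> fst g"
        (* If g were met at its head, the tour would cross the cut of g there, come back to the head side to
           meet e at its head, and leave it once more to meet e at its tail. *)
        then have "x = snd g" using flag_in_flags[of i T] xa ag by (auto simp: flags_def incident_def)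
        then have xX: "x \<in> ?X" using tree_cut(1)[OF T g(1)] by simp
        have "i \<noteq> k" using xa k ag ge by auto
        then show False
          using tour_no_return[OF T g(1) xa[unfolded ag] _ kj j(1)] ik eX xX j k by auto
      qed
      then show ?thesis using xa ag g(1) ge by (auto simp: good_def)
    qed
    then have "(badness ?T, badness T) \<in> lex less_than"
      using badness_less[OF _ agree] i tour_length_eq_card[OF T] by auto
    then show False using min[of ?T] T' g(3) by (simp add: C_def in_inv_image)
  qed
  then show ?thesis using p by blast
qed

lemma root_polytope_hull: "root_polytope A = convex hull (edge_vec ` A)" for A :: "('v \<times> 'v) set"
  by (simp add: root_polytope_def edge_vec_def)

lemma independent_tree:
  assumes T: "cut_tree E T" shows "independent (edge_vec ` T)"
proof
  assume "dependent (edge_vec ` T)"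
  then obtain u v where u: "v \<in> edge_vec ` T" "u v \<noteq> 0" "(\<Sum>v\<in>edge_vec ` T. u v *\<^sub>R v) = 0"
    using dependent_finite[of "edge_vec ` T"] by auto
  then obtain a where a: "a \<in> T" "u (edge_vec a) \<noteq> 0" by blast
  have inj: "inj_on edge_vec T" using edge_vec_inj_E tree_subset[OF T] by blast
  have "(\<Sum>a\<in>T. u (edge_vec a) *\<^sub>R edge_vec a) = 0" using u(3) by (simp add: sum.reindex[OF inj])
  then have "mass (tree_cut T a) 0 = u (edge_vec a)"
    using mass_tree_combination[OF T a(1), of "\<lambda>a. u (edge_vec a)"] by simp
  then show False using a(2) by (simp add: mass_def)
qed

text \<open>The coefficients of an edge vector with respect to a tree add up to 1.\<close>

lemma affine_hull_tree:
  assumes T: "cut_tree E T" shows "affine hull (edge_vec ` T) = affine hull (edge_vec ` E)"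
proof
  show "affine hull (edge_vec ` T) \<subseteq> affine hull (edge_vec ` E)"
    using tree_subset[OF T] by (intro hull_mono) auto
  have inj: "inj_on edge_vec T" using edge_vec_inj_E tree_subset[OF T] by blast
  have "edge_vec e \<in> affine hull (edge_vec ` T)" if e: "e \<in> E" for e
  proof -
    let ?c = "\<lambda>a. mass (tree_cut T a) (edge_vec e)"
    let ?u = "\<lambda>v. ?c (the_inv_into T edge_vec v)"
    have u: "?u (edge_vec a) = ?c a" if "a \<in> T" for a using the_inv_into_f_f[OF inj that] by simp
    have "sum ?u (edge_vec ` T) = 1"
      using tree_coefficients_sum[OF T e] by (simp add: sum.reindex[OF inj] u)
    moreover have "(\<Sum>v\<in>edge_vec ` T. ?u v *\<^sub>R v) = edge_vec e"
      using edge_vec_tree_expansion[OF T no_loop, of e] by (simp add: sum.reindex[OF inj] u)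
    ultimately show ?thesis unfolding affine_hull_finite[OF finite_imageI[OF finite]] by blast
  qed
  then show "affine hull (edge_vec ` E) \<subseteq> affine hull (edge_vec ` T)"
    by (intro hull_minimal) auto
qed

lemma tree_simplex:
  assumes T: "cut_tree E T" shows "aff_dim (root_polytope E) simplex root_polytope T"
proof -
  have naff: "\<not> affine_dependent (edge_vec ` T)"
    using independent_tree[OF T] affine_dependent_imp_dependent by blast
  have "of_nat (card (edge_vec ` T)) = aff_dim (edge_vec ` E) + 1"
    using aff_dim_unique affine_hull_tree[OF T] naff by blast
  then show ?thesis unfolding simplex_def root_polytope_hull aff_dim_convex_hull using naff
    by (intro exI[of _ "edge_vec ` T"]) auto
qed

lemma tree_polytope_subset: "cut_tree E T \<Longrightarrow> root_polytope T \<subseteq> root_polytope E"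
  unfolding root_polytope_hull using tree_subset by (intro hull_mono) auto

lemma mass_polytope_nonpos:
  assumes "p \<in> root_polytope T" "\<forall>a\<in>T. mass X (edge_vec a) \<le> 0" "T \<subseteq> E"
  shows "mass X p \<le> 0"
proof -
  obtain f where f: "\<forall>a\<in>T. 0 \<le> f a" "p = (\<Sum>a\<in>T. f a *\<^sub>R edge_vec a)"
    using assms(1) root_polytope_iff[OF edge_vec_inj_E[OF assms(3)]] by blast
  show ?thesis unfolding f(2) mass_sum using f(1) assms(2) by (intro sum_nonpos) (auto intro: mult_nonneg_nonpos)
qed

lemma mass_rel_interior_pos:
  assumes T: "cut_tree E T" and p: "p \<in> rel_interior (root_polytope T)" and e: "e \<in> T"
  shows "mass (tree_cut T e) p > 0"
proof -
  have inj: "inj_on edge_vec T" using edge_vec_inj_E tree_subset[OF T] by blast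
  have naff: "\<not> affine_dependent (edge_vec ` T)"
    using independent_tree[OF T] affine_dependent_imp_dependent by blast
  obtain u where u: "\<forall>x\<in>edge_vec ` T. 0 < u x" "(\<Sum>x\<in>edge_vec ` T. u x *\<^sub>R x) = p"
    using p unfolding root_polytope_hull rel_interior_convex_hull_explicit[OF naff] by blast
  have "p = (\<Sum>a\<in>T. u (edge_vec a) *\<^sub>R edge_vec a)" using u(2) by (simp add: sum.reindex[OF inj])
  then have "mass (tree_cut T e) p = u (edge_vec e)"
    using mass_tree_combination[OF T e, of "\<lambda>a. u (edge_vec a)"] by simp
  then show ?thesis using u(1) e by simp
qed

lemma jaeger_interiors_disjoint:
  assumes T: "jaeger_tree G \<rho> b T" and T': "jaeger_tree G \<rho> b T'" and ne: "T \<noteq> T'"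
  shows "rel_interior (root_polytope T) \<inter> rel_interior (root_polytope T') = {}"
proof (rule ccontr)
  assume "rel_interior (root_polytope T) \<inter> rel_interior (root_polytope T') \<noteq> {}"
  then obtain p where p: "p \<in> rel_interior (root_polytope T)" "p \<in> rel_interior (root_polytope T')" by blast
  then have p': "p \<in> root_polytope T" "p \<in> root_polytope T'" using rel_interior_subset by blast+
  have tree: "cut_tree E T" "cut_tree E T'" using T T' by (auto simp: jaeger_tree_iff)
  show False
  proof (rule separating_cut[OF T T' ne])
    fix e assume "e \<in> T" "\<forall>a\<in>T'. mass (tree_cut T e) (edge_vec a) \<le> 0"
    then show False
      using mass_polytope_nonpos[OF p'(2) _ tree_subset[OF tree(2)]] mass_rel_interior_pos[OF tree(1) p(1)] by (meson not_le)
  next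
    fix e assume "e \<in> T'" "\<forall>a\<in>T. mass (tree_cut T' e) (edge_vec a) \<le> 0"
    then show False
      using mass_polytope_nonpos[OF p'(1) _ tree_subset[OF tree(1)]] mass_rel_interior_pos[OF tree(2) p(2)] by (meson not_le)
  qed
qed

theorem jaeger_dissection:
  "dissection (root_polytope E) {root_polytope T | T. jaeger_tree G \<rho> b T}"
  unfolding dissection_def
proof (intro conjI ballI impI)
  let ?S = "{root_polytope T | T. jaeger_tree G \<rho> b T}"
  show "finite ?S" by simp
  fix S assume "S \<in> ?S"
  then obtain T where T: "S = root_polytope T" "jaeger_tree G \<rho> b T" by blast
  then have tree: "cut_tree E T" by (simp add: jaeger_tree_iff)
  show "aff_dim (root_polytope E) simplex S" unfolding T(1) using tree by (rule tree_simplex)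
  fix S' assume "S' \<in> ?S" and ne: "S \<noteq> S'"
  then obtain T' where T': "S' = root_polytope T'" "jaeger_tree G \<rho> b T'" by blast
  have "T \<noteq> T'" using ne T(1) T'(1) by blast
  then show "rel_interior S \<inter> rel_interior S' = {}"
    unfolding T(1) T'(1) by (rule jaeger_interiors_disjoint[OF T(2) T'(2)])
next
  let ?S = "{root_polytope T | T. jaeger_tree G \<rho> b T}"
  show "\<Union>?S = root_polytope E"
  proof
    show "\<Union>?S \<subseteq> root_polytope E"
    proof (rule Union_least)
      fix S assume "S \<in> ?S"
      then obtain T where T: "S = root_polytope T" "jaeger_tree G \<rho> b T" by blast
      then show "S \<subseteq> root_polytope E" using tree_polytope_subset by (simp add: jaeger_tree_iff)
    qed
    show "root_polytope E \<subseteq> \<Union>?S"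
    proof
      fix p assume "p \<in> root_polytope E"
      then obtain T where "jaeger_tree G \<rho> b T" "p \<in> root_polytope T" using jaeger_cover by blast
      then show "p \<in> \<Union>?S" by blast
    qed
  qed
qed

end

section \<open>Two-colourings of corners and the triangulation\<close>

text \<open>A cycle together with a direction, given by the successor \<open>nx x\<close> of a vertex and by the edge \<open>ed x\<close>
  from \<open>x\<close> to its successor. Injectivity of \<open>ed\<close> excludes going back and forth along one
  edge. The encoding as a cyclic permutation, and not as a list, makes all vertices of the cycle
  equivalent.\<close>

definition oriented_cycle :: "('v \<times> 'v) set \<Rightarrow> 'v set \<Rightarrow> ('v \<Rightarrow> 'v) \<Rightarrow> ('v \<Rightarrow> 'v \<times> 'v) \<Rightarrow> bool" where
  "oriented_cycle E S nx ed \<longleftrightarrow> cyclic_on nx S \<and> inj_on ed S \<and>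
     (\<forall>x\<in>S. ed x \<in> E \<and> (ed x = (x, nx x) \<or> ed x = (nx x, x)))"

text \<open>The flag \<open>(x, a)\<close> stands for the corner at \<open>x\<close> that precedes \<open>a\<close> in the rotation, and the
  colour says whether this corner is on the right of the cycle. The three conditions say that a
  rotation past an edge outside the cycle does not change the side, that such an edge has the
  same side at both of its ends, and how the sides alternate at an edge of the cycle.
  For the counterclockwise rotation, the corner before an edge is on the right of this edge
  when looking away from the vertex.\<close>

definition cycle_colouring :: "'v pair_pre_digraph \<Rightarrow> 'v ribbon \<Rightarrow> 'v set \<Rightarrow> ('v \<Rightarrow> 'v) \<Rightarrow> ('v \<Rightarrow> 'v \<times> 'v) \<Rightarrow> ('v \<Rightarrow> 'v \<times> 'v \<Rightarrow> bool) \<Rightarrow> bool" where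
  "cycle_colouring G \<rho> S nx ed col \<longleftrightarrow>
     (\<forall>x. \<forall>a\<in>incident G x. a \<notin> ed ` S \<longrightarrow> col x (\<rho> x a) = col x a) \<and>
     (\<forall>a\<in>parcs G. a \<notin> ed ` S \<longrightarrow> col (fst a) a = col (snd a) a) \<and>
     (\<forall>x\<in>S. col x (ed x) \<and> \<not> col x (\<rho> x (ed x)) \<and> \<not> col (nx x) (ed x) \<and> col (nx x) (\<rho> (nx x) (ed x)))"

context toured_graph begin

text \<open>Otherwise the cycle would cross a fundamental cut only once.\<close>

lemma cut_tree_no_cycle:
  assumes T: "cut_tree E T" and C: "oriented_cycle E S nx ed"
  shows "\<exists>x\<in>S. ed x \<notin> T"
proof (rule ccontr)
  assume "\<not> (\<exists>x\<in>S. ed x \<notin> T)"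
  then have all: "\<And>x. x \<in> S \<Longrightarrow> ed x \<in> T" by blast
  have C': "cyclic_on nx S" "inj_on ed S" "\<And>x. x \<in> S \<Longrightarrow> ed x = (x, nx x) \<or> ed x = (nx x, x)"
    using C by (auto simp: oriented_cycle_def)
  obtain z where z: "z \<in> S" using C'(1) by (auto simp: cyclic_on_def)
  have iter: "(nx ^^ i) z \<in> S" for i using cyclic_on_funpow_in[OF C'(1) z] .
  let ?X = "tree_cut T (ed z)"
  let ?s = "\<lambda>i. (nx ^^ i) z \<in> ?X"
  have cr: "crosses (ed x) ?X \<longleftrightarrow> (x \<in> ?X) \<noteq> (nx x \<in> ?X)" if "x \<in> S" for x
    using C'(3)[OF that] by (auto simp: crosses_def)
  have "crosses (ed z) ?X" using tree_cut_crosses[OF T all[OF z] all[OF z]] by simp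
  then have "?s 1 \<noteq> ?s (card S)" using cr[OF z] cyclic_on_enumerate(2)[OF C'(1) z] by simp
  moreover have "1 \<le> card S" using z by (metis One_nat_def Suc_leI card_gt_0_iff empty_iff finite)
  ultimately obtain m where m: "1 \<le> m" "m < card S" "?s m = ?s 1" "?s (Suc m) \<noteq> ?s 1"
    using discrete_change[of 1 "card S" ?s] by metis
  have "crosses (ed ((nx ^^ m) z)) ?X" using m(3,4) cr[OF iter[of m]] by simp
  then have "ed ((nx ^^ m) z) = ed z" using tree_cut(3)[OF T all[OF z] all[OF iter]] by blast
  then have "(nx ^^ m) z = (nx ^^ 0) z" using inj_onD[OF C'(2)] iter z by simp
  then have "m = 0"
    using cyclic_on_enumerate(1)[OF C'(1) z] m unfolding bij_betw_def inj_on_def by simp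
  then show False using m by simp
qed

text \<open>The colour of the corner changes along the tour only at edges of the cycle that are outside
  the tree. It does change, since such an edge exists and its two flags have different colours.
  At the first change, the edge is met for the first time, hence at its tail; and the colour there,
  which is the colour of the basis, tells the direction of the edge along the cycle.\<close>

lemma jaeger_tree_misses_edge:
  assumes T: "jaeger_tree G \<rho> b T" and C: "oriented_cycle E S nx ed"
    and col: "cycle_colouring G \<rho> S nx ed col"
  shows "\<exists>x\<in>S. ed x \<notin> T \<and> (if col (fst b) (snd b) then ed x = (x, nx x) else ed x = (nx x, x))"
proof -
  have tree: "cut_tree E T" using T by (simp add: jaeger_tree_iff)
  have J: "\<exists>i j. i < j \<and> j < len T \<and> flag T i = (fst a, a) \<and> flag T j = (snd a, a)" if "a \<in> E" "a \<notin> T" for a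
    using T that unfolding jaeger_tree_iff by simp
  have edE: "ed x \<in> E" and ed: "ed x = (x, nx x) \<or> ed x = (nx x, x)" if "x \<in> S" for x
    using C that by (auto simp: oriented_cycle_def)
  have colA: "col x (\<rho> x a) = col x a" if "a \<in> incident G x" "a \<notin> ed ` S" for x a
    using col that by (auto simp: cycle_colouring_def)
  have colC: "col (opposite_end a x) a = col x a" if "a \<in> incident G x" "a \<notin> ed ` S" for x a
    using col that by (auto simp: cycle_colouring_def incident_def opposite_end_def)
  have colB: "col x (ed x)" "\<not> col x (\<rho> x (ed x))" "\<not> col (nx x) (ed x)" "col (nx x) (\<rho> (nx x) (ed x))"
    if "x \<in> S" for x using col that by (auto simp: cycle_colouring_def)
  define s where "s i = col (fst (flag T i)) (snd (flag T i))" for i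
  have change: "snd (flag T i) \<in> ed ` S - T" if "s (Suc i) \<noteq> s i" for i
  proof -
    obtain x a where xa: "flag T i = (x, a)" by (cases "flag T i")
    have inc: "a \<in> incident G x" using flag_in_flags[of i T] xa by (simp add: flags_def)
    define y where "y = (if a \<in> T then opposite_end a x else x)"
    have sy: "s (Suc i) = col y (\<rho> y a)" "s i = col x a"
      using xa by (simp_all add: s_def flag_Suc Let_def y_def del: funpow.simps)
    have incy: "a \<in> incident G y" using inc opposite_incident by (simp add: y_def)
    have "a \<in> ed ` S"
    proof (rule ccontr)
      assume n: "a \<notin> ed ` S"
      have "col y (\<rho> y a) = col y a" using colA[OF incy n] .
      also have "\<dots> = col x a" using colC[OF inc n] by (simp add: y_def)
      finally show False using that sy by simp
    qed
    moreover have "a \<notin> T"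
    proof
      assume aT: "a \<in> T"
      obtain z where z: "z \<in> S" "a = ed z" using \<open>a \<in> ed ` S\<close> by blast
      have zn: "z \<noteq> nx z" using edE[OF z(1)] ed[OF z(1)] no_loop by metis
      have opp: "opposite_end (ed z) z = nx z" "opposite_end (ed z) (nx z) = z"
      proof -
        consider "ed z = (z, nx z)" | "ed z = (nx z, z)" using ed[OF z(1)] by blast
        then show "opposite_end (ed z) z = nx z" "opposite_end (ed z) (nx z) = z"
          using zn by (cases; simp add: opposite_end_def)+
      qed
      have "x = z \<or> x = nx z" using inc ed[OF z(1)] z(2) by (auto simp: incident_def)
      then show False
      proof
        assume x: "x = z"
        then have "y = nx z" using aT z(2) opp by (simp add: y_def)
        then show False using that sy colB[OF z(1)] x z(2) by simp
      next
        assume x: "x = nx z"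
        then have "y = z" using aT z(2) opp by (simp add: y_def)
        then show False using that sy colB[OF z(1)] x z(2) by simp
      qed
    qed
    ultimately show ?thesis using xa by simp
  qed
  have ends: "col (fst (ed z)) (ed z) \<noteq> col (snd (ed z)) (ed z)" if "z \<in> S" for z
    using ed[OF that] colB(1,3)[OF that] by auto
  have "\<exists>k. s k \<noteq> s 0"
  proof -
    obtain z where z: "z \<in> S" "ed z \<notin> T" using cut_tree_no_cycle[OF tree C] by blast
    obtain i j where "flag T i = (fst (ed z), ed z)" "flag T j = (snd (ed z), ed z)"
      using J[OF edE[OF z(1)] z(2)] by blast
    then have "s i \<noteq> s j" using ends[OF z(1)] by (simp add: s_def)
    then show ?thesis by metis
  qed
  then obtain k where k: "s k \<noteq> s 0" and kmin: "\<And>j. j < k \<Longrightarrow> s j = s 0"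
    using exists_least_iff[of "\<lambda>k. s k \<noteq> s 0"] by blast
  have "k \<noteq> 0" using k by (metis (no_types))
  then obtain m where m: "k = Suc m" using not0_implies_Suc by blast
  have sm: "s j = s 0" if "j \<le> m" for j using kmin[of j] that m by simp
  obtain x a where xa: "flag T m = (x, a)" by (cases "flag T m")
  have "snd (flag T m) \<in> ed ` S - T" using change[of m] k sm[of m] m by simp
  then obtain z where z: "z \<in> S" "a = ed z" "a \<notin> T" using xa by auto
  obtain i j where ij: "i < j" "j < len T" "flag T i = (fst a, a)" "flag T j = (snd a, a)"
    using J[OF edE[OF z(1)]] z(2,3) by blast
  have sij: "s i \<noteq> s j" using ends[OF z(1)] ij z(2) by (simp add: s_def)
  have inc: "a \<in> incident G x" using flag_in_flags[of m T] xa by (simp add: flags_def)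
  have mlen: "m < len T"
  proof (rule ccontr)
    assume "\<not> m < len T"
    then have "s i = s 0" "s j = s 0" using sm[of i] sm[of j] ij(1,2) by simp_all
    then show False using sij by simp
  qed
  have "x = fst a"
  proof (rule ccontr)
    assume "x \<noteq> fst a"
    then have "x = snd a" using inc by (simp add: incident_def)
    then have "flag T m = flag T j" using xa ij(4) by simp
    then have "m = j" using flag_inj[of m T j] mlen ij(2) by simp
    then show False using sm[of i] sm[of j] ij(1) sij by simp
  qed
  moreover have "s 0 = col x a" using sm[of m] xa by (simp add: s_def)
  moreover have "s 0 = col (fst b) (snd b)" by (simp add: s_def)
  ultimately have "if col (fst b) (snd b) then ed z = (z, nx z) else ed z = (nx z, z)"
    using ed[OF z(1)] colB(1,3)[OF z(1)] z(2) by (metis fst_conv)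
  then show ?thesis using z by blast
qed

text \<open>Follow arcs with a positive value forwards and arcs with a negative value backwards. By
  conservation, a vertex that can be entered in this way can also be left, so the walk runs into
  a cycle.\<close>

lemma circulation_cycle:
  fixes d :: "'v \<times> 'v \<Rightarrow> real"
  assumes circ: "(\<Sum>a\<in>E. d a *\<^sub>R edge_vec a) = 0" and nz: "a0 \<in> E" "d a0 \<noteq> 0"
  obtains S nx ed where "oriented_cycle E S nx ed"
    "\<And>x. x \<in> S \<Longrightarrow> ed x = (x, nx x) \<Longrightarrow> 0 < d (ed x)"
    "\<And>x. x \<in> S \<Longrightarrow> ed x = (nx x, x) \<Longrightarrow> d (ed x) < 0"
proof -
  define D where "D x y \<longleftrightarrow> ((x, y) \<in> E \<and> 0 < d (x, y)) \<or> ((y, x) \<in> E \<and> d (y, x) < 0)" for x y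
  have contr: "d a * edge_vec a $ y = (if snd a = y then d a else 0) - (if fst a = y then d a else 0)" for a y
    by (cases a) (auto simp: edge_vec_def axis_def)
  have out: "\<exists>z. D y z" if xy: "D x y" for x y
  proof (rule ccontr)
    assume no: "\<not> (\<exists>z. D y z)"
    have nn: "0 \<le> d a * edge_vec a $ y" if a: "a \<in> E" for a
    proof -
      obtain u v where uv: "a = (u, v)" by (cases a)
      show ?thesis using no a no_loop[of u] unfolding contr uv D_def by (cases "v = y"; cases "u = y") (auto simp: not_less)
    qed
    have "(\<Sum>a\<in>E. d a * edge_vec a $ y) = (\<Sum>a\<in>E. d a *\<^sub>R edge_vec a) $ y" by simp
    then have "(\<Sum>a\<in>E. d a * edge_vec a $ y) = 0" unfolding circ by simp
    then have zero: "\<And>a. a \<in> E \<Longrightarrow> d a * edge_vec a $ y = 0"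
      using sum_nonneg_eq_0_iff[of E "\<lambda>a. d a * edge_vec a $ y"] nn by simp
    have "x \<noteq> y" using xy no_loop by (auto simp: D_def)
    then show False using xy zero[of "(x, y)"] zero[of "(y, x)"] unfolding contr D_def by auto
  qed
  define nx where "nx y = (SOME z. D y z)" for y
  have nx: "D y (nx y)" if "D x y" for x y
    unfolding nx_def using out[OF that] by (rule someI_ex)
  obtain x0 y0 where xy0: "D x0 y0"
  proof -
    obtain u v where uv: "a0 = (u, v)" by (cases a0)
    have "D u v \<or> D v u" using nz uv by (auto simp: D_def linorder_neq_iff)
    then show ?thesis using that by blast
  qed
  have iter: "\<exists>x. D x ((nx ^^ i) y0)" for i
  proof (induction i)
    case (Suc i)
    then show ?case using nx by auto
  qed (use xy0 in auto)
  have "\<not> inj (\<lambda>i. (nx ^^ i) y0)"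
    using finite_imageD[of "\<lambda>i. (nx ^^ i) y0" UNIV] by (metis finite infinite_UNIV_nat)
  then obtain i j where ij: "i < j" "(nx ^^ i) y0 = (nx ^^ j) y0"
    unfolding inj_def by (metis linorder_neqE_nat)
  define y where "y = (nx ^^ i) y0"
  have "(nx ^^ (j - i)) y = (nx ^^ (j - i + i)) y0" unfolding y_def by (simp only: funpow_add comp_apply)
  then have "(nx ^^ (j - i)) y = y" using ij by (simp add: y_def)
  then have self: "y \<in> orbit nx y" unfolding orbit_altdef using ij(1) by (auto intro!: exI[of _ "j - i"])
  define S where "S = orbit nx y"
  have cyc: "cyclic_on nx S" unfolding cyclic_on_def S_def using self by blast
  have Dnx: "D x (nx x)" if xS: "x \<in> S" for x
  proof -
    obtain n where "x = (nx ^^ n) y" using xS unfolding S_def orbit_altdef by blast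
    then have "x = (nx ^^ (n + i)) y0" by (simp add: y_def funpow_add)
    then show ?thesis using iter[of "n + i"] nx by blast
  qed
  define ed where "ed x = (if (x, nx x) \<in> E then (x, nx x) else (nx x, x))" for x
  have ed: "ed x \<in> E" "ed x = (x, nx x) \<and> 0 < d (ed x) \<or> ed x = (nx x, x) \<and> d (ed x) < 0" if "x \<in> S" for x
    using Dnx[OF that] no_2cycle unfolding D_def ed_def by (auto split: if_splits)
  have "inj_on ed S"
  proof (rule inj_onI, rule ccontr)
    fix x z assume xz: "x \<in> S" "z \<in> S" "ed x = ed z" "x \<noteq> z"
    then have "z = nx x" "x = nx z" using ed(2)[OF xz(1)] ed(2)[OF xz(2)] by auto
    then have "D x z" "D z x" using Dnx[OF xz(1)] Dnx[OF xz(2)] by auto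
    then show False using no_2cycle by (auto simp: D_def)
  qed
  then have "oriented_cycle E S nx ed" unfolding oriented_cycle_def using cyc ed by blast
  moreover have "x \<noteq> nx x" if "x \<in> S" for x using ed[OF that] no_loop by metis
  ultimately show thesis using that[of S nx ed] ed by (metis less_asym prod.inject)
qed

text \<open>Otherwise the difference of the coefficients is a circulation. On a cycle obtained from it, the
  forward arcs have a positive coefficient in \<open>T\<close> and the backward arcs have one in \<open>T'\<close>.\<close>

lemma jaeger_coefficients_agree:
  assumes planar: "\<forall>S nx ed. oriented_cycle E S nx ed \<longrightarrow> (\<exists>col. cycle_colouring G \<rho> S nx ed col)"
    and T: "jaeger_tree G \<rho> b T" and T': "jaeger_tree G \<rho> b T'"
    and f: "\<forall>a\<in>T. 0 \<le> f a" "\<forall>a\<in>T'. 0 \<le> f' a"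
    and eq: "(\<Sum>a\<in>T. f a *\<^sub>R edge_vec a) = (\<Sum>a\<in>T'. f' a *\<^sub>R edge_vec a)"
    and a: "a \<in> E"
  shows "(if a \<in> T then f a else 0) = (if a \<in> T' then f' a else 0)"
proof (rule ccontr)
  assume ne: "\<not> ?thesis"
  have tree: "cut_tree E T" "cut_tree E T'" using T T' by (auto simp: jaeger_tree_iff)
  define d where "d a = (if a \<in> T then f a else 0) - (if a \<in> T' then f' a else 0)" for a
  have restrict: "(\<Sum>a\<in>E. (if a \<in> A then h a else 0) *\<^sub>R edge_vec a) = (\<Sum>a\<in>A. h a *\<^sub>R edge_vec a)"
    if "A \<subseteq> E" for A and h :: "'v \<times> 'v \<Rightarrow> real"
  proof -
    have "(\<Sum>a\<in>A. h a *\<^sub>R edge_vec a) = (\<Sum>a\<in>A. (if a \<in> A then h a else 0) *\<^sub>R edge_vec a)"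
      by (intro sum.cong) auto
    also have "\<dots> = (\<Sum>a\<in>E. (if a \<in> A then h a else 0) *\<^sub>R edge_vec a)"
      using that by (intro sum.mono_neutral_left) auto
    finally show ?thesis by simp
  qed
  have circ: "(\<Sum>a\<in>E. d a *\<^sub>R edge_vec a) = 0"
    unfolding d_def scaleR_left_diff_distrib sum_subtractf
      restrict[OF tree_subset[OF tree(1)]] restrict[OF tree_subset[OF tree(2)]] using eq by simp
  have "d a \<noteq> 0" using ne by (simp add: d_def)
  then obtain S nx ed where C: "oriented_cycle E S nx ed"
    and dpos: "\<And>x. x \<in> S \<Longrightarrow> ed x = (x, nx x) \<Longrightarrow> 0 < d (ed x)"
    and dneg: "\<And>x. x \<in> S \<Longrightarrow> ed x = (nx x, x) \<Longrightarrow> d (ed x) < 0"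
    by (rule circulation_cycle[OF circ a]) (rule that; assumption)
  obtain col where col: "cycle_colouring G \<rho> S nx ed col" using planar C by blast
  show False
  proof (cases "col (fst b) (snd b)")
    case True
    then obtain x where x: "x \<in> S" "ed x \<notin> T" "ed x = (x, nx x)"
      using jaeger_tree_misses_edge[OF T C col] by auto
    have "d (ed x) \<le> 0" using x(2) f(2) by (simp add: d_def)
    then show False using dpos[OF x(1,3)] by simp
  next
    case False
    then obtain x where x: "x \<in> S" "ed x \<notin> T'" "ed x = (nx x, x)"
      using jaeger_tree_misses_edge[OF T' C col] by auto
    have "0 \<le> d (ed x)" using x(2) f(1) by (simp add: d_def)
    then show False using dneg[OF x(1,3)] by simp
  qed
qed

lemma jaeger_intersection:
  assumes planar: "\<forall>S nx ed. oriented_cycle E S nx ed \<longrightarrow> (\<exists>col. cycle_colouring G \<rho> S nx ed col)"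
    and T: "jaeger_tree G \<rho> b T" and T': "jaeger_tree G \<rho> b T'"
  shows "root_polytope T \<inter> root_polytope T' = root_polytope (T \<inter> T')"
proof
  have tree: "cut_tree E T" "cut_tree E T'" using T T' by (auto simp: jaeger_tree_iff)
  note sub = tree_subset[OF tree(1)] tree_subset[OF tree(2)]
  show "root_polytope (T \<inter> T') \<subseteq> root_polytope T \<inter> root_polytope T'"
    unfolding root_polytope_hull by (intro Int_greatest hull_mono) auto
  show "root_polytope T \<inter> root_polytope T' \<subseteq> root_polytope (T \<inter> T')"
  proof
    fix p assume "p \<in> root_polytope T \<inter> root_polytope T'"
    then obtain f f' where f: "\<forall>a\<in>T. 0 \<le> f a" "sum f T = 1" "p = (\<Sum>a\<in>T. f a *\<^sub>R edge_vec a)"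
      and f': "\<forall>a\<in>T'. 0 \<le> f' a" "p = (\<Sum>a\<in>T'. f' a *\<^sub>R edge_vec a)"
      using root_polytope_iff[OF edge_vec_inj_E[OF sub(1)]] root_polytope_iff[OF edge_vec_inj_E[OF sub(2)]] by blast
    have zero: "f a = 0" if "a \<in> T - T'" for a
      using jaeger_coefficients_agree[OF planar T T' f(1) f'(1), of a] f(3) f'(2) that sub(1) by auto
    have "sum f T = sum f (T \<inter> T')" using zero by (intro sum.mono_neutral_right) auto
    moreover have "(\<Sum>a\<in>T. f a *\<^sub>R edge_vec a) = (\<Sum>a\<in>T \<inter> T'. f a *\<^sub>R edge_vec a)"
      using zero by (intro sum.mono_neutral_right) auto
    moreover have "T \<inter> T' \<subseteq> E" using sub by blast
    ultimately show "p \<in> root_polytope (T \<inter> T')"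
      using f root_polytope_iff[OF edge_vec_inj_E, of "T \<inter> T'" p] by auto
  qed
qed

theorem jaeger_triangulation:
  assumes planar: "\<forall>S nx ed. oriented_cycle E S nx ed \<longrightarrow> (\<exists>col. cycle_colouring G \<rho> S nx ed col)"
  shows "triangulation_of (root_polytope E) {root_polytope T | T. jaeger_tree G \<rho> b T}"
proof -
  have face: "root_polytope T \<inter> root_polytope T' face_of root_polytope T"
    if T: "jaeger_tree G \<rho> b T" and T': "jaeger_tree G \<rho> b T'" for T T'
  proof -
    have naff: "\<not> affine_dependent (edge_vec ` T)"
      using independent_tree affine_dependent_imp_dependent T by (auto simp: jaeger_tree_iff)
    have "root_polytope (T \<inter> T') face_of root_polytope T"
      unfolding root_polytope_hull face_of_convex_hull_affine_independent[OF naff]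
      by (intro exI[of _ "edge_vec ` (T \<inter> T')"]) auto
    then show ?thesis unfolding jaeger_intersection[OF planar T T'] .
  qed
  have "triangulation {root_polytope T | T. jaeger_tree G \<rho> b T}"
    unfolding triangulation_def
  proof (intro conjI allI impI ballI)
    show "finite {root_polytope T | T. jaeger_tree G \<rho> b T}" by simp
  next
    fix S assume "S \<in> {root_polytope T | T. jaeger_tree G \<rho> b T}"
    then obtain T where T: "S = root_polytope T" "jaeger_tree G \<rho> b T" by blast
    then have "cut_tree E T" by (simp add: jaeger_tree_iff)
    then show "\<exists>n. n simplex S" unfolding T(1) using tree_simplex by blast
  next
    fix S S' assume "S \<in> {root_polytope T | T. jaeger_tree G \<rho> b T} \<and> S' \<in> {root_polytope T | T. jaeger_tree G \<rho> b T}"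
    then obtain T T' where "S = root_polytope T" "S' = root_polytope T'" "jaeger_tree G \<rho> b T" "jaeger_tree G \<rho> b T'" by blast
    then show "S \<inter> S' face_of S" using face[of T T'] by simp
  qed
  then show ?thesis using jaeger_dissection by (simp add: triangulation_of_def)
qed

end

section \<open>Winding numbers on the two sides of an arc\<close>

lemma subpath_part_circlepath:
  "subpath u v (part_circlepath c r s t) = part_circlepath c r (linepath s t u) (linepath s t v)"
  by (rule ext) (simp add: subpath_def part_circlepath_def linepath_def algebra_simps)

lemma winding_number_part_circlepath_full_turn:
  assumes "dist x y < r"
  shows "winding_number (part_circlepath x r \<alpha> (\<alpha> + 2*pi)) y = 1"
proof -
  let ?C = "part_circlepath x r \<alpha> (\<alpha> + 2*pi)"
  have r: "r > 0" using assms by (metis dist_not_less_zero linorder_neqE_linordered_idom order_less_trans)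
  have "0 < Re (winding_number ?C y)"
    using assms by (intro winding_number_part_circlepath_pos_less) (auto simp: dist_norm norm_minus_commute)
  moreover have "simple_path ?C"
    using r by (simp add: simple_path_part_circlepath)
  moreover have "pathfinish ?C = pathstart ?C"
    by (simp add: exp_add algebra_simps exp_eq)
  moreover have "y \<notin> path_image ?C"
    using assms r path_image_part_circlepath_subset[of \<alpha> "\<alpha> + 2*pi" r x] by (auto)
  ultimately show ?thesis
    using simple_closed_path_winding_number_cases[of ?C y] by auto
qed

lemma winding_number_circle_arcs:
  assumes "dist x y < r" "0 < \<theta>" "\<theta> < 2*pi"
  shows "winding_number (part_circlepath x r \<alpha> (\<alpha>+\<theta>)) y
       + winding_number (part_circlepath x r (\<alpha>+\<theta>) (\<alpha> + 2*pi)) y = 1"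
proof -
  let ?C = "part_circlepath x r \<alpha> (\<alpha> + 2*pi)"
  let ?u = "\<theta> / (2*pi)"
  have r: "r > 0" using assms(1) by (metis dist_not_less_zero linorder_neqE_linordered_idom order_less_trans)
  have "y \<notin> path_image ?C"
    using assms r path_image_part_circlepath_subset[of \<alpha> "\<alpha> + 2*pi" r x] by (auto)
  then have "winding_number (subpath 0 ?u ?C) y + winding_number (subpath ?u 1 ?C) y = winding_number (subpath 0 1 ?C) y"
    using assms by (intro winding_number_subpath_combine) auto
  moreover have "linepath \<alpha> (\<alpha> + 2*pi) ?u = \<alpha> + \<theta>"
    by (simp add: linepath_def field_simps)
  moreover have "linepath \<alpha> (\<alpha> + 2*pi) 0 = \<alpha>" "linepath \<alpha> (\<alpha> + 2*pi) 1 = \<alpha> + 2*pi"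
    by (simp_all add: linepath_def)
  ultimately show ?thesis
    using winding_number_part_circlepath_full_turn[OF assms(1)] by (simp add: subpath_part_circlepath)
qed

text \<open>Arguments of the same point differ by a multiple of \<open>2 * pi\<close>, and here by less than \<open>2 * pi\<close>.\<close>

lemma circle_point_in_arc_iff:
  assumes "r > 0" "0 \<le> s" "s \<le> t" "t \<le> 2*pi" "0 < \<theta>" "\<theta> < 2*pi"
  shows "x + of_real r * exp (\<i> * of_real (\<alpha> + \<theta>)) \<in> path_image (part_circlepath x r (\<alpha>+s) (\<alpha>+t)) \<longleftrightarrow> s \<le> \<theta> \<and> \<theta> \<le> t"
proof
  assume "x + of_real r * exp (\<i> * of_real (\<alpha> + \<theta>)) \<in> path_image (part_circlepath x r (\<alpha>+s) (\<alpha>+t))"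
  then obtain u where u: "\<alpha> + s \<le> u" "u \<le> \<alpha> + t" "exp (\<i> * of_real (\<alpha> + \<theta>)) = exp (\<i> * of_real u)"
    using assms by (auto simp: path_image_part_circlepath)
  then obtain n :: int where n: "\<i> * of_real (\<alpha> + \<theta>) = \<i> * of_real u + (of_int (2 * n) * pi) * \<i>"
    by (auto simp: exp_eq)
  then have "\<i> * of_real (\<alpha> + \<theta>) = \<i> * of_real (u + 2 * n * pi)"
    by (simp add: algebra_simps)
  then have "\<alpha> + \<theta> = u + 2 * n * pi"
    by (simp only: mult_cancel_left of_real_eq_iff) simp
  then have eq: "\<theta> - (u - \<alpha>) = n * (2 * pi)" by simp
  have "\<bar>real_of_int n * (2*pi)\<bar> < 1 * (2 * pi)"
    using eq u assms by linarith
  then have "\<bar>real_of_int n\<bar> < 1"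
    by (simp only: abs_mult) (simp add: mult_less_cancel_right)
  then have "n = 0" by linarith
  then show "s \<le> \<theta> \<and> \<theta> \<le> t" using eq u by simp
next
  assume "s \<le> \<theta> \<and> \<theta> \<le> t"
  then show "x + of_real r * exp (\<i> * of_real (\<alpha> + \<theta>)) \<in> path_image (part_circlepath x r (\<alpha>+s) (\<alpha>+t))"
    using assms by (auto simp: path_image_part_circlepath intro!: exI[of _ "\<alpha>+\<theta>"])
qed

lemma Arg2pi_circle_coordinates:
  assumes "r > 0" "dist x q = r" "dist x z = r"
  shows "z = x + of_real r * exp (\<i> * of_real (Arg2pi (q - x) + Arg2pi ((z - x) / (q - x))))"
proof -
  have nq: "norm (q - x) = r" "norm (z - x) = r" using assms by (auto simp: dist_norm norm_minus_commute)
  have q: "q - x = of_real r * exp (\<i> * of_real (Arg2pi (q - x)))"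
    using Arg2pi_eq[of "q - x"] nq by simp
  have "(z - x) / (q - x) = of_real 1 * exp (\<i> * of_real (Arg2pi ((z - x) / (q - x))))"
    using Arg2pi_eq[of "(z - x)/(q - x)"] nq assms by (simp add: norm_divide)
  moreover have "z - x = (q - x) * ((z - x)/(q - x))" using nq assms by auto
  ultimately have "z - x = of_real r * exp (\<i> * of_real (Arg2pi (q - x))) * exp (\<i> * of_real (Arg2pi ((z - x) / (q - x))))"
    using q by (metis mult_1 of_real_1)
  then show ?thesis by (simp add: exp_add algebra_simps)
qed

lemma connected_arc_without_start:
  assumes "arc Z"
  shows "topological_space_class.connected (path_image Z - {pathstart Z})"
proof -
  have "path_image Z - {pathstart Z} = Z ` {0<..1}"
  proof -
    have "{0..1} - {0} = {0<..1::real}" by auto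
    moreover have "Z ` ({0..1} - {0}) = Z ` {0..1} - Z ` {0}"
      using assms by (intro inj_on_image_set_diff[where C="{0..1}"]) (auto simp: arc_def)
    ultimately show ?thesis by (simp add: path_image_def pathstart_def)
  qed
  moreover have "continuous_on {0<..1} Z"
    using assms by (auto simp: arc_def path_def intro: continuous_on_subset)
  then have "topological_space_class.connected (Z ` {0<..1})" by (intro connected_continuous_image) auto
  ultimately show ?thesis by simp
qed

text \<open>A closed disc without a point of its boundary is convex.\<close>

lemma winding_number_zero_from_sphere:
  assumes "path K" "pathfinish K = pathstart K" "path_image K \<subseteq> cball x r" "dist x z = r" "z \<notin> path_image K"
  shows "winding_number K z = 0"
proof -
  have "convex (cball x r - {z})"
    using assms(4) by (intro convex_intermediate_ball[of x r]) auto
  then show ?thesis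
    using assms by (intro winding_number_zero_outside[where s = "cball x r - {z}"]) auto
qed

text \<open>The arcs \<open>P\<close> and \<open>Q\<close> lead from the centre \<open>x\<close> of a disc to points \<open>p\<close> and \<open>q\<close> of its boundary,
  and \<open>R\<close> returns from \<open>p\<close> to \<open>q\<close> and may enter the disc again, but avoids \<open>x\<close>. Closing the
  crosscut from \<open>q\<close> through \<open>x\<close> to \<open>p\<close> by either arc of the boundary circle gives two simple closed
  curves whose winding numbers differ by 1, the winding number of the circle. Both take only values
  in \<open>{-1, 0, 1}\<close>, so that the first one takes only the values -1 and 0. Near \<open>x\<close> it differs by a
  constant \<open>k\<close> from the winding number of the whole curve, since the remaining closed curve
  stays away from \<open>x\<close>. If an arc \<open>Z\<close> leaves the disc through one of the two boundary arcs, then it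
  does not meet the curve that is closed by the other boundary arc, whose winding number along \<open>Z\<close>
  is therefore 0.\<close>

lemma winding_number_across_arc:
  fixes x p q :: complex
  assumes P: "arc P" "pathstart P = x" "pathfinish P = p" "dist x p = r" "path_image P - {p} \<subseteq> ball x r"
    and Q: "arc Q" "pathstart Q = x" "pathfinish Q = q" "dist x q = r" "path_image Q - {q} \<subseteq> ball x r"
    and PQ: "path_image P \<inter> path_image Q = {x}"
    and R: "path R" "pathstart R = p" "pathfinish R = q" "x \<notin> path_image R"
    and r: "r > 0"
  obtains k \<delta> where "\<delta> > 0" "\<delta> \<le> r"
    "\<And>y. y \<in> ball x \<delta> \<Longrightarrow> y \<notin> path_image P \<union> path_image Q \<Longrightarrow>
       winding_number P y + winding_number R y - winding_number Q y \<in> {k - 1, k}"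
    "\<And>Z z y. \<lbrakk>arc Z; pathstart Z = x; pathfinish Z = z; dist x z = r; path_image Z - {z} \<subseteq> ball x r;
        path_image Z \<inter> (path_image P \<union> path_image Q) = {x}; y \<in> path_image Z; y \<noteq> x; y \<in> ball x \<delta>\<rbrakk> \<Longrightarrow>
       winding_number P y + winding_number R y - winding_number Q y =
         (if Arg2pi ((z - x) / (q - x)) < Arg2pi ((p - x) / (q - x)) then k - 1 else k)"
proof -
  define \<alpha> where "\<alpha> = Arg2pi (q - x)"
  define \<theta> where "\<theta> = Arg2pi ((p - x) / (q - x))"
  have qx: "q \<noteq> x" "p \<noteq> x" using P Q r by auto
  have pP: "p \<in> path_image P" and qQ: "q \<in> path_image Q" using pathfinish_in_path_image[of P] pathfinish_in_path_image[of Q] P(3) Q(3) by simp_all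
  have xP: "x \<in> path_image P" and xQ: "x \<in> path_image Q" using pathstart_in_path_image[of P] pathstart_in_path_image[of Q] P(2) Q(2) by simp_all
  have pq: "p \<noteq> q" using PQ pP qQ qx by auto
  have q_eq: "q = x + of_real r * exp (\<i> * of_real \<alpha>)"
    using Arg2pi_eq[of "q - x"] Q(4) by (simp add: \<alpha>_def dist_norm norm_minus_commute algebra_simps)
  have p_eq: "p = x + of_real r * exp (\<i> * of_real (\<alpha> + \<theta>))"
    using Arg2pi_circle_coordinates[OF r Q(4) P(4)] by (simp add: \<alpha>_def \<theta>_def)
  have \<theta>: "0 < \<theta>" "\<theta> < 2*pi"
  proof -
    have "\<theta> \<noteq> 0" using p_eq q_eq pq by (metis add.right_neutral)
    then show "0 < \<theta>" "\<theta> < 2*pi"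
      using Arg2pi_ge_0[of "(p - x) / (q - x)"] Arg2pi_lt_2pi[of "(p - x) / (q - x)"] by (simp_all add: \<theta>_def)
  qed
  define A1 where "A1 = part_circlepath x r \<alpha> (\<alpha> + \<theta>)"
  define A2 where "A2 = part_circlepath x r (\<alpha> + \<theta>) (\<alpha> + 2*pi)"
  have exp2: "exp (\<i> * of_real (\<alpha> + 2*pi)) = exp (\<i> * of_real \<alpha>)" by (simp add: exp_eq algebra_simps)
  have A1: "arc A1" "pathstart A1 = q" "pathfinish A1 = p" "path_image A1 \<subseteq> sphere x r"
    using r \<theta> path_image_part_circlepath_subset[of \<alpha> "\<alpha>+\<theta>" r x] q_eq p_eq
    by (auto simp: A1_def arc_part_circlepath)
  have A2: "arc A2" "pathstart A2 = p" "pathfinish A2 = q" "path_image A2 \<subseteq> sphere x r"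
    using r \<theta> path_image_part_circlepath_subset[of "\<alpha>+\<theta>" "\<alpha>+2*pi" r x] q_eq p_eq exp2
    by (auto simp: A2_def arc_part_circlepath)
  define S where "S = reversepath Q +++ P"
  have "arc S" unfolding S_def
    using P(1,2) Q(1,2) PQ by (intro arc_join) (auto simp: arc_reversepath)
  then have S: "arc S" "pathstart S = q" "pathfinish S = p" "path_image S = path_image P \<union> path_image Q"
    using P Q by (auto simp: S_def path_image_join)
  have S_ball: "path_image S \<subseteq> ball x r \<union> {p, q}" using S(4) P(5) Q(5) by auto
  have AS: "path_image A \<inter> path_image S \<subseteq> {p, q}" if "path_image A \<subseteq> sphere x r" for A
    using that S_ball by (auto simp: subset_iff)
  have K1: "simple_path (S +++ reversepath A1)"
    using S A1 AS[OF A1(4)] by (intro simple_path_join_loop) (auto simp: arc_reversepath)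
  have K2: "simple_path (S +++ A2)"
    using S A2 AS[OF A2(4)] by (intro simple_path_join_loop) auto
  have K1cl: "pathfinish (S +++ reversepath A1) = pathstart (S +++ reversepath A1)"
    and K2cl: "pathfinish (S +++ A2) = pathstart (S +++ A2)"
    using S A1 A2 by auto
  have wS: "winding_number S y = winding_number P y - winding_number Q y"
    if "y \<notin> path_image P \<union> path_image Q" for y
    unfolding S_def using that P Q
    by (subst winding_number_join) (auto simp: arc_imp_path winding_number_reversepath)
  have wK1: "winding_number (S +++ reversepath A1) y = winding_number S y - winding_number A1 y"
    if "y \<in> ball x r" "y \<notin> path_image P \<union> path_image Q" for y
  proof -
    have "y \<notin> path_image A1" using that A1(4) by auto
    then show ?thesis
      using that S A1
      by (subst winding_number_join) (auto simp: arc_imp_path winding_number_reversepath)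
  qed
  have wK2: "winding_number (S +++ A2) y = winding_number S y + winding_number A2 y"
    if "y \<in> ball x r" "y \<notin> path_image P \<union> path_image Q" for y
  proof -
    have "y \<notin> path_image A2" using that A2(4) by auto
    then show ?thesis
      using that S A2 by (subst winding_number_join) (auto simp: arc_imp_path)
  qed
  have diff: "winding_number (S +++ A2) y = winding_number (S +++ reversepath A1) y + 1"
    if "y \<in> ball x r" "y \<notin> path_image P \<union> path_image Q" for y
  proof -
    have "winding_number A1 y = 1 - winding_number A2 y"
      using winding_number_circle_arcs[of x y r \<theta> \<alpha>] \<theta> that by (simp add: A1_def A2_def eq_diff_eq)
    then show ?thesis using wK1[OF that] wK2[OF that] by simp
  qed
  have K1im: "path_image (S +++ reversepath A1) = path_image P \<union> path_image Q \<union> path_image A1"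
    and K2im: "path_image (S +++ A2) = path_image P \<union> path_image Q \<union> path_image A2"
    using S A1 A2 by (auto simp: path_image_join)
  have w1: "winding_number (S +++ reversepath A1) y \<in> {-1, 0}"
    if "y \<in> ball x r" "y \<notin> path_image P \<union> path_image Q" for y
  proof -
    have "y \<notin> path_image A1" "y \<notin> path_image A2" using that A1(4) A2(4) by auto
    then have "winding_number (S +++ reversepath A1) y \<in> {-1, 0, 1}" "winding_number (S +++ A2) y \<in> {-1,0,1}"
      using that simple_closed_path_winding_number_cases[OF K1 K1cl, of y]
        simple_closed_path_winding_number_cases[OF K2 K2cl, of y] K1im K2im by auto
    then show ?thesis using diff[OF that] by auto
  qed
  (* The closed curve made of S and R is homologous to the sum of S - A1 and L. *)
  define L where "L = A1 +++ R"
  have L: "path L" "pathfinish L = pathstart L" "path_image L = path_image A1 \<union> path_image R"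
    using A1 R by (auto simp: L_def arc_imp_path path_image_join)
  have xL: "x \<notin> path_image L" using L(3) R A1(4) r by auto
  obtain \<delta>0 where \<delta>0: "\<delta>0 > 0" "ball x \<delta>0 \<inter> path_image L = {}"
  proof -
    have "open (- path_image L)" using L(1) by (simp add: closed_path_image open_Compl)
    then show ?thesis using xL that by (metis ComplI openE disjoint_eq_subset_Compl)
  qed
  define \<delta> where "\<delta> = min \<delta>0 r"
  have \<delta>: "\<delta> > 0" "\<delta> \<le> r" using \<delta>0 r by (auto simp: \<delta>_def)
  have \<delta>L: "ball x \<delta> \<inter> path_image L = {}" using \<delta>0 by (auto simp: \<delta>_def)
  define k where "k = winding_number L x"
  have wL: "winding_number L y = k" if "y \<in> ball x \<delta>" for y
    using winding_number_eq[OF L(1,2), of y "ball x \<delta>" x] \<delta>L that \<delta> by (auto simp: k_def)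
  have W: "winding_number P y + winding_number R y - winding_number Q y = winding_number (S +++ reversepath A1) y + k"
    if y: "y \<in> ball x \<delta>" "y \<notin> path_image P \<union> path_image Q" for y
  proof -
    have "y \<notin> path_image L" using y \<delta>L by auto
    then have "winding_number L y = winding_number A1 y + winding_number R y"
      unfolding L_def using A1 R by (subst winding_number_join) (auto simp: arc_imp_path path_image_join)
    moreover have "y \<in> ball x r" using y \<delta> by auto
    ultimately show ?thesis using wL[OF y(1)] wK1[of y] wS[OF y(2)] y(2) by (simp add: algebra_simps)
  qed
  have exit: "winding_number K y = 0"
    if K: "simple_path K" "pathfinish K = pathstart K" "path_image K \<subseteq> cball x r" "path_image K \<inter> path_image Z \<subseteq> {x}"
     and Z: "arc Z" "pathstart Z = x" "pathfinish Z = z" "dist x z = r" "y \<in> path_image Z" "y \<noteq> x" for K Z z y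
  proof -
    have pK: "path K" using K(1) by (simp add: simple_path_imp_path)
    have zK: "z \<notin> path_image K" using K(4) Z r by (metis Int_iff pathfinish_in_path_image singletonD subsetD dist_self less_irrefl)
    have conn: "topological_space_class.connected (path_image Z - {x})"
      using connected_arc_without_start[OF Z(1)] Z(2) by simp
    have "winding_number K y = winding_number K z"
    proof (rule winding_number_eq[OF pK K(2) _ _ conn])
      show "z \<in> path_image Z - {x}" using Z r pathfinish_in_path_image[of Z] by auto
    qed (use Z K in auto)
    also have "\<dots> = 0"
      using pK K(2,3) Z(4) zK by (rule winding_number_zero_from_sphere)
    finally show ?thesis .
  qed
  show thesis
  proof (rule that[of \<delta> k])
    show "\<delta> > 0" "\<delta> \<le> r" by fact+
  next
    fix y assume y: "y \<in> ball x \<delta>" "y \<notin> path_image P \<union> path_image Q"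
    then have "winding_number (S +++ reversepath A1) y \<in> {-1, 0}" using \<delta> by (intro w1) auto
    then show "winding_number P y + winding_number R y - winding_number Q y \<in> {k - 1, k}"
      using W[OF y] by auto
  next
    fix Z z y
    assume Z: "arc Z" "pathstart Z = x" "pathfinish Z = z" "dist x z = r" "path_image Z - {z} \<subseteq> ball x r"
        "path_image Z \<inter> (path_image P \<union> path_image Q) = {x}" and y: "y \<in> path_image Z" "y \<noteq> x" "y \<in> ball x \<delta>"
    have yPQ: "y \<notin> path_image P \<union> path_image Q" using Z y by auto
    have yr: "y \<in> ball x r" using y \<delta> by auto
    have zZ: "z \<in> path_image Z" using Z(3) pathfinish_in_path_image by blast
    have zx: "z \<noteq> x" using Z(4) r by auto
    have zpq: "z \<noteq> p" "z \<noteq> q" using Z(6) zZ zx pP qQ by auto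
    define \<phi> where "\<phi> = Arg2pi ((z - x) / (q - x))"
    have z_eq: "z = x + of_real r * exp (\<i> * of_real (\<alpha> + \<phi>))"
      using Arg2pi_circle_coordinates[OF r Q(4) Z(4)] by (simp add: \<alpha>_def \<phi>_def)
    have \<phi>: "0 < \<phi>" "\<phi> < 2*pi"
    proof -
      have "\<phi> \<noteq> 0" using z_eq q_eq zpq by (metis add.right_neutral)
      then show "0 < \<phi>" "\<phi> < 2*pi"
        using Arg2pi_ge_0[of "(z - x) / (q - x)"] Arg2pi_lt_2pi[of "(z - x) / (q - x)"] by (simp_all add: \<phi>_def)
    qed
    have \<phi>\<theta>: "\<phi> \<noteq> \<theta>" using z_eq p_eq zpq by auto
    have cb: "path_image P \<union> path_image Q \<subseteq> cball x r" using P(4,5) Q(4,5)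
      by (auto simp: subset_iff)
    have sphere_Int: "sphere x r \<inter> path_image Z \<subseteq> {z}" using Z(5) by auto
    show "winding_number P y + winding_number R y - winding_number Q y =
         (if Arg2pi ((z - x) / (q - x)) < Arg2pi ((p - x) / (q - x)) then k - 1 else k)"
    proof (cases "\<phi> < \<theta>")
      case True
      have "z \<notin> path_image A2"
        using circle_point_in_arc_iff[of r \<theta> "2*pi" \<phi> x \<alpha>] r \<theta> \<phi> True z_eq unfolding A2_def by auto
      then have "path_image (S +++ A2) \<inter> path_image Z \<subseteq> {x}"
        using Z(5,6) A2(4) sphere_Int unfolding K2im by blast
      then have "winding_number (S +++ A2) y = 0"
        using A2(4) cb by (intro exit[OF K2 K2cl _ _ Z(1-4) y(1,2)]) (auto simp: K2im)
      then show ?thesis using W[OF y(3) yPQ] diff[OF yr yPQ] True by (simp add: \<phi>_def \<theta>_def eq_neg_iff_add_eq_0)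
    next
      case False
      have "z \<notin> path_image A1"
        using circle_point_in_arc_iff[of r 0 \<theta> \<phi> x \<alpha>] r \<theta> \<phi> False \<phi>\<theta> z_eq unfolding A1_def by auto
      then have "path_image (S +++ reversepath A1) \<inter> path_image Z \<subseteq> {x}"
        using Z(5,6) A1(4) sphere_Int unfolding K1im by blast
      then have "winding_number (S +++ reversepath A1) y = 0"
        using A1(4) cb by (intro exit[OF K1 K1cl _ _ Z(1-4) y(1,2)]) (auto simp: K1im)
      then show ?thesis using W[OF y(3) yPQ] False by (simp add: \<phi>_def \<theta>_def)
    qed
  qed
qed

text \<open>The infimum in the definition of \<open>exit_vector\<close> is attained, and it is the first time at which
  the arc reaches the circle.\<close>

lemma first_exit:
  assumes "arc g" "0 < r" "r < dist (pathstart g) (pathfinish g)"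
  obtains s where "0 < s" "s < 1" "g s = pathstart g + exit_vector g r"
    "dist (pathstart g) (g s) = r" "\<And>t. 0 \<le> t \<Longrightarrow> t < s \<Longrightarrow> dist (pathstart g) (g t) < r"
proof -
  define A where "A = {s \<in> {0..1}. dist (g 0) (g s) = r}"
  define s where "s = Inf A"
  have cont: "continuous_on {0..1} (\<lambda>s. dist (g 0) (g s))"
    using assms(1) by (auto simp: arc_def path_def intro!: continuous_intros)
  have ends: "dist (g 0) (g 0) \<le> r" "r \<le> dist (g 0) (g 1)"
    using assms by (auto simp: pathstart_def pathfinish_def)
  have "A \<noteq> {}"
    using IVT'[of "\<lambda>s. dist (g 0) (g s)" 0 r 1] ends cont by (auto simp: A_def)
  moreover have "closed A"
    unfolding A_def using cont by (intro continuous_closed_preimage_constant) auto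
  moreover have bdd: "bdd_below A" by (auto simp: A_def bdd_below_def)
  ultimately have "s \<in> A" unfolding s_def by (simp add: closed_contains_Inf)
  then have s: "0 \<le> s" "s \<le> 1" "dist (g 0) (g s) = r" by (auto simp: A_def)
  have "s \<noteq> 0" "s \<noteq> 1" using s assms by (auto simp: pathstart_def pathfinish_def)
  moreover have "dist (g 0) (g t) < r" if t: "0 \<le> t" "t < s" for t
  proof (rule ccontr)
    assume "\<not> dist (g 0) (g t) < r"
    then have "\<exists>u\<ge>0. u \<le> t \<and> dist (g 0) (g u) = r"
      using IVT'[of "\<lambda>s. dist (g 0) (g s)" 0 r t] ends t s continuous_on_subset[OF cont, of "{0..t}"] by auto
    then obtain u where "u \<in> A" "u \<le> t" using t s by (auto simp: A_def)
    then have "s \<le> t" using cInf_lower[OF _ bdd, of u] by (auto simp: s_def)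
    then show False using t by simp
  qed
  ultimately show thesis
    using s that[of s] by (auto simp: exit_vector_def pathstart_def A_def s_def)
qed

lemma initial_piece:
  assumes "arc g" "0 < r" "r < dist (pathstart g) (pathfinish g)"
  obtains s where "0 < s" "s < 1" "arc (subpath 0 s g)" "pathstart (subpath 0 s g) = pathstart g"
    "pathfinish (subpath 0 s g) = pathstart g + exit_vector g r"
    "dist (pathstart g) (pathfinish (subpath 0 s g)) = r"
    "path_image (subpath 0 s g) - {pathfinish (subpath 0 s g)} \<subseteq> ball (pathstart g) r"
    "path_image (subpath 0 s g) \<subseteq> path_image g - {pathfinish g}"
    "path_image (subpath s 1 g) \<subseteq> path_image g - {pathstart g}"
proof -
  obtain s where s: "0 < s" "s < 1" "g s = pathstart g + exit_vector g r"
    "dist (pathstart g) (g s) = r" "\<And>t. 0 \<le> t \<Longrightarrow> t < s \<Longrightarrow> dist (pathstart g) (g t) < r"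
    using first_exit[OF assms] by blast
  have inj: "inj_on g {0..1}" using assms(1) by (simp add: arc_def)
  have g0: "g 0 = pathstart g" by (simp add: pathstart_def)
  have im: "path_image (subpath 0 s g) = g ` {0..s}" "path_image (subpath s 1 g) = g ` {s..1}"
    using s by (auto simp: path_image_subpath)
  show thesis
  proof (rule that[of s])
    show "arc (subpath 0 s g)" using s assms(1) by (intro arc_subpath_arc) auto
    show "path_image (subpath 0 s g) - {pathfinish (subpath 0 s g)} \<subseteq> ball (pathstart g) r"
      using s by (auto simp: im) (metis less_eq_real_def)
    show "path_image (subpath 0 s g) \<subseteq> path_image g - {pathfinish g}"
      using s unfolding im path_image_def[of g] by (auto simp: pathfinish_def dest!: inj_onD[OF inj])
    show "path_image (subpath s 1 g) \<subseteq> path_image g - {pathstart g}"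
      using s unfolding im path_image_def[of g] by (auto simp: pathstart_def dest!: inj_onD[OF inj])
  qed (use s g0 in auto)
qed

text \<open>The curve \<open>J\<close> leaves \<open>x\<close> along \<open>c\<close> and comes back along the reverse of \<open>d\<close>. The arc \<open>g\<close> starts on the
  right of \<open>J\<close> iff its exit point comes before that of \<open>c\<close>, counted counterclockwise from that of
  \<open>d\<close>. By \<open>winding_number_across_arc\<close>, the winding numbers near \<open>x\<close> are \<open>k - 1\<close> on the right and \<open>k\<close>
  on the left. Both the inside and the outside of \<open>J\<close> accumulate at \<open>x\<close>, so \<open>k - 1\<close> and \<open>k\<close> are 0 and
  the winding number of the inside, in some order. Hence the value on the right is 0 for a
  counterclockwise curve and -1 for a clockwise one, whatever the point \<open>x\<close> is.

  The winding number is given as a function \<open>W\<close> because for a cycle of a graph the curve \<open>J\<close> depends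
  on the vertex at which it starts, whereas \<open>W\<close> does not.\<close>

lemma winding_number_beside_closed_curve:
  fixes x :: complex and W :: "complex \<Rightarrow> complex"
  assumes out: "arc c" "pathstart c = x" "pathfinish c = u"
    and inc: "arc d" "pathstart d = x" "pathfinish d = v"
    and rest: "path M" "pathstart M = u" "pathfinish M = v" "x \<notin> path_image M"
    and cd: "path_image c \<inter> path_image d = {x}"
    and J: "simple_path J" "pathfinish J = pathstart J"
      "path_image J = path_image c \<union> path_image M \<union> path_image d"
      "\<And>y. y \<notin> path_image J \<Longrightarrow> winding_number J y = W y"
      "\<And>y. y \<notin> path_image J \<Longrightarrow> W y = winding_number c y + winding_number M y - winding_number d y"
    and r: "0 < r" "r < dist x u" "r < dist x v" "r < dist x (pathfinish g)"
    and g: "arc g" "pathstart g = x" "path_image g \<inter> path_image J \<subseteq> {x, pathfinish g}"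
    and y: "y \<in> path_image g" "y \<notin> path_image J"
  shows "W y = (if \<forall>z\<in>inside (path_image J). W z = 1 then 0 else -1) +
    (if Arg2pi (exit_vector g r / exit_vector d r) < Arg2pi (exit_vector c r / exit_vector d r) then 0 else 1)"
proof -
  let ?I = "path_image J"
  obtain s where s: "0 < s" "s < 1" "arc (subpath 0 s c)" "pathstart (subpath 0 s c) = x"
    "pathfinish (subpath 0 s c) = x + exit_vector c r"
    "dist x (pathfinish (subpath 0 s c)) = r"
    "path_image (subpath 0 s c) - {pathfinish (subpath 0 s c)} \<subseteq> ball x r"
    "path_image (subpath 0 s c) \<subseteq> path_image c - {pathfinish c}"
    "path_image (subpath s 1 c) \<subseteq> path_image c - {pathstart c}"
    using initial_piece[OF out(1), of r] out r by auto
  obtain s' where s': "0 < s'" "s' < 1" "arc (subpath 0 s' d)" "pathstart (subpath 0 s' d) = x"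
    "pathfinish (subpath 0 s' d) = x + exit_vector d r"
    "dist x (pathfinish (subpath 0 s' d)) = r"
    "path_image (subpath 0 s' d) - {pathfinish (subpath 0 s' d)} \<subseteq> ball x r"
    "path_image (subpath 0 s' d) \<subseteq> path_image d - {pathfinish d}"
    "path_image (subpath s' 1 d) \<subseteq> path_image d - {pathstart d}"
    using initial_piece[OF inc(1), of r] inc r by auto
  obtain t where t: "0 < t" "t < 1" "arc (subpath 0 t g)" "pathstart (subpath 0 t g) = x"
    "pathfinish (subpath 0 t g) = x + exit_vector g r"
    "dist x (pathfinish (subpath 0 t g)) = r"
    "path_image (subpath 0 t g) - {pathfinish (subpath 0 t g)} \<subseteq> ball x r"
    "path_image (subpath 0 t g) \<subseteq> path_image g - {pathfinish g}"
    "path_image (subpath t 1 g) \<subseteq> path_image g - {pathstart g}"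
    using initial_piece[OF g(1), of r] g r by auto
  define P where "P = subpath 0 s c"
  define Q where "Q = subpath 0 s' d"
  define Z where "Z = subpath 0 t g"
  define R where "R = subpath s 1 c +++ M +++ subpath 1 s' d"
  have pc: "path c" "path d" "path g" using out inc g by (auto simp: arc_imp_path)
  have cs: "c 1 = u" "d 1 = v" using out inc by (auto simp: pathfinish_def)
  have R: "path R" "pathstart R = pathfinish P" "pathfinish R = pathfinish Q"
    using pc s(1,2) s'(1,2) rest cs by (auto simp: R_def P_def Q_def)
  have rev: "path_image (subpath 1 s' d) = path_image (subpath s' 1 d)"
    using s' by (auto simp: path_image_subpath_gen closed_segment_commute)
  have Rim: "path_image R = path_image (subpath s 1 c) \<union> path_image M \<union> path_image (subpath s' 1 d)"
    unfolding R_def using rest cs rev by (subst path_image_join; simp)+ auto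
  have xR: "x \<notin> path_image R" using Rim s(9) s'(9) rest out inc by auto
  have PI: "path_image P \<subseteq> path_image c" "path_image Q \<subseteq> path_image d" using s(8) s'(8) by (auto simp: P_def Q_def)
  have xP: "x \<in> path_image P" "x \<in> path_image Q"
    using pathstart_in_path_image[of P] pathstart_in_path_image[of Q] s(4) s'(4) by (simp_all add: P_def Q_def)
  have PQ: "path_image P \<inter> path_image Q = {x}" using PI xP cd by blast
  have W: "W w = winding_number P w + winding_number R w - winding_number Q w" if w: "w \<notin> ?I" for w
  proof -
    have n: "w \<notin> path_image c" "w \<notin> path_image d" "w \<notin> path_image M" using w J(3) by auto
    then have n2: "w \<notin> path_image (subpath s 1 c)" "w \<notin> path_image (subpath s' 1 d)" using s(9) s'(9) by auto
    have "winding_number c w = winding_number P w + winding_number (subpath s 1 c) w"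
      using winding_number_subpath_combine[OF pc(1) n(1), of 0 s 1] s by (simp add: P_def)
    moreover have "winding_number d w = winding_number Q w + winding_number (subpath s' 1 d) w"
      using winding_number_subpath_combine[OF pc(2) n(2), of 0 s' 1] s' by (simp add: Q_def)
    moreover have "winding_number (subpath 1 s' d) w = - winding_number (subpath s' 1 d) w"
      using winding_number_reversepath[of "subpath s' 1 d" w] n2 pc s' by (simp add: reversepath_subpath)
    moreover have "winding_number (M +++ subpath 1 s' d) w = winding_number M w + winding_number (subpath 1 s' d) w"
      using pc s'(1,2) rest cs n n2 rev by (intro winding_number_join) auto
    moreover have "winding_number R w = winding_number (subpath s 1 c) w + winding_number (M +++ subpath 1 s' d) w"
      unfolding R_def using pc s(1,2) s'(1,2) rest cs n n2 rev
      by (intro winding_number_join) (auto simp: path_image_join)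
    ultimately show ?thesis using J(5)[OF w] by algebra
  qed
  have Pf: "arc P" "pathstart P = x" "dist x (pathfinish P) = r" "path_image P - {pathfinish P} \<subseteq> ball x r"
    and Qf: "arc Q" "pathstart Q = x" "dist x (pathfinish Q) = r" "path_image Q - {pathfinish Q} \<subseteq> ball x r"
    using s s' by (simp_all add: P_def Q_def)
  obtain k \<delta> where k: "\<delta> > 0" "\<delta> \<le> r"
    "\<And>y. y \<in> ball x \<delta> \<Longrightarrow> y \<notin> path_image P \<union> path_image Q \<Longrightarrow>
       winding_number P y + winding_number R y - winding_number Q y \<in> {k - 1, k}"
    "\<And>Z z y. \<lbrakk>arc Z; pathstart Z = x; pathfinish Z = z; dist x z = r; path_image Z - {z} \<subseteq> ball x r;
        path_image Z \<inter> (path_image P \<union> path_image Q) = {x}; y \<in> path_image Z; y \<noteq> x; y \<in> ball x \<delta>\<rbrakk> \<Longrightarrow>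
       winding_number P y + winding_number R y - winding_number Q y =
         (if Arg2pi ((z - x) / (pathfinish Q - x)) < Arg2pi ((pathfinish P - x) / (pathfinish Q - x)) then k - 1 else k)"
    by (rule winding_number_across_arc[OF Pf(1,2) refl Pf(3,4) Qf(1,2) refl Qf(3,4) PQ R xR r(1)]) (rule that; assumption)
  have PQI: "path_image P \<union> path_image Q \<subseteq> ?I" using PI J(3) by auto
  have xI: "x \<in> ?I" using PQI xP by auto
  have k_eq: "k - 1 = (if \<forall>z\<in>inside ?I. W z = 1 then 0 else -1)"
  proof -
    have "x \<in> closure (inside ?I)" "x \<in> closure (outside ?I)"
      using Jordan_inside_outside[OF J(1,2)] xI by (auto simp: frontier_def)
    then obtain y1 y2 where y: "y1 \<in> inside ?I" "dist y1 x < \<delta>" "y2 \<in> outside ?I" "dist y2 x < \<delta>"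
      using k(1) unfolding closure_approachable by meson
    have y_notin: "y1 \<notin> ?I" "y2 \<notin> ?I" using y inside_no_overlap outside_no_overlap by blast+
    have pJ: "path J" using J(1) by (simp add: simple_path_imp_path)
    have W2: "W y2 = 0"
      using winding_number_zero_in_outside[OF pJ J(2) y(3)] J(4)[OF y_notin(2)] by simp
    have mem: "W y1 \<in> {k - 1, k}" "W y2 \<in> {k - 1, k}"
      using k(3)[of y1] k(3)[of y2] W y_notin y PQI by (auto simp: dist_commute)
    have J4: "winding_number J z = W z" if "z \<in> inside ?I" for z
      using that J(4) inside_no_overlap by blast
    show ?thesis
    proof (rule simple_closed_path_winding_number_inside[OF J(1)])
      assume a: "\<And>z. z \<in> inside ?I \<Longrightarrow> winding_number J z = 1"
      then have "\<forall>z\<in>inside ?I. W z = 1" "W y1 = 1" using J4 y by auto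
      then show ?thesis using mem W2 by auto
    next
      assume a: "\<And>z. z \<in> inside ?I \<Longrightarrow> winding_number J z = -1"
      then have "W y1 = -1" using J4 y by auto
      moreover then have "\<not> (\<forall>z\<in>inside ?I. W z = 1)" using y(1) by force
      ultimately show ?thesis using mem W2 by auto
    qed
  qed
  have gend: "pathfinish g \<noteq> x" using r by auto
  obtain w where w: "w \<in> path_image Z" "w \<noteq> x" "w \<in> ball x \<delta>"
  proof -
    have "continuous_on {0..1} g" using pc by (simp add: path_def)
    then obtain e where e: "e > 0" "\<And>t. t \<in> {0..1} \<Longrightarrow> dist t 0 < e \<Longrightarrow> dist (g t) (g 0) < \<delta>"
      using k(1) unfolding continuous_on_iff by (metis atLeastAtMost_iff order_refl zero_le_one)
    define t' where "t' = min t (e/2)"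
    have t': "0 < t'" "t' \<le> t" "t' < e" "t' \<le> 1" using t(1,2) e(1) by (auto simp: t'_def)
    have "g t' \<in> path_image Z" unfolding Z_def using t t' by (auto simp: path_image_subpath)
    moreover have "g t' \<noteq> x" using inj_onD[of g "{0..1}" t' 0] g(1,2) t' by (auto simp: arc_def pathstart_def)
    moreover have "g t' \<in> ball x \<delta>" using e(2)[of t'] t' g(2) by (auto simp: pathstart_def dist_commute)
    ultimately show ?thesis using that by blast
  qed
  have Zg: "path_image Z \<subseteq> path_image g - {pathfinish g}" using t(8) by (simp add: Z_def)
  have xZ: "x \<in> path_image Z" using pathstart_in_path_image[of Z] t(4) by (simp add: Z_def)
  have wI: "w \<notin> ?I" using w Zg g(3) by auto
  have "path_image Z \<inter> (path_image P \<union> path_image Q) = {x}"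
    using Zg g(3) PQI xZ xP by blast
  then have Ww: "W w = (if Arg2pi ((pathfinish Z - x) / (pathfinish Q - x)) < Arg2pi ((pathfinish P - x) / (pathfinish Q - x)) then k - 1 else k)"
    using k(4)[of Z "pathfinish Z" w] t w W[OF wI] by (simp add: Z_def)
  have "W y = W w"
  proof -
    have pJ: "path J" using J(1) by (simp add: simple_path_imp_path)
    have conn: "topological_space_class.connected (path_image g - {x, pathfinish g})"
      using connected_simple_path_endless[OF arc_imp_simple_path[OF g(1)]] g(2) by simp
    have *: "W y' = W w" if "y' \<in> path_image g - {x, pathfinish g}" for y'
    proof -
      have "y' \<notin> ?I" using that g(3) by auto
      moreover have "winding_number J y' = winding_number J w"
        using that w Zg g(3) by (intro winding_number_eq[OF pJ J(2) _ _ conn]) auto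
      ultimately show ?thesis using J(4) wI by metis
    qed
    show ?thesis
    proof (cases "y = pathfinish g")
      case True
      have conn2: "topological_space_class.connected (path_image g - {x})"
        using connected_arc_without_start[OF g(1)] g(2) by simp
      have "winding_number J y = winding_number J w"
        using y w Zg g(3) True gend by (intro winding_number_eq[OF pJ J(2) _ _ conn2]) auto
      then show ?thesis using J(4) wI y by metis
    qed (use * y xI in blast)
  qed
  then show ?thesis unfolding Ww k_eq[symmetric] using s(5) s'(5) t(5) by (simp add: P_def Q_def Z_def)
qed

section \<open>The closed curve of a cycle of a plane graph\<close>

locale plane_cycle = oriented_graph G for G :: "'v::finite pair_pre_digraph" +
  fixes pos \<gamma> \<rho> S nx ed
  assumes plane: "plane_embedding G pos \<gamma>"
    and ribbon: "positive_ribbon_structure G pos \<gamma> \<rho>"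
    and cyclic: "cyclic_on nx S"
    and ed: "\<And>x. x \<in> S \<Longrightarrow> ed x \<in> parcs G \<and> (ed x = (x, nx x) \<or> ed x = (nx x, x))"
    and ed_inj: "inj_on ed S"
begin

definition side :: "'v \<Rightarrow> real \<Rightarrow> complex" where "side x = arc_from \<gamma> x (ed x)"

definition curve :: "complex set" where "curve = (\<Union>x\<in>S. path_image (side x))"

text \<open>The winding number of the cycle. As a sum over the edges it does not depend on a starting
  vertex.\<close>

definition W :: "complex \<Rightarrow> complex" where "W z = (\<Sum>x\<in>S. winding_number (side x) z)"

lemma nx_in: "x \<in> S \<Longrightarrow> nx x \<in> S"
  using cyclic by (rule cyclic_on_inI)

lemma funpow_in: "x \<in> S \<Longrightarrow> (nx ^^ i) x \<in> S"
  by (induction i) (auto simp: nx_in)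

lemma nx_inj: "x \<in> S \<Longrightarrow> y \<in> S \<Longrightarrow> nx x = nx y \<Longrightarrow> x = y"
  using cyclic_on_inj_on[OF cyclic] by (rule inj_onD)

lemma nx_neq: "x \<in> S \<Longrightarrow> nx x \<noteq> x"
  using ed no_loop by metis

lemma nx_nx_neq: assumes "x \<in> S" shows "nx (nx x) \<noteq> x"
proof
  assume *: "nx (nx x) = x"
  have "ed x = ed (nx x)" using ed[OF assms] ed[OF nx_in[OF assms]] no_2cycle * by metis
  then show False using ed_inj assms nx_in nx_neq by (metis inj_onD)
qed

lemma card_ge_3: "card S \<ge> 3"
proof -
  obtain x where x: "x \<in> S" using cyclic by (auto simp: cyclic_on_def)
  have "{x, nx x, nx (nx x)} \<subseteq> S" using x nx_in by auto
  moreover have "card {x, nx x, nx (nx x)} = 3" using x nx_neq nx_in nx_nx_neq by (metis card_3_iff)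
  ultimately show ?thesis by (metis card_mono finite)
qed

lemma arc_from:
  assumes "a \<in> incident G x"
  shows "arc (arc_from \<gamma> x a)" "pathstart (arc_from \<gamma> x a) = pos x"
    "pathfinish (arc_from \<gamma> x a) = pos (opposite_end a x)" "path_image (arc_from \<gamma> x a) = path_image (\<gamma> a)"
  using assms plane by (auto simp: incident_def arc_from_def plane_embedding_def opposite_end_def arc_reversepath)

lemma pos_inj: "pos x = pos y \<longleftrightarrow> x = y"
  using plane verts by (auto simp: plane_embedding_def inj_on_def)

lemma ed_incident: assumes "x \<in> S"
  shows "ed x \<in> incident G x" "opposite_end (ed x) x = nx x" "ed x \<in> incident G (nx x)" "opposite_end (ed x) (nx x) = x"
proof -
  consider "ed x = (x, nx x)" | "ed x = (nx x, x)" using ed[OF assms] by blast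
  then show "ed x \<in> incident G x" "opposite_end (ed x) x = nx x" "ed x \<in> incident G (nx x)" "opposite_end (ed x) (nx x) = x"
    using ed[OF assms] nx_neq[OF assms] by (cases; simp add: incident_def opposite_end_def)+
qed

lemma side: assumes "x \<in> S"
  shows "arc (side x)" "pathstart (side x) = pos x" "pathfinish (side x) = pos (nx x)"
    "path_image (side x) = path_image (\<gamma> (ed x))" "reversepath (side x) = arc_from \<gamma> (nx x) (ed x)"
proof -
  show "arc (side x)" "pathstart (side x) = pos x" "pathfinish (side x) = pos (nx x)"
    "path_image (side x) = path_image (\<gamma> (ed x))"
    using arc_from[OF ed_incident(1)[OF assms]] ed_incident[OF assms] by (auto simp: side_def)
  show "reversepath (side x) = arc_from \<gamma> (nx x) (ed x)"
  proof -
    consider "ed x = (x, nx x)" | "ed x = (nx x, x)" using ed[OF assms] by blast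
    then show ?thesis using nx_neq[OF assms] by (cases; simp add: side_def arc_from_def)
  qed
qed

lemma edges_meet:
  assumes "a \<in> parcs G" "b \<in> parcs G" "a \<noteq> b"
  shows "path_image (\<gamma> a) \<inter> path_image (\<gamma> b) \<subseteq> pos ` ({fst a, snd a} \<inter> {fst b, snd b})"
proof
  fix z assume z: "z \<in> path_image (\<gamma> a) \<inter> path_image (\<gamma> b)"
  then have "z \<in> range pos" using plane assms verts unfolding plane_embedding_def by blast
  moreover have "z \<in> {pos (fst a), pos (snd a)}" "z \<in> {pos (fst b), pos (snd b)}"
    using z calculation plane assms verts unfolding plane_embedding_def by blast+
  ultimately show "z \<in> pos ` ({fst a, snd a} \<inter> {fst b, snd b})"
    using pos_inj by auto
qed

lemma sides_meet:
  assumes "x \<in> S" "y \<in> S" "x \<noteq> y"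
  shows "path_image (side x) \<inter> path_image (side y) \<subseteq> pos ` ({x, nx x} \<inter> {y, nx y})"
proof -
  have "ed x \<noteq> ed y" using ed_inj assms by (metis inj_onD)
  then have "path_image (side x) \<inter> path_image (side y) \<subseteq> pos ` ({fst (ed x), snd (ed x)} \<inter> {fst (ed y), snd (ed y)})"
    using edges_meet[of "ed x" "ed y"] ed assms side by auto
  moreover have "{fst (ed x), snd (ed x)} = {x, nx x}" "{fst (ed y), snd (ed y)} = {y, nx y}"
    using ed[OF assms(1)] ed[OF assms(2)] by auto
  ultimately show ?thesis by simp
qed

lemma funpow_inj:
  assumes "x \<in> S" "i < card S" "j < card S" "(nx ^^ i) x = (nx ^^ j) x"
  shows "i = j"
  using cyclic_on_enumerate(1)[OF cyclic assms(1)] assms by (auto simp: bij_betw_def inj_on_def)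

text \<open>The join of consecutive sides of the cycle, as long as it does not close up.\<close>

lemma chain_of_sides:
  assumes "x \<in> S" "0 < n" "n < card S"
  shows "\<exists>M. arc M \<and> pathstart M = pos x \<and> pathfinish M = pos ((nx ^^ n) x) \<and>
    path_image M = (\<Union>i<n. path_image (side ((nx ^^ i) x))) \<and>
    (\<forall>z. z \<notin> path_image M \<longrightarrow> winding_number M z = (\<Sum>i<n. winding_number (side ((nx ^^ i) x)) z))"
  using assms(2,3)
proof (induction n rule: nat_induct_non_zero)
  case 1
  then show ?case using side[OF assms(1)] by (intro exI[of _ "side x"]) auto
next
  case (Suc n)
  then obtain M where M: "arc M" "pathstart M = pos x" "pathfinish M = pos ((nx ^^ n) x)"
    "path_image M = (\<Union>i<n. path_image (side ((nx ^^ i) x)))"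
    "\<And>z. z \<notin> path_image M \<Longrightarrow> winding_number M z = (\<Sum>i<n. winding_number (side ((nx ^^ i) x)) z)"
    by auto
  let ?y = "(nx ^^ n) x"
  have y: "?y \<in> S" using funpow_in assms(1) by auto
  note sy = side[OF y]
  have meet: "path_image M \<inter> path_image (side ?y) \<subseteq> {pos ?y}"
  proof
    fix z assume z: "z \<in> path_image M \<inter> path_image (side ?y)"
    then obtain i where i: "i < n" "z \<in> path_image (side ((nx ^^ i) x))" using M(4) by auto
    have ne: "(nx ^^ i) x \<noteq> ?y" using funpow_inj[OF assms(1), of i n] i Suc.prems by auto
    have "z \<in> pos ` ({(nx ^^ i) x, nx ((nx ^^ i) x)} \<inter> {?y, nx ?y})"
      using sides_meet[OF funpow_in[OF assms(1), of i] y ne] i z by auto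
    moreover have "(nx ^^ i) x \<noteq> nx ?y" "nx ((nx ^^ i) x) \<noteq> nx ?y"
      using funpow_inj[OF assms(1), of i "Suc n"] funpow_inj[OF assms(1), of "Suc i" "Suc n"] i Suc.prems by auto
    ultimately show "z \<in> {pos ?y}" using ne by auto
  qed
  show ?case
  proof (intro exI[of _ "M +++ side ?y"] conjI allI impI)
    show "arc (M +++ side ?y)" using M sy meet by (intro arc_join) auto
    show im: "path_image (M +++ side ?y) = (\<Union>i<Suc n. path_image (side ((nx ^^ i) x)))"
      using M sy by (simp add: path_image_join lessThan_Suc) blast
    fix z assume "z \<notin> path_image (M +++ side ?y)"
    then have z: "z \<notin> path_image M" "z \<notin> path_image (side ?y)" using M sy by (auto simp: path_image_join)
    have "winding_number (M +++ side ?y) z = winding_number M z + winding_number (side ?y) z"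
      using M sy z by (intro winding_number_join) (auto simp: arc_imp_path)
    then show "winding_number (M +++ side ?y) z = (\<Sum>i<Suc n. winding_number (side ((nx ^^ i) x)) z)"
      using M(5)[OF z(1)] by simp
  qed (use M sy in auto)
qed


lemma pos_in_edge: assumes "a \<in> parcs G" "pos v \<in> path_image (\<gamma> a)" shows "v = fst a \<or> v = snd a"
proof -
  have "path_image (\<gamma> a) \<inter> pos ` pverts G \<subseteq> {pos (fst a), pos (snd a)}"
    using plane assms(1) by (simp add: plane_embedding_def)
  then have "pos v \<in> {pos (fst a), pos (snd a)}" using assms(2) verts by blast
  then show ?thesis using pos_inj by auto
qed

lemma pos_in_side:
  assumes "x \<in> S" "pos v \<in> path_image (side x)"
  shows "v = x \<or> v = nx x"
  using pos_in_edge[of "ed x" v] ed[OF assms(1)] side(4)[OF assms(1)] assms(2) by auto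

text \<open>The closed curve of the cycle, cut at \<open>x\<close> into the side that leaves \<open>x\<close>, the side that returns
  to \<open>x\<close> and the rest.\<close>

lemma closed_curve_at:
  assumes x: "x \<in> S" and p: "p \<in> S" "nx p = x"
  obtains M J where "path M" "pathstart M = pos (nx x)" "pathfinish M = pos p" "pos x \<notin> path_image M"
    "simple_path J" "pathfinish J = pathstart J" "path_image J = curve"
    "path_image J = path_image (side x) \<union> path_image M \<union> path_image (side p)"
    "\<And>y. y \<notin> curve \<Longrightarrow> winding_number J y = W y"
    "\<And>y. y \<notin> curve \<Longrightarrow> W y = winding_number (side x) y + winding_number M y + winding_number (side p) y"
proof -
  obtain n where n: "card S = Suc (Suc n)" "0 < n" using card_ge_3
    by (metis Suc_le_D Suc_le_mono numeral_3_eq_3 zero_less_Suc)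
  have full: "(nx ^^ card S) x = x" and bij: "bij_betw (\<lambda>i. (nx ^^ i) x) {0..<card S} S"
    using cyclic_on_enumerate[OF cyclic x] by auto
  have S_eq: "S = (\<lambda>i. (nx ^^ i) x) ` {..<card S}" using bij by (auto simp: bij_betw_def lessThan_atLeast0)
  have p_eq: "p = (nx ^^ Suc n) x"
  proof -
    obtain i where i: "i < card S" "p = (nx ^^ i) x" using p(1) S_eq by auto
    then have "(nx ^^ Suc i) x = x" using p(2) by simp
    then have "Suc i = card S" using funpow_inj[OF x, of "Suc i" 0] i x by force
    then show ?thesis using i n by simp
  qed
  obtain M where M: "arc M" "pathstart M = pos (nx x)" "pathfinish M = pos ((nx ^^ n) (nx x))"
    "path_image M = (\<Union>i<n. path_image (side ((nx ^^ i) (nx x))))"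
    "\<And>z. z \<notin> path_image M \<Longrightarrow> winding_number M z = (\<Sum>i<n. winding_number (side ((nx ^^ i) (nx x))) z)"
    using chain_of_sides[OF nx_in[OF x], of n] n by auto
  obtain L where L: "arc L" "pathstart L = pos x" "pathfinish L = pos ((nx ^^ Suc n) x)"
    "path_image L = (\<Union>i<Suc n. path_image (side ((nx ^^ i) x)))"
    "\<And>z. z \<notin> path_image L \<Longrightarrow> winding_number L z = (\<Sum>i<Suc n. winding_number (side ((nx ^^ i) x)) z)"
    using chain_of_sides[OF x, of "Suc n"] n by auto
  have curve_eq: "curve = (\<Union>i<card S. path_image (side ((nx ^^ i) x)))"
    unfolding curve_def by (subst S_eq) auto
  have W_eq: "W z = (\<Sum>i<card S. winding_number (side ((nx ^^ i) x)) z)" for z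
    unfolding W_def lessThan_atLeast0 by (rule sum.reindex_bij_betw[OF bij, symmetric])
  have shift: "(nx ^^ i) (nx x) = (nx ^^ Suc i) x" for i by (simp add: funpow_swap1)
  have M_im: "path_image M = (\<Union>i<n. path_image (side ((nx ^^ Suc i) x)))" using M(4) unfolding shift .
  have L_im: "path_image L = path_image (side x) \<union> path_image M"
    unfolding L(4) M_im lessThan_Suc_eq_insert_0 by (auto simp del: funpow.simps(2))
  have curve_L: "curve = path_image L \<union> path_image (side p)"
    unfolding curve_eq n(1) L(4) p_eq by (simp only: lessThan_Suc[of "Suc n"]) blast
  note sp = side[OF p(1)]
  define J where "J = L +++ side p"
  have meet: "path_image L \<inter> path_image (side p) \<subseteq> {pos x, pos p}"
  proof
    fix z assume z: "z \<in> path_image L \<inter> path_image (side p)"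
    then obtain i where i: "i < Suc n" "z \<in> path_image (side ((nx ^^ i) x))" using L(4) by auto
    have "(nx ^^ i) x \<noteq> p" unfolding p_eq using funpow_inj[OF x, of i "Suc n"] i n by auto
    then show "z \<in> {pos x, pos p}"
      using sides_meet[OF funpow_in[OF x, of i] p(1)] i z p(2) by auto
  qed
  have pp: "pos ((nx ^^ Suc n) x) = pos p" using p_eq by simp
  show thesis
  proof (rule that[of M J])
    show "path M" "pathstart M = pos (nx x)" using M by (auto simp: arc_imp_path)
    show "pathfinish M = pos p" unfolding p_eq M(3) shift ..
    show "pos x \<notin> path_image M"
    proof
      assume "pos x \<in> path_image M"
      then obtain i where i: "i < n" "pos x \<in> path_image (side ((nx ^^ Suc i) x))" using M_im by auto
      then have "x = (nx ^^ Suc i) x \<or> x = (nx ^^ Suc (Suc i)) x"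
        using pos_in_side[OF funpow_in[OF x, of "Suc i"], of x] by auto
      then show False using funpow_inj[OF x, of 0 "Suc i"] funpow_inj[OF x, of 0 "Suc (Suc i)"] i n by auto
    qed
    show "simple_path J" unfolding J_def
      using L sp meet p(2) pp by (intro simple_path_join_loop) auto
    show "pathfinish J = pathstart J" unfolding J_def using L sp p(2) by simp
    show im: "path_image J = curve" unfolding J_def curve_L using L sp pp by (simp add: path_image_join)
    show "path_image J = path_image (side x) \<union> path_image M \<union> path_image (side p)"
      unfolding im curve_L L_im by blast
    fix y assume y: "y \<notin> curve"
    then have yn: "y \<notin> path_image L" "y \<notin> path_image (side p)" "y \<notin> path_image M" using curve_L L_im by auto
    have "winding_number J y = winding_number L y + winding_number (side p) y"
      unfolding J_def using L sp pp yn by (intro winding_number_join) (auto simp: arc_imp_path)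
    also have "\<dots> = W y" unfolding W_eq L(5)[OF yn(1)] n(1) p_eq by simp
    finally show "winding_number J y = W y" .
    show "W y = winding_number (side x) y + winding_number M y + winding_number (side p) y"
      unfolding W_eq M(5)[OF yn(3)] n(1) p_eq shift
      by (subst sum.lessThan_Suc, subst sum.lessThan_Suc_shift) simp
  qed
qed

text \<open>The winding number of the cycle immediately to its right; on its left it is larger by 1.\<close>

definition right_value :: complex where
  "right_value = (if \<forall>z\<in>inside curve. W z = 1 then 0 else -1)"

text \<open>A circle of this radius around \<open>x\<close> has all other vertices outside, so that every edge at \<open>x\<close> reaches
  it, and shows the counterclockwise order of these edges.\<close>

definition good_radius :: "'v \<Rightarrow> real \<Rightarrow> bool" where
  "good_radius x r \<longleftrightarrow> 0 < r \<and> (\<forall>y. y \<noteq> x \<longrightarrow> r < dist (pos x) (pos y)) \<and>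
     (\<forall>a\<in>incident G x. ccw_successor (incident G x) (\<lambda>c. exit_vector (arc_from \<gamma> x c) r) a (\<rho> x a))"

lemma ex_good_radius: "\<exists>r. good_radius x r"
proof -
  have 1: "\<forall>\<^sub>F r in at_right 0. \<forall>a\<in>incident G x.
        ccw_successor (incident G x) (\<lambda>c. exit_vector (arc_from \<gamma> x c) r) a (\<rho> x a)"
    using ribbon verts by (auto simp: positive_ribbon_structure_def)
  have "\<forall>\<^sub>F r in at_right 0. \<forall>y\<in>UNIV. y \<noteq> x \<longrightarrow> r < dist (pos x) (pos y)"
  proof (intro eventually_ball_finite ballI)
    fix y :: 'v
    show "\<forall>\<^sub>F r in at_right 0. y \<noteq> x \<longrightarrow> r < dist (pos x) (pos y)"
    proof (cases "y = x")
      case False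
      then have "dist (pos x) (pos y) > 0" using pos_inj by auto
      then show ?thesis using eventually_at_right_less eventually_at_right by (metis (mono_tags, lifting))
    qed auto
  qed auto
  moreover have "\<forall>\<^sub>F r in at_right (0::real). 0 < r" by (rule eventually_at_right_less)
  ultimately have "\<forall>\<^sub>F r in at_right 0. good_radius x r"
    using 1 by eventually_elim (auto simp: good_radius_def)
  then show ?thesis using eventually_happens trivial_limit_at_right_real by blast
qed

definition radius :: "'v \<Rightarrow> real" where "radius x = (SOME r. good_radius x r)"

lemma radius: "good_radius x (radius x)"
  unfolding radius_def using ex_good_radius by (rule someI_ex)

definition exit_dir :: "'v \<Rightarrow> 'v \<times> 'v \<Rightarrow> complex" where
  "exit_dir x a = exit_vector (arc_from \<gamma> x a) (radius x)"

definition prev :: "'v \<Rightarrow> 'v" where "prev x = (SOME p. p \<in> S \<and> nx p = x)"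

lemma prev: assumes "x \<in> S" shows "prev x \<in> S" "nx (prev x) = x"
proof -
  have "\<exists>p. p \<in> S \<and> nx p = x"
  proof -
    have "(nx ^^ card S) x = x" using cyclic_on_enumerate[OF cyclic assms] by simp
    then have "nx ((nx ^^ (card S - 1)) x) = x" using card_ge_3
      by (metis Suc_diff_1 funpow.simps(2) comp_apply gr0I not_numeral_le_zero)
    then show ?thesis using funpow_in assms by blast
  qed
  then show "prev x \<in> S" "nx (prev x) = x" unfolding prev_def by (metis (mono_tags, lifting) someI_ex)+
qed

text \<open>The angle is measured counterclockwise from the edge on which the cycle arrives at \<open>x\<close>, so that
  the edges on the right of the cycle are those with an angle between 0 and that of \<open>ed x\<close>.\<close>

definition angle :: "'v \<Rightarrow> 'v \<times> 'v \<Rightarrow> real" where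
  "angle x a = Arg2pi (exit_dir x a / exit_dir x (ed (prev x)))"

lemma W_beside:
  assumes x: "x \<in> S" and a: "a \<in> incident G x" "a \<notin> ed ` S"
    and y: "y \<in> path_image (\<gamma> a)" "y \<notin> curve"
  shows "W y = right_value + (if angle x a < angle x (ed x) then 0 else 1)"
proof -
  let ?p = "prev x"
  note p = prev[OF x]
  obtain M J where M: "path M" "pathstart M = pos (nx x)" "pathfinish M = pos ?p" "pos x \<notin> path_image M"
    and J: "simple_path J" "pathfinish J = pathstart J" "path_image J = curve"
    "path_image J = path_image (side x) \<union> path_image M \<union> path_image (side ?p)"
    "\<And>y. y \<notin> curve \<Longrightarrow> winding_number J y = W y"
    "\<And>y. y \<notin> curve \<Longrightarrow> W y = winding_number (side x) y + winding_number M y + winding_number (side ?p) y"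
    using closed_curve_at[OF x p] by metis
  note sp = side[OF p(1), unfolded p(2)]
  define d where "d = arc_from \<gamma> x (ed ?p)"
  have d_eq: "d = reversepath (side ?p)" using sp(5) by (simp add: d_def)
  have d: "arc d" "pathstart d = pos x" "pathfinish d = pos ?p" "path_image d = path_image (side ?p)"
    using sp(1-3) unfolding d_eq by (simp_all add: arc_reversepath)
  have wd: "winding_number (side ?p) z = - winding_number d z" if "z \<notin> curve" for z
    using winding_number_reversepath[of "side ?p" z] sp(1) that p(1)
    unfolding d_eq by (auto simp: arc_imp_path curve_def)
  define g where "g = arc_from \<gamma> x a"
  have g: "arc g" "pathstart g = pos x" "pathfinish g = pos (opposite_end a x)" "path_image g = path_image (\<gamma> a)"
    using arc_from[OF a(1)] by (auto simp: g_def)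
  have opp: "opposite_end a x \<noteq> x" using a(1) no_loop[of x] by (cases a) (auto simp: incident_def opposite_end_def)
  have g_meet: "path_image g \<inter> path_image J \<subseteq> {pos x, pathfinish g}"
  proof
    fix z assume z: "z \<in> path_image g \<inter> path_image J"
    then obtain w where w: "w \<in> S" "z \<in> path_image (\<gamma> (ed w))" using J(3) side by (auto simp: curve_def)
    have "z \<in> pos ` ({fst a, snd a} \<inter> {fst (ed w), snd (ed w)})"
      using edges_meet[of a "ed w"] z w ed[OF w(1)] a g by (auto simp: incident_def)
    then show "z \<in> {pos x, pathfinish g}" using a(1) g(3) by (auto simp: incident_def opposite_end_def)
  qed
  have cd: "path_image (side x) \<inter> path_image d = {pos x}"
  proof -
    have "x \<noteq> ?p" using p nx_neq by metis
    moreover have "nx x \<noteq> ?p" using p nx_nx_neq by metis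
    ultimately have "path_image (side x) \<inter> path_image (side ?p) \<subseteq> {pos x}"
      using sides_meet[OF x p(1)] p(2) x nx_neq by auto
    moreover have "pos x \<in> path_image (side x)" "pos x \<in> path_image d"
      using d side[OF x] by (metis pathstart_in_path_image)+
    ultimately show ?thesis using d by auto
  qed
  have r: "0 < radius x" "\<And>y. y \<noteq> x \<Longrightarrow> radius x < dist (pos x) (pos y)"
    using radius[of x] by (auto simp: good_radius_def)
  have "W y = (if \<forall>z\<in>inside (path_image J). W z = 1 then 0 else -1) +
    (if Arg2pi (exit_vector g (radius x) / exit_vector d (radius x)) < Arg2pi (exit_vector (side x) (radius x) / exit_vector d (radius x)) then 0 else 1)"
  proof (rule winding_number_beside_closed_curve[where W = W and M = M and J = J and x = "pos x" and u = "pos (nx x)" and v = "pos ?p"])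
    show "W z = winding_number (side x) z + winding_number M z - winding_number d z" if "z \<notin> path_image J" for z
      using J(6)[of z] J(3) that wd[of z] by simp
    show "radius x < dist (pos x) (pos (nx x))" "radius x < dist (pos x) (pos ?p)" "radius x < dist (pos x) (pathfinish g)"
      using r nx_neq[OF x] nx_neq[OF p(1)] p(2) opp g(3) by metis+
  qed (use side[OF x] d M J cd r g g_meet y in auto)
  then show ?thesis unfolding right_value_def J(3) angle_def exit_dir_def g_def d_def side_def .
qed

lemma exit_dir:
  assumes "a \<in> incident G x"
  shows "pos x + exit_dir x a \<in> path_image (\<gamma> a)" "norm (exit_dir x a) = radius x" "exit_dir x a \<noteq> 0"
proof -
  let ?g = "arc_from \<gamma> x a"
  note g = arc_from[OF assms]
  have opp: "opposite_end a x \<noteq> x" using assms no_loop[of x] by (cases a) (auto simp: incident_def opposite_end_def)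
  have r: "0 < radius x" "radius x < dist (pos x) (pos (opposite_end a x))"
    using radius[of x] opp by (auto simp: good_radius_def)
  obtain s where s: "0 < s" "s < 1" "?g s = pos x + exit_dir x a" "dist (pos x) (?g s) = radius x"
    using first_exit[OF g(1), of "radius x"] r unfolding g(2,3) exit_dir_def by metis
  have "?g s \<in> path_image ?g" using s(1,2) unfolding path_image_def by (intro imageI) auto
  then show "pos x + exit_dir x a \<in> path_image (\<gamma> a)" using s g(4) by simp
  show "norm (exit_dir x a) = radius x" using s by (simp add: dist_norm)
  then show "exit_dir x a \<noteq> 0" using r by auto
qed

lemma exit_dir_inj:
  assumes "a \<in> incident G x" "b \<in> incident G x" "exit_dir x a = exit_dir x b"
  shows "a = b"
proof (rule ccontr)
  assume "a \<noteq> b"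
  then obtain w where w: "pos x + exit_dir x a = pos w"
    using edges_meet[of a b] exit_dir(1)[OF assms(1)] exit_dir(1)[OF assms(2)] assms by (auto simp: incident_def)
  then have "dist (pos x) (pos w) = radius x"
    using exit_dir(2)[OF assms(1)] by (metis add_diff_cancel_left' dist_commute dist_norm)
  moreover have "w \<noteq> x" using w exit_dir(3)[OF assms(1)] by auto
  ultimately show False using radius[of x] by (auto simp: good_radius_def)
qed

lemma ed_prev: assumes "x \<in> S"
  shows "ed (prev x) \<in> incident G x" "ed (prev x) \<noteq> ed x"
proof -
  note p = prev[OF assms]
  show "ed (prev x) \<in> incident G x" using ed_incident(3)[OF p(1)] p(2) by simp
  have "prev x \<noteq> x" using p nx_neq by metis
  then show "ed (prev x) \<noteq> ed x" using ed_inj p(1) assms by (metis inj_onD)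
qed

lemma angle_range: "0 \<le> angle x a" "angle x a < 2 * pi"
  by (auto simp: angle_def Arg2pi_ge_0 Arg2pi_lt_2pi)

lemma angle_inj:
  assumes "x \<in> S" "a \<in> incident G x" "b \<in> incident G x" "angle x a = angle x b"
  shows "a = b"
proof -
  let ?e = "ed (prev x)"
  have e: "exit_dir x ?e \<noteq> 0" using exit_dir(3) ed_prev(1)[OF assms(1)] by blast
  have "exit_dir x a / exit_dir x ?e = exit_dir x b / exit_dir x ?e"
    using Arg2pi_eq[of "exit_dir x a / exit_dir x ?e"] Arg2pi_eq[of "exit_dir x b / exit_dir x ?e"] assms(4) exit_dir(2)[OF assms(2)] exit_dir(2)[OF assms(3)]
    by (metis angle_def norm_divide)
  then show ?thesis using exit_dir_inj assms e by simp
qed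

lemma angle_prev: "x \<in> S \<Longrightarrow> angle x (ed (prev x)) = 0"
  using exit_dir(3) ed_prev(1) by (simp add: angle_def Arg2pi_eq_0)

lemma angle_pos:
  assumes "x \<in> S" "a \<in> incident G x" "a \<noteq> ed (prev x)" shows "0 < angle x a"
  using angle_inj[OF assms(1,2) ed_prev(1)[OF assms(1)]] angle_prev[OF assms(1)] angle_range(1)[of x a] assms(3)
  by linarith

lemma Arg2pi_exit_dir_quotient:
  assumes "x \<in> S" "a \<in> incident G x" "c \<in> incident G x"
  shows "Arg2pi (exit_dir x c / exit_dir x a) = (if angle x a \<le> angle x c then angle x c - angle x a else angle x c - angle x a + 2 * pi)"
proof -
  let ?e = "exit_dir x (ed (prev x))"
  have nz: "?e \<noteq> 0" "exit_dir x a / ?e \<noteq> 0" "exit_dir x c / ?e \<noteq> 0" using exit_dir(3) ed_prev(1) assms by auto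
  have q: "exit_dir x c / exit_dir x a = (exit_dir x c / ?e) / (exit_dir x a / ?e)" using nz by simp
  show ?thesis
  proof (cases "angle x a \<le> angle x c")
    case True
    then show ?thesis unfolding q using Arg2pi_divide[OF nz(2,3)] by (simp add: angle_def)
  next
    case False
    then have *: "Arg2pi (exit_dir x a / exit_dir x c) = angle x a - angle x c"
      using Arg2pi_divide[OF nz(3,2)] nz by (simp add: angle_def)
    have "Arg2pi (inverse (exit_dir x a / exit_dir x c)) = 2 * pi - Arg2pi (exit_dir x a / exit_dir x c)"
      unfolding Arg2pi_inverse using * False Arg2pi_eq_0_pi[of "exit_dir x a / exit_dir x c"] by auto
    then show ?thesis using * False by simp
  qed
qed

text \<open>The rotation goes to the next larger angle, and from the largest one back to 0.\<close>

lemma angle_successor: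
  assumes x: "x \<in> S" and a: "a \<in> incident G x"
  shows "\<rho> x a \<in> incident G x"
    and "c \<in> incident G x \<Longrightarrow> angle x a < angle x c \<Longrightarrow> angle x a < angle x (\<rho> x a) \<and> angle x (\<rho> x a) \<le> angle x c"
    and "(\<And>c. c \<in> incident G x \<Longrightarrow> angle x c \<le> angle x a) \<Longrightarrow> angle x (\<rho> x a) = 0"
proof -
  let ?b = "\<rho> x a"
  have "ccw_successor (incident G x) (exit_dir x) a ?b"
    using radius[of x] a by (auto simp: good_radius_def exit_dir_def[abs_def])
  then have b: "?b \<in> incident G x"
    and min: "\<And>c. c \<in> incident G x \<Longrightarrow> c \<noteq> a \<Longrightarrow> ?b \<noteq> a \<and> Arg2pi (exit_dir x ?b / exit_dir x a) \<le> Arg2pi (exit_dir x c / exit_dir x a)"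
    by (auto simp: ccw_successor_def)
  show "?b \<in> incident G x" by fact
  note D = Arg2pi_exit_dir_quotient[OF x a]
  show "angle x a < angle x ?b \<and> angle x ?b \<le> angle x c" if c: "c \<in> incident G x" "angle x a < angle x c"
  proof -
    have ne: "c \<noteq> a" using c by auto
    have "angle x ?b \<noteq> angle x a" using min[OF c(1) ne] angle_inj[OF x b a] by auto
    then show ?thesis using min[OF c(1) ne] c D[OF b] D[OF c(1)] angle_range[of x c] angle_range[of x ?b]
      by (auto split: if_splits)
  qed
  show "angle x ?b = 0" if max: "\<And>c. c \<in> incident G x \<Longrightarrow> angle x c \<le> angle x a"
  proof -
    let ?e = "ed (prev x)"
    have e: "?e \<in> incident G x" "angle x ?e = 0" using ed_prev[OF x] angle_prev[OF x] by auto
    have "0 < angle x (ed x)" using angle_pos[OF x ed_incident(1)[OF x]] ed_prev(2)[OF x] by auto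
    then have ap: "0 < angle x a" using max[OF ed_incident(1)[OF x]] by simp
    then have ne: "?e \<noteq> a" using e by auto
    have "angle x ?b \<noteq> angle x a" using min[OF e(1) ne] angle_inj[OF x b a] by auto
    then have "angle x ?b < angle x a" using max[OF b] by simp
    then show ?thesis using min[OF e(1) ne] e D[OF b] D[OF e(1)] ap angle_range[of x ?b]
      by (auto split: if_splits)
  qed
qed

text \<open>At a vertex of the cycle, the bounds reflect that \<open>(x, a)\<close> stands for the corner before \<open>a\<close>: the
  corner before \<open>ed x\<close> is still on the right, the one before the arriving edge is on the left.\<close>

definition right_of_cycle :: "'v \<Rightarrow> 'v \<times> 'v \<Rightarrow> bool" where
  "right_of_cycle x a \<longleftrightarrow> (if x \<in> S then 0 < angle x a \<and> angle x a \<le> angle x (ed x) else W (pos x) = right_value)"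

lemma right_rotate:
  assumes a: "a \<in> incident G x" "a \<notin> ed ` S"
  shows "right_of_cycle x (\<rho> x a) = right_of_cycle x a"
proof (cases "x \<in> S")
  case x: True
  have ne: "a \<noteq> ed x" "a \<noteq> ed (prev x)" using a x prev[OF x] by auto
  have pos: "0 < angle x a" using angle_pos[OF x a(1) ne(2)] .
  have "angle x a \<noteq> angle x (ed x)" using angle_inj[OF x a(1) ed_incident(1)[OF x]] ne by auto
  then consider "angle x a < angle x (ed x)" | "angle x (ed x) < angle x a" by linarith
  then show ?thesis
  proof cases
    case 1
    then show ?thesis using angle_successor(2)[OF x a(1) ed_incident(1)[OF x]] pos x by (auto simp: right_of_cycle_def)
  next
    case 2
    show ?thesis
    proof (cases "\<exists>c\<in>incident G x. angle x a < angle x c")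
      case True
      then show ?thesis using angle_successor(2)[OF x a(1)] 2 x by (force simp: right_of_cycle_def)
    next
      case False
      then have "angle x (\<rho> x a) = 0" using angle_successor(3)[OF x a(1)] by (auto simp: not_less)
      then show ?thesis using 2 x by (auto simp: right_of_cycle_def)
    qed
  qed
qed (simp add: right_of_cycle_def)

lemma right_cycle:
  assumes x: "x \<in> S"
  shows "right_of_cycle x (ed x)" "\<not> right_of_cycle x (\<rho> x (ed x))" "\<not> right_of_cycle (nx x) (ed x)" "right_of_cycle (nx x) (\<rho> (nx x) (ed x))"
proof -
  note e = ed_incident(1)[OF x]
  have pos: "0 < angle x (ed x)" using angle_pos[OF x e] ed_prev(2)[OF x] by auto
  then show "right_of_cycle x (ed x)" using x by (simp add: right_of_cycle_def)
  show "\<not> right_of_cycle x (\<rho> x (ed x))"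
  proof (cases "\<exists>c\<in>incident G x. angle x (ed x) < angle x c")
    case True
    then show ?thesis using angle_successor(2)[OF x e] x by (force simp: right_of_cycle_def)
  next
    case False
    then have "angle x (\<rho> x (ed x)) = 0" using angle_successor(3)[OF x e] by (auto simp: not_less)
    then show ?thesis using x by (auto simp: right_of_cycle_def)
  qed
  let ?y = "nx x"
  have y: "?y \<in> S" using nx_in x by auto
  have py: "prev ?y = x"
  proof -
    have "nx (prev ?y) = nx x" "prev ?y \<in> S" using prev[OF y] by auto
    then show ?thesis using nx_inj x by blast
  qed
  have 0: "angle ?y (ed x) = 0" using angle_prev[OF y] py by simp
  then show "\<not> right_of_cycle ?y (ed x)" using y by (simp add: right_of_cycle_def)
  have "0 < angle ?y (ed ?y)" using angle_pos[OF y ed_incident(1)[OF y]] ed_prev(2)[OF y] by auto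
  then show "right_of_cycle ?y (\<rho> ?y (ed x))"
    using angle_successor(2)[OF y ed_incident(3)[OF x] ed_incident(1)[OF y]] 0 y by (auto simp: right_of_cycle_def)
qed

text \<open>Links the local description of the right side by angles with the global one by winding
  numbers.\<close>

lemma right_iff_W:
  assumes x: "x \<in> S" and a: "a \<in> incident G x" "a \<notin> ed ` S" and y: "y \<in> path_image (\<gamma> a)" "y \<notin> curve"
  shows "right_of_cycle x a \<longleftrightarrow> W y = right_value"
proof -
  have ne: "a \<noteq> ed x" "a \<noteq> ed (prev x)" using a x prev[OF x] by auto
  have pos: "0 < angle x a" using angle_pos[OF x a(1) ne(2)] .
  have "angle x a \<noteq> angle x (ed x)" using angle_inj[OF x a(1) ed_incident(1)[OF x]] ne by auto
  then show ?thesis using W_beside[OF x a y] pos x by (auto simp: right_of_cycle_def)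
qed

lemma pos_notin_curve: "v \<notin> S \<Longrightarrow> pos v \<notin> curve"
  using pos_in_side nx_in by (auto simp: curve_def)

text \<open>An edge outside the cycle is disjoint from the curve apart from its ends, so the winding number
  decides its side at both ends.\<close>

lemma right_across:
  assumes a: "a \<in> parcs G" "a \<notin> ed ` S"
  shows "right_of_cycle (fst a) a = right_of_cycle (snd a) a"
proof -
  let ?g = "\<gamma> a"
  have g: "arc ?g" "pathstart ?g = pos (fst a)" "pathfinish ?g = pos (snd a)"
    using plane a(1) by (auto simp: plane_embedding_def)
  have inc: "a \<in> incident G (fst a)" "a \<in> incident G (snd a)" using a(1) by (auto simp: incident_def)
  have ends: "pos (fst a) \<in> path_image ?g" "pos (snd a) \<in> path_image ?g"
    using g by (metis pathstart_in_path_image, metis pathfinish_in_path_image)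
  have meet: "path_image ?g \<inter> curve \<subseteq> pos ` ({fst a, snd a} \<inter> S)"
  proof
    fix z assume z: "z \<in> path_image ?g \<inter> curve"
    then obtain w where w: "w \<in> S" "z \<in> path_image (\<gamma> (ed w))" using side by (auto simp: curve_def)
    have "z \<in> pos ` ({fst a, snd a} \<inter> {fst (ed w), snd (ed w)})"
      using edges_meet[of a "ed w"] z w ed[OF w(1)] a by auto
    moreover have "{fst (ed w), snd (ed w)} \<subseteq> S" using ed[OF w(1)] w(1) nx_in by auto
    ultimately show "z \<in> pos ` ({fst a, snd a} \<inter> S)" by blast
  qed
  consider "fst a \<in> S" "snd a \<in> S" | "fst a \<in> S" "snd a \<notin> S" | "fst a \<notin> S" "snd a \<in> S" | "fst a \<notin> S" "snd a \<notin> S" by blast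
  then show ?thesis
  proof cases
    case 1
    have inj: "inj_on ?g {0..1}" using g(1) by (simp add: arc_def)
    have "?g (1/2) \<noteq> ?g 0" "?g (1/2) \<noteq> ?g 1" using inj_onD[OF inj, of "1/2"] by fastforce+
    moreover have "?g (1/2) \<in> path_image ?g" unfolding path_image_def by (intro imageI) auto
    ultimately have "?g (1/2) \<notin> curve" "?g (1/2) \<in> path_image ?g"
      using meet g by (auto simp: pathstart_def pathfinish_def)
    then show ?thesis using right_iff_W[OF 1(1) inc(1) a(2)] right_iff_W[OF 1(2) inc(2) a(2)] by blast
  next
    case 2
    then show ?thesis using right_iff_W[OF 2(1) inc(1) a(2) ends(2)] pos_notin_curve by (simp add: right_of_cycle_def)
  next
    case 3
    then show ?thesis using right_iff_W[OF 3(2) inc(2) a(2) ends(1)] pos_notin_curve by (simp add: right_of_cycle_def)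
  next
    case 4
    then have disj: "path_image ?g \<inter> curve = {}" using meet by auto
    obtain x where x: "x \<in> S" using cyclic by (auto simp: cyclic_on_def)
    obtain J where J: "simple_path J" "pathfinish J = pathstart J" "path_image J = curve"
      "\<And>y. y \<notin> curve \<Longrightarrow> winding_number J y = W y"
      using closed_curve_at[OF x prev[OF x]] by metis
    have "winding_number J (pos (fst a)) = winding_number J (pos (snd a))"
      using disj J ends g(1) by (intro winding_number_eq[where S = "path_image ?g"]) (auto simp: simple_path_imp_path connected_arc_image)
    then show ?thesis using J(4) pos_notin_curve 4 by (simp add: right_of_cycle_def)
  qed
qed

end

section \<open>Jaeger trees of plane graphs\<close>

lemma plane_cycle_colouring:
  fixes G :: "'v::finite pair_pre_digraph"
  assumes "oriented_simple_graph G" "pverts G = UNIV" "plane_embedding G pos \<gamma>"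
    "positive_ribbon_structure G pos \<gamma> \<rho>" "oriented_cycle (parcs G) S nx ed"
  shows "\<exists>col. cycle_colouring G \<rho> S nx ed col"
proof -
  interpret plane_cycle G pos \<gamma> \<rho> S nx ed
    using assms by unfold_locales (auto simp: oriented_cycle_def)
  show ?thesis
    unfolding cycle_colouring_def using right_rotate right_across right_cycle by (intro exI[of _ right_of_cycle]) blast
qed

theorem proposition8p5:
  fixes G :: "'v::finite pair_pre_digraph"
    and pos :: "'v \<Rightarrow> complex"
    and \<gamma> :: "'v \<times> 'v \<Rightarrow> real \<Rightarrow> complex"
    and \<rho> :: "'v ribbon"
    and b :: "'v \<times> ('v \<times> 'v)"
  assumes "oriented_simple_graph G"
    and "pverts G = UNIV"
    and "Digraph_Component.connected (with_proj G)"
    and "semi_balanced G"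
    and "plane_embedding G pos \<gamma>"
    and "positive_ribbon_structure G pos \<gamma> \<rho>"
    and "basis_pair G b"
  shows "triangulation_of (root_polytope (parcs G)) {root_polytope T | T. jaeger_tree G \<rho> b T}"
proof -
  interpret toured_graph G \<rho> b
    using assms by unfold_locales (auto simp: positive_ribbon_structure_def)
  show ?thesis
    using plane_cycle_colouring[OF assms(1,2,5,6)] by (intro jaeger_triangulation) blast
qed

end
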